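(* Suppose $n\ge d$ and let $\omega=(1^d)=(1,\dots,1,0,\dots,0)\in\Lambda(n,d)$. Then the elements $E_A1_\lambda F_C$ ($A,C\in\mathbb{N}^{\Phi^+}$, $\lambda\in\Lambda(n,d)$) of $\mathbf{Y}_+=\bigcup_{\lambda\in\Lambda(n,d)}\{E_A1_\lambda F_C\mid\chi(E_AF_C)\preceq\lambda\}$ satisfying the condition $$\lambda+\sum_{\alpha\in\Phi^+}A(\alpha)\alpha=\omega=\lambda+\sum_{\alpha\in\Phi^+}C(\alpha)\alpha$$ form an $\mathcal{A}$-basis of the algebra $1_\omega\mathbf{S}_{\mathcal{A}}(n,d)1_\omega$ (the $\mathcal{A}$-form of the Hecke algebra $\mathbf{H}(\Sigma_d)\cong1_\omega\mathbf{S}(n,d)1_\omega$).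
   Context: $n\ge1$, $d\ge0$ are integers, $\mathbb{N}=\{0,1,2,\dots\}$, $v$ is an indeterminate, $\mathcal{A}=\mathbb{Z}[v,v^{-1}]$. $\varepsilon_1,\dots,\varepsilon_n$ is the standard orthonormal basis of $\mathbb{R}^n$; $\Phi^+=\{\varepsilon_i-\varepsilon_j\mid i<j\}$, $\alpha_i=\varepsilon_i-\varepsilon_{i+1}$. $\mathbf{U}=\mathbf{U}(\mathfrak{gl}_n)$ is the $\mathbb{Q}(v)$-algebra with generators $E_i,F_i$ ($1\le i\le n-1$), $K_i^{\pm1}$ ($1\le i\le n$) and relations: $K_iK_j=K_jK_i$, $K_iK_i^{-1}=K_i^{-1}K_i=1$; $E_iF_j-F_jE_i=\delta_{ij}(K_iK_{i+1}^{-1}-K_i^{-1}K_{i+1})/(v-v^{-1})$; $K_iE_j=v^{(\varepsilon_i,\alpha_j)}E_jK_i$, $K_iF_j=v^{-(\varepsilon_i,\alpha_j)}F_jK_i$; $E_i^2E_j-(v+v^{-1})E_iE_jE_i+E_jE_i^2=0$ for $|i-j|=1$, $E_iE_j=E_jE_i$ otherwise; and the same two relations with $F$ in place of $E$. $\mathbf{V}$ is the natural module with basis $w_1,\dots,w_n$: $K_iw_j=v^{\delta_{ij}}w_j$, $E_iw_j=\delta_{j,i+1}w_i$, $F_iw_j=\delta_{ij}w_{i+1}$; $\mathbf{U}$ acts on $\mathbf{V}^{\otimes d}$ through a standard comultiplication, e.g. $\Delta(K_i)=K_i\otimes K_i$, $\Delta(E_i)=E_i\otimes K_iK_{i+1}^{-1}+1\otimes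 E_i$, $\Delta(F_i)=F_i\otimes1+K_i^{-1}K_{i+1}\otimes F_i$. $\mathbf{S}(n,d)$ is the image of $\mathbf{U}\to\operatorname{End}(\mathbf{V}^{\otimes d})$; images are denoted by the same symbols. $\mathbf{S}_{\mathcal{A}}(n,d)$ is the $\mathcal{A}$-subalgebra of elements of $\mathbf{S}(n,d)$ preserving the lattice $\mathbf{V}_{\mathcal{A}}^{\otimes d}$, $\mathbf{V}_{\mathcal{A}}=\bigoplus_j\mathcal{A}w_j$; equivalently (Du) the $\mathcal{A}$-subalgebra generated by all $E_i^{(m)},F_i^{(m)},K_i^{\pm1},\begin{bmatrix} K_i \\ m \end{bmatrix}$. Notation: $[m]=(v^m-v^{-m})/(v-v^{-1})$, $[m]!=[m]\cdots[1]$, $[0]!=1$; $\begin{bmatrix} K_i \\ t \end{bmatrix}=\prod_{s=1}^t\frac{K_iv^{-s+1}-K_i^{-1}v^{s-1}}{v^s-v^{-s}}$, $\begin{bmatrix} K_i \\ 0 \end{bmatrix}=1$. $\Lambda(n,d)=\{\lambda\in\mathbb{N}^n\mid\sum\lambda_i=d\}$, $1_\lambda=\prod_i\begin{bmatrix} K_i \\ \lambda_i \end{bmatrix}$. Root vectors: for $\alpha=\varepsilon_i-\varepsilon_j$, $i<j$: if $j-i=1$, $X_\alpha=E_i$, $X_{-\alpha}=F_i$; if $j-i>1$, inductively $X_\alpha=v^{-1}E_iX_{\alpha-\alpha_i}-X_{\alpha-\alpha_i}E_i$, $X_{-\alpha}=vX_{-\alpha+\alpha_i}F_i-F_iX_{-\alpha+\alpha_i}$.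 $X_{\pm\alpha}^{(m)}=X_{\pm\alpha}^m/[m]!$. $E_A=\prod_{\alpha\in\Phi^+}X_\alpha^{(A(\alpha))}$, $F_C=\prod_{\alpha\in\Phi^+}X_{-\alpha}^{(C(\alpha))}$, products relative to any two fixed orders on $\Phi^+$. Content: $\chi(E_AF_C)=\sum_{\alpha=\varepsilon_i-\varepsilon_j\in\Phi^+}(A(\alpha)+C(\alpha))\varepsilon_j$. $\preceq$ is the componentwise order on $\mathbb{N}^n$. *)

theory Defs
  imports
    HOL.Modules
    "HOL-Library.Poly_Mapping"
    "HOL-Library.Function_Algebras"
    "HOL-Computational_Algebra.Fraction_Field"
begin

section \<open>The ground rings\<close>

text \<open>
  \<open>\<A> = \<int>[v, v\<^sup>-\<^sup>1]\<close> is the group ring of the additive group \<open>\<int>\<close>, and \<open>\<rat>(v)\<close> is its field of fractions.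
\<close>

type_synonym laurent = "int \<Rightarrow>\<^sub>0 int"
type_synonym qfield = "laurent fract"

definition of_laurent :: "laurent \<Rightarrow> qfield" where
  "of_laurent a = Fract a 1"

definition vv :: qfield where
  "vv = of_laurent (Poly_Mapping.single 1 1)"

definition qint :: "nat \<Rightarrow> qfield" where
  "qint m = (vv powi int m - vv powi (- int m)) / (vv - inverse vv)"

definition qfact :: "nat \<Rightarrow> qfield" where
  "qfact m = (\<Prod>s=1..m. qint s)"

lemma of_laurent_add: "of_laurent (a + b) = of_laurent a + of_laurent b"
  by (simp add: of_laurent_def)

lemma of_laurent_mult: "of_laurent (a * b) = of_laurent a * of_laurent b"
  by (simp add: of_laurent_def)

lemma of_laurent_1: "of_laurent 1 = 1"
  by (simp add: of_laurent_def One_fract_def)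

lemma inj_of_laurent: "inj of_laurent"
  by (auto simp: inj_on_def of_laurent_def eq_fract)

lemma vv_nonzero: "vv \<noteq> 0"
proof -
  have "Poly_Mapping.single 1 1 \<noteq> (0 :: laurent)"
    by (metis lookup_single_eq lookup_zero zero_neq_one)
  then show ?thesis
    by (simp add: vv_def of_laurent_def Zero_fract_def eq_fract)
qed


section \<open>Free algebras\<close>

datatype 'a fword = FWord (letters: "'a list")

instantiation fword :: (type) monoid_add
begin

definition zero_fword :: "'a fword" where
  "0 = FWord []"

definition plus_fword :: "'a fword \<Rightarrow> 'a fword \<Rightarrow> 'a fword" where
  "x + y = FWord (letters x @ letters y)"

instance
  by standard (simp_all add: zero_fword_def plus_fword_def)

end

text \<open>
  The monoid algebra of the free monoid, that is, the free associative unital \<open>\<rat>(v)\<close>-algebra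
  on \<^typ>\<open>'a\<close>; its multiplication is that of \<^theory>\<open>HOL-Library.Poly_Mapping\<close>.
\<close>

type_synonym 'a free_alg = "'a fword \<Rightarrow>\<^sub>0 qfield"

definition gen :: "'a \<Rightarrow> 'a free_alg" where
  "gen a = Poly_Mapping.single (FWord [a]) 1"

definition cst :: "qfield \<Rightarrow> 'a free_alg" where
  "cst c = Poly_Mapping.single 0 c"

definition lin_ext :: "('a fword \<Rightarrow> 'b free_alg) \<Rightarrow> 'a free_alg \<Rightarrow> 'b free_alg" where
  "lin_ext f t = (\<Sum>w\<in>Poly_Mapping.keys t. cst (Poly_Mapping.lookup t w) * f w)"


section \<open>Weights and roots\<close>

definition eps :: "nat \<Rightarrow> nat \<Rightarrow> int" where
  "eps i k = of_bool (k = i)"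

text \<open>The pair \<open>(i, j)\<close> stands for \<open>\<epsilon>\<^sub>i - \<epsilon>\<^sub>j\<close>.\<close>

definition root :: "nat \<times> nat \<Rightarrow> nat \<Rightarrow> int" where
  "root = (\<lambda>(i, j) k. eps i k - eps j k)"

definition pos_roots :: "nat \<Rightarrow> (nat \<times> nat) set" where
  "pos_roots n = {(i, j). 1 \<le> i \<and> i < j \<and> j \<le> n}"

definition inner_prod :: "nat \<Rightarrow> (nat \<Rightarrow> int) \<Rightarrow> (nat \<Rightarrow> int) \<Rightarrow> int" where
  "inner_prod n x y = (\<Sum>k=1..n. x k * y k)"

text \<open>
  Elements of \<open>\<nat>\<^sup>n\<close> and of \<open>\<nat>\<^bsup>\<Phi>\<^sup>+\<^esup>\<close> are functions vanishing outside \<open>{1..n}\<close> and outside \<open>\<Phi>\<^sup>+\<close>.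
\<close>

definition Lam :: "nat \<Rightarrow> nat \<Rightarrow> (nat \<Rightarrow> nat) set" where
  "Lam n d = {l. (\<forall>i. i \<notin> {1..n} \<longrightarrow> l i = 0) \<and> (\<Sum>i=1..n. l i) = d}"

definition omega :: "nat \<Rightarrow> nat \<Rightarrow> nat" where
  "omega d i = of_bool (1 \<le> i \<and> i \<le> d)"

definition root_exps :: "nat \<Rightarrow> (nat \<times> nat \<Rightarrow> nat) set" where
  "root_exps n = {A. \<forall>\<alpha>. \<alpha> \<notin> pos_roots n \<longrightarrow> A \<alpha> = 0}"

definition add_roots :: "nat \<Rightarrow> (nat \<Rightarrow> nat) \<Rightarrow> (nat \<times> nat \<Rightarrow> nat) \<Rightarrow> nat \<Rightarrow> int" where
  "add_roots n l A k = int (l k) + (\<Sum>\<alpha>\<in>pos_roots n. int (A \<alpha>) * root \<alpha> k)"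

definition content :: "nat \<Rightarrow> (nat \<times> nat \<Rightarrow> nat) \<Rightarrow> (nat \<times> nat \<Rightarrow> nat) \<Rightarrow> nat \<Rightarrow> nat" where
  "content n A C k = (\<Sum>\<alpha>\<in>pos_roots n. (A \<alpha> + C \<alpha>) * of_bool (snd \<alpha> = k))"


section \<open>The quantized enveloping algebra of \<open>gl\<^sub>n\<close>\<close>

datatype uq_gen = GE nat | GF nat | GK nat | GKinv nat

abbreviation E :: "nat \<Rightarrow> uq_gen free_alg" where "E i \<equiv> gen (GE i)"
abbreviation F :: "nat \<Rightarrow> uq_gen free_alg" where "F i \<equiv> gen (GF i)"
abbreviation K :: "nat \<Rightarrow> uq_gen free_alg" where "K i \<equiv> gen (GK i)"
abbreviation Kinv :: "nat \<Rightarrow> uq_gen free_alg" where "Kinv i \<equiv> gen (GKinv i)"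

definition uq_gens :: "nat \<Rightarrow> uq_gen set" where
  "uq_gens n = GE ` {1..<n} \<union> GF ` {1..<n} \<union> GK ` {1..n} \<union> GKinv ` {1..n}"

definition uq_free :: "nat \<Rightarrow> uq_gen free_alg set" where
  "uq_free n = {x. \<forall>w\<in>Poly_Mapping.keys x. set (letters w) \<subseteq> uq_gens n}"

text \<open>Each defining relation \<open>x = y\<close> is recorded as \<open>x - y\<close>.\<close>

inductive_set uq_relators :: "nat \<Rightarrow> uq_gen free_alg set" for n :: nat where
  KK: "\<lbrakk>i \<in> {1..n}; j \<in> {1..n}\<rbrakk> \<Longrightarrow> K i * K j - K j * K i \<in> uq_relators n"
| KKinv: "i \<in> {1..n} \<Longrightarrow> K i * Kinv i - 1 \<in> uq_relators n"
| KinvK: "i \<in> {1..n} \<Longrightarrow> Kinv i * K i - 1 \<in> uq_relators n"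
| EF: "\<lbrakk>i \<in> {1..<n}; j \<in> {1..<n}\<rbrakk> \<Longrightarrow>
    E i * F j - F j * E i
      - (if i = j then cst (1 / (vv - inverse vv)) * (K i * Kinv (i + 1) - Kinv i * K (i + 1)) else 0)
    \<in> uq_relators n"
| KE: "\<lbrakk>i \<in> {1..n}; j \<in> {1..<n}\<rbrakk> \<Longrightarrow>
    K i * E j - cst (vv powi inner_prod n (eps i) (root (j, j + 1))) * E j * K i \<in> uq_relators n"
| KF: "\<lbrakk>i \<in> {1..n}; j \<in> {1..<n}\<rbrakk> \<Longrightarrow>
    K i * F j - cst (vv powi (- inner_prod n (eps i) (root (j, j + 1)))) * F j * K i \<in> uq_relators n"
| EEE: "\<lbrakk>i \<in> {1..<n}; j \<in> {1..<n}; \<bar>int i - int j\<bar> = 1\<rbrakk> \<Longrightarrow>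
    E i ^ 2 * E j - cst (vv + inverse vv) * E i * E j * E i + E j * E i ^ 2 \<in> uq_relators n"
| EE: "\<lbrakk>i \<in> {1..<n}; j \<in> {1..<n}; \<bar>int i - int j\<bar> \<noteq> 1\<rbrakk> \<Longrightarrow>
    E i * E j - E j * E i \<in> uq_relators n"
| FFF: "\<lbrakk>i \<in> {1..<n}; j \<in> {1..<n}; \<bar>int i - int j\<bar> = 1\<rbrakk> \<Longrightarrow>
    F i ^ 2 * F j - cst (vv + inverse vv) * F i * F j * F i + F j * F i ^ 2 \<in> uq_relators n"
| FF: "\<lbrakk>i \<in> {1..<n}; j \<in> {1..<n}; \<bar>int i - int j\<bar> \<noteq> 1\<rbrakk> \<Longrightarrow>
    F i * F j - F j * F i \<in> uq_relators n"

inductive_set uq_ideal :: "nat \<Rightarrow> uq_gen free_alg set" for n :: nat where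
  relator: "r \<in> uq_relators n \<Longrightarrow> r \<in> uq_ideal n"
| zero: "0 \<in> uq_ideal n"
| add: "\<lbrakk>x \<in> uq_ideal n; y \<in> uq_ideal n\<rbrakk> \<Longrightarrow> x + y \<in> uq_ideal n"
| left: "\<lbrakk>a \<in> uq_free n; x \<in> uq_ideal n\<rbrakk> \<Longrightarrow> a * x \<in> uq_ideal n"
| right: "\<lbrakk>x \<in> uq_ideal n; a \<in> uq_free n\<rbrakk> \<Longrightarrow> x * a \<in> uq_ideal n"

definition uq_cong :: "nat \<Rightarrow> (uq_gen free_alg \<times> uq_gen free_alg) set" where
  "uq_cong n = {(x, y). x \<in> uq_free n \<and> y \<in> uq_free n \<and> x - y \<in> uq_ideal n}"

definition uq_class :: "nat \<Rightarrow> uq_gen free_alg \<Rightarrow> uq_gen free_alg set" where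
  "uq_class n x = uq_cong n `` {x}"

definition uq :: "nat \<Rightarrow> uq_gen free_alg set set" where
  "uq n = uq_free n // uq_cong n"

text \<open>Elements of \<^term>\<open>uq n\<close>, given by representatives in the free algebra.\<close>

definition div_pow :: "uq_gen free_alg \<Rightarrow> nat \<Rightarrow> uq_gen free_alg" where
  "div_pow x m = cst (1 / qfact m) * x ^ m"

definition K_binom :: "nat \<Rightarrow> nat \<Rightarrow> uq_gen free_alg" where
  "K_binom i t = (\<Prod>s\<leftarrow>[1..<Suc t].
     cst (1 / (vv powi int s - vv powi (- int s))) *
     (cst (vv powi (1 - int s)) * K i - cst (vv powi (int s - 1)) * Kinv i))"

definition weight_idem :: "nat \<Rightarrow> (nat \<Rightarrow> nat) \<Rightarrow> uq_gen free_alg" where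
  "weight_idem n l = (\<Prod>i\<leftarrow>[1..<Suc n]. K_binom i (l i))"

function root_vec_pos :: "nat \<Rightarrow> nat \<Rightarrow> uq_gen free_alg" where
  "root_vec_pos i j = (if j \<le> i + 1 then E i
     else cst (inverse vv) * E i * root_vec_pos (i + 1) j - root_vec_pos (i + 1) j * E i)"
  by auto
termination by (relation "measure (\<lambda>(i, j). j - i)") auto

function root_vec_neg :: "nat \<Rightarrow> nat \<Rightarrow> uq_gen free_alg" where
  "root_vec_neg i j = (if j \<le> i + 1 then F i
     else cst vv * root_vec_neg (i + 1) j * F i - F i * root_vec_neg (i + 1) j)"
  by auto
termination by (relation "measure (\<lambda>(i, j). j - i)") auto

declare root_vec_pos.simps [simp del] root_vec_neg.simps [simp del]

definition E_mon :: "(nat \<times> nat) list \<Rightarrow> (nat \<times> nat \<Rightarrow> nat) \<Rightarrow> uq_gen free_alg" where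
  "E_mon rs A = (\<Prod>\<alpha>\<leftarrow>rs. div_pow (root_vec_pos (fst \<alpha>) (snd \<alpha>)) (A \<alpha>))"

definition F_mon :: "(nat \<times> nat) list \<Rightarrow> (nat \<times> nat \<Rightarrow> nat) \<Rightarrow> uq_gen free_alg" where
  "F_mon rs C = (\<Prod>\<alpha>\<leftarrow>rs. div_pow (root_vec_neg (fst \<alpha>) (snd \<alpha>)) (C \<alpha>))"


section \<open>The action on tensor space\<close>

text \<open>
  \<open>V\<^bsup>\<otimes>d\<^esup>\<close> is realized inside the tensor algebra, the free algebra on the symbols \<open>w\<^sub>j\<close>: the word
  \<open>j\<^sub>1 \<dots> j\<^sub>d\<close> is \<open>w\<^bsub>j\<^sub>1\<^esub> \<otimes> \<dots> \<otimes> w\<^bsub>j\<^sub>d\<^esub>\<close>, and \<open>\<otimes>\<close> is the product. An element of \<open>End(V\<^bsup>\<otimes>d\<^esup>)\<close> is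
  represented by its extension that kills all words not belonging to \<open>V\<^bsup>\<otimes>d\<^esup>\<close>; in particular
  the identity of \<open>V\<^bsup>\<otimes>d\<^esup>\<close> is the projection \<open>tens_id n d\<close>.
\<close>

type_synonym tens = "nat free_alg"

definition tens_words :: "nat \<Rightarrow> nat \<Rightarrow> nat fword set" where
  "tens_words n d = {w. length (letters w) = d \<and> set (letters w) \<subseteq> {1..n}}"

definition tens_id :: "nat \<Rightarrow> nat \<Rightarrow> tens \<Rightarrow> tens" where
  "tens_id n d = lin_ext (\<lambda>w. if w \<in> tens_words n d then Poly_Mapping.single w 1 else 0)"

primrec nat_act :: "uq_gen \<Rightarrow> nat \<Rightarrow> tens" where
  "nat_act (GE i) j = (if j = i + 1 then gen i else 0)"
| "nat_act (GF i) j = (if j = i then gen (i + 1) else 0)"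
| "nat_act (GK i) j = cst (if j = i then vv else 1) * gen j"
| "nat_act (GKinv i) j = cst (if j = i then inverse vv else 1) * gen j"

definition nat_op :: "nat \<Rightarrow> uq_gen \<Rightarrow> tens \<Rightarrow> tens" where
  "nat_op n g = lin_ext (\<lambda>w. if w \<in> tens_words n 1 then nat_act g (hd (letters w)) else 0)"

definition tensor_op :: "(tens \<Rightarrow> tens) \<Rightarrow> (tens \<Rightarrow> tens) \<Rightarrow> tens \<Rightarrow> tens" where
  "tensor_op f g = lin_ext (\<lambda>w. case letters w of [] \<Rightarrow> 0
     | x # xs \<Rightarrow> f (gen x) * g (Poly_Mapping.single (FWord xs) 1))"

text \<open>
  The action on \<open>V\<^bsup>\<otimes>(d+1)\<^esup> = V \<otimes> V\<^bsup>\<otimes>d\<^esup>\<close> is through the comultiplication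
  \<open>\<Delta>(K\<^sub>i) = K\<^sub>i \<otimes> K\<^sub>i\<close>, \<open>\<Delta>(E\<^sub>i) = E\<^sub>i \<otimes> K\<^sub>i K\<^bsub>i+1\<^esub>\<^sup>-\<^sup>1 + 1 \<otimes> E\<^sub>i\<close>,
  \<open>\<Delta>(F\<^sub>i) = F\<^sub>i \<otimes> 1 + K\<^sub>i\<^sup>-\<^sup>1 K\<^bsub>i+1\<^esub> \<otimes> F\<^sub>i\<close>, and on \<open>V\<^bsup>\<otimes>0\<^esup>\<close> through the counit.
\<close>

primrec tens_op :: "nat \<Rightarrow> nat \<Rightarrow> uq_gen \<Rightarrow> tens \<Rightarrow> tens" where
  "tens_op n 0 g = (case g of GE i \<Rightarrow> 0 | GF i \<Rightarrow> 0 | GK i \<Rightarrow> tens_id n 0 | GKinv i \<Rightarrow> tens_id n 0)"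
| "tens_op n (Suc d) g = (case g of
      GE i \<Rightarrow> tensor_op (nat_op n (GE i)) (tens_op n d (GK i) \<circ> tens_op n d (GKinv (i + 1)))
              + tensor_op (tens_id n 1) (tens_op n d (GE i))
    | GF i \<Rightarrow> tensor_op (nat_op n (GF i)) (tens_id n d)
              + tensor_op (nat_op n (GKinv i) \<circ> nat_op n (GK (i + 1))) (tens_op n d (GF i))
    | GK i \<Rightarrow> tensor_op (nat_op n (GK i)) (tens_op n d (GK i))
    | GKinv i \<Rightarrow> tensor_op (nat_op n (GKinv i)) (tens_op n d (GKinv i)))"

definition word_op :: "nat \<Rightarrow> nat \<Rightarrow> uq_gen fword \<Rightarrow> tens \<Rightarrow> tens" where
  "word_op n d w = foldr (\<lambda>g f. tens_op n d g \<circ> f) (letters w) (tens_id n d)"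

definition free_act :: "nat \<Rightarrow> nat \<Rightarrow> uq_gen free_alg \<Rightarrow> tens \<Rightarrow> tens" where
  "free_act n d u t =
     (\<Sum>w\<in>Poly_Mapping.keys u. cst (Poly_Mapping.lookup u w) * word_op n d w t)"

text \<open>The action of the quotient algebra; well defined by \<open>uq_rep_class\<close> below.\<close>

definition uq_rep :: "nat \<Rightarrow> nat \<Rightarrow> uq_gen free_alg set \<Rightarrow> tens \<Rightarrow> tens" where
  "uq_rep n d c = the_elem (free_act n d ` c)"


section \<open>The \<open>q\<close>-Schur algebra\<close>

definition schur :: "nat \<Rightarrow> nat \<Rightarrow> (tens \<Rightarrow> tens) set" where
  "schur n d = uq_rep n d ` uq n"

definition schur_elt :: "nat \<Rightarrow> nat \<Rightarrow> uq_gen free_alg \<Rightarrow> tens \<Rightarrow> tens" where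
  "schur_elt n d x = uq_rep n d (uq_class n x)"

definition tens_lattice :: "nat \<Rightarrow> nat \<Rightarrow> tens set" where
  "tens_lattice n d = {t. Poly_Mapping.keys t \<subseteq> tens_words n d \<and>
     (\<forall>w. Poly_Mapping.lookup t w \<in> range of_laurent)}"

definition schur_A :: "nat \<Rightarrow> nat \<Rightarrow> (tens \<Rightarrow> tens) set" where
  "schur_A n d = {f \<in> schur n d. f ` tens_lattice n d \<subseteq> tens_lattice n d}"

definition hecke_A :: "nat \<Rightarrow> nat \<Rightarrow> (tens \<Rightarrow> tens) set" where
  "hecke_A n d = {schur_elt n d (weight_idem n (omega d)) \<circ> f \<circ>
                  schur_elt n d (weight_idem n (omega d)) | f. f \<in> schur_A n d}"

definition laurent_scale :: "laurent \<Rightarrow> (tens \<Rightarrow> tens) \<Rightarrow> tens \<Rightarrow> tens" where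
  "laurent_scale a f = (\<lambda>t. cst (of_laurent a) * f t)"

lemma cst_add: "cst (a + b) = cst a + cst b"
  by (simp add: cst_def single_add)

lemma cst_mult: "cst (a * b) = cst a * cst b"
  by (simp add: cst_def mult_single)

lemma cst_1: "cst 1 = 1"
  by (simp add: cst_def)

global_interpretation laurent_mod: module laurent_scale
  by standard
    (auto simp: laurent_scale_def fun_eq_iff of_laurent_add of_laurent_mult of_laurent_1
      cst_add cst_mult cst_1 algebra_simps)

definition is_A_basis :: "('i \<Rightarrow> tens \<Rightarrow> tens) \<Rightarrow> 'i set \<Rightarrow> (tens \<Rightarrow> tens) set \<Rightarrow> bool" where
  "is_A_basis b I M \<longleftrightarrow>
     inj_on b I \<and> \<not> laurent_mod.dependent (b ` I) \<and> laurent_mod.span (b ` I) = M"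

text \<open>The triples \<open>(A, \<lambda>, C)\<close> indexing the elements \<open>E\<^sub>A 1\<^sub>\<lambda> F\<^sub>C\<close> of \<open>Y\<^sub>+\<close>.\<close>

definition Y_plus_index ::
  "nat \<Rightarrow> nat \<Rightarrow> ((nat \<times> nat \<Rightarrow> nat) \<times> (nat \<Rightarrow> nat) \<times> (nat \<times> nat \<Rightarrow> nat)) set" where
  "Y_plus_index n d = {(A, l, C). A \<in> root_exps n \<and> l \<in> Lam n d \<and> C \<in> root_exps n \<and>
     content n A C \<le> l}"


section \<open>The action respects the defining relations\<close>

definition scl :: "qfield \<Rightarrow> 'a free_alg \<Rightarrow> 'a free_alg" where "scl c t = cst c * t"

definition lin :: "('a free_alg \<Rightarrow> 'b free_alg) \<Rightarrow> bool" where
  "lin f \<longleftrightarrow> (\<forall>x y. f (x + y) = f x + f y) \<and> (\<forall>c x. f (cst c * x) = cst c * f x)"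

lemma lin_simps:
  assumes "lin f"
  shows "f (x + y) = f x + f y" "f (cst c * x) = cst c * f x" "f 0 = 0" "f (- x) = - f x"
    "f (x - y) = f x - f y"
proof -
  show 1: "f (x + y) = f x + f y" for x y using assms by (simp add: lin_def)
  show "f (cst c * x) = cst c * f x" for c x using assms by (simp add: lin_def)
  show 0: "f 0 = 0" using 1[of 0 0] by simp
  show m: "f (- x) = - f x" for x using 1[of x "- x"] 0 by (simp add: eq_neg_iff_add_eq_0 add.commute)
  show "f (x - y) = f x - f y" using 1[of x "- y"] m by simp
qed

lemma lin_sum: "lin f \<Longrightarrow> f (sum g S) = (\<Sum>x\<in>S. f (g x))"
  by (induction S rule: infinite_finite_induct) (auto simp: lin_simps)

lemma sum_mono: "(\<Sum>w\<in>Poly_Mapping.keys t. Poly_Mapping.single w (Poly_Mapping.lookup t w)) = t"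
  by (rule poly_mapping_eqI)
    (auto simp: lookup_sum lookup_single when_def in_keys_iff sum.delta[OF Poly_Mapping.finite_keys])

lemma sum_keys: "t = (\<Sum>w\<in>Poly_Mapping.keys t. cst (Poly_Mapping.lookup t w) * Poly_Mapping.single w 1)"
  for t :: "'a free_alg"
  by (simp add: cst_def mult_single sum_mono)

lemma lookup_cst: "Poly_Mapping.lookup (cst c * t) w = c * Poly_Mapping.lookup t w"
proof -
  have "cst c * t = (\<Sum>w\<in>Poly_Mapping.keys t. Poly_Mapping.single w (c * Poly_Mapping.lookup t w))"
    by (subst (2) sum_mono[symmetric])
      (simp add: sum_distrib_left cst_def mult_single)
  then show ?thesis
    by (simp add: lookup_sum lookup_single when_def in_keys_iff if_distrib cong: if_cong)
qed

lemma cst_comm: "t * cst c = cst c * t"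
proof -
  have "t * cst c = (\<Sum>w\<in>Poly_Mapping.keys t. Poly_Mapping.single w (c * Poly_Mapping.lookup t w))"
    by (subst sum_mono[symmetric])
      (simp add: sum_distrib_right cst_def mult_single mult.commute)
  also have "\<dots> = cst c * t"
    by (subst (3) sum_mono[symmetric])
      (simp add: sum_distrib_left cst_def mult_single)
  finally show ?thesis .
qed

lemma lin_ext_superset:
  assumes "finite S" "Poly_Mapping.keys t \<subseteq> S"
  shows "lin_ext f t = (\<Sum>w\<in>S. cst (Poly_Mapping.lookup t w) * f w)"
  unfolding lin_ext_def
  by (rule sum.mono_neutral_left) (use assms in \<open>auto simp: in_keys_iff cst_def\<close>)

lemma lin_lin_ext: "lin (lin_ext f)"
  unfolding lin_def
proof (intro conjI allI)
  fix x y :: "'a free_alg" and c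
  let ?S = "Poly_Mapping.keys x \<union> Poly_Mapping.keys y"
  have "Poly_Mapping.keys (x + y) \<subseteq> ?S" by (rule Poly_Mapping.keys_add)
  then show "lin_ext f (x + y) = lin_ext f x + lin_ext f y"
    by (simp add: lin_ext_superset[of ?S] lookup_add cst_add distrib_right sum.distrib)
  have "Poly_Mapping.keys (cst c * x) \<subseteq> Poly_Mapping.keys x"
    by (auto simp: in_keys_iff lookup_cst)
  then show "lin_ext f (cst c * x) = cst c * lin_ext f x"
    by (simp add: lin_ext_superset[of "Poly_Mapping.keys x"] lookup_cst cst_mult mult.assoc sum_distrib_left)
qed

lemma lin_ext_single [simp]: "lin_ext f (Poly_Mapping.single w 1) = f w"
  by (simp add: lin_ext_def cst_1)

lemma lin_eqI:
  assumes "lin f" "lin g" "\<And>w. f (Poly_Mapping.single w 1) = g (Poly_Mapping.single w 1)"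
  shows "f t = g t"
  by (subst (1 2) sum_keys) (simp add: lin_sum lin_simps assms)

lemma lin_add: "lin f \<Longrightarrow> lin g \<Longrightarrow> lin (f + g)"
  by (simp add: lin_def algebra_simps)
lemma lin_comp: "lin f \<Longrightarrow> lin g \<Longrightarrow> lin (f \<circ> g)"
  by (simp add: lin_def)
lemma lin_zero: "lin 0" by (simp add: lin_def)
lemma lin_cst: "lin (\<lambda>t. cst c * t)"
  by (simp add: lin_def algebra_simps) (metis cst_comm mult.assoc)
lemma lin_lmult: "lin (\<lambda>t. a * t)"
  by (simp add: lin_def algebra_simps) (metis cst_comm mult.assoc)

lemma lin_tens_id: "lin (tens_id n d)" by (simp add: tens_id_def lin_lin_ext)
lemma lin_nat_op: "lin (nat_op n g)" by (simp add: nat_op_def lin_lin_ext)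
lemma lin_tensor_op: "lin (tensor_op f g)" by (simp add: tensor_op_def lin_lin_ext)
lemma lin_tens_op: "lin (tens_op n d g)"
  by (cases d; cases g) (auto simp: lin_zero lin_tens_id intro!: lin_add lin_tensor_op)

lemma gen_mult_single: "gen x * Poly_Mapping.single w 1 = Poly_Mapping.single (FWord (x # letters w)) 1"
  by (simp add: gen_def mult_single plus_fword_def)

lemma tensor_op_cons: "lin g \<Longrightarrow> tensor_op f g (gen x * t) = f (gen x) * g t"
proof (rule lin_eqI[of "\<lambda>t. tensor_op f g (gen x * t)" "\<lambda>t. f (gen x) * g t"])
  assume g: "lin g"
  show "lin (\<lambda>t. tensor_op f g (gen x * t))"
    using lin_comp[OF lin_tensor_op[of f g] lin_lmult[of "gen x"]] by (simp add: o_def)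
  show "lin (\<lambda>t. f (gen x) * g t)"
    using lin_comp[OF lin_lmult[of "f (gen x)"] g] by (simp add: o_def)
  show "tensor_op f g (gen x * Poly_Mapping.single w 1) = f (gen x) * g (Poly_Mapping.single w 1)" for w
    by (simp add: gen_mult_single tensor_op_def)
qed


lemma single_Nil: "Poly_Mapping.single (FWord []) 1 = (1 :: 'a free_alg)"
  by (metis zero_fword_def single_one)

lemma cons_eqI:
  assumes "lin f" "lin g" "f 1 = g 1" "\<And>x t. f (gen x * t) = g (gen x * t)"
  shows "f t = g t"
proof (rule lin_eqI[OF assms(1,2)])
  fix w
  show "f (Poly_Mapping.single w 1) = g (Poly_Mapping.single w 1)"
  proof (cases w)
    case (FWord xs)
    then show ?thesis
      using assms(3) assms(4)[of "hd xs" "Poly_Mapping.single (FWord (tl xs)) 1"]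
      by (cases xs) (auto simp: single_Nil gen_mult_single)
  qed
qed

lemma tensor_op_1: "tensor_op f g 1 = 0"
  unfolding single_Nil[symmetric] tensor_op_def by (subst lin_ext_single) simp

lemma tens_id_single:
  "tens_id n d (Poly_Mapping.single w 1) = (if w \<in> tens_words n d then Poly_Mapping.single w 1 else 0)"
  by (simp add: tens_id_def)

lemma tens_id_Suc_1: "tens_id n (Suc d) 1 = 0"
  unfolding single_Nil[symmetric] tens_id_single by (simp add: tens_words_def)

lemma tens_id_cons: "tens_id n (Suc d) (gen x * t) = (if x \<in> {1..n} then gen x * tens_id n d t else 0)"
proof (rule lin_eqI[of "\<lambda>t. tens_id n (Suc d) (gen x * t)" "\<lambda>t. if x \<in> {1..n} then gen x * tens_id n d t else 0"])
  show "lin (\<lambda>t. tens_id n (Suc d) (gen x * t))"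
    using lin_comp[OF lin_tens_id lin_lmult[of "gen x"]] by (simp add: o_def)
  show "lin (\<lambda>t. if x \<in> {1..n} then gen x * tens_id n d t else 0)"
    using lin_comp[OF lin_lmult[of "gen x"] lin_tens_id, of n d] by (auto simp: o_def lin_def)
  show "tens_id n (Suc d) (gen x * Poly_Mapping.single w 1)
     = (if x \<in> {1..n} then gen x * tens_id n d (Poly_Mapping.single w 1) else 0)" for w
    by (auto simp: gen_mult_single tens_id_single tens_words_def)
qed

lemma tens_id_1_gen: "tens_id n (Suc 0) (gen x) = (if x \<in> {1..n} then gen x else 0)"
  by (simp add: gen_def tens_id_single tens_words_def)

lemma nat_op_gen: "nat_op n g (gen x) = (if x \<in> {1..n} then nat_act g x else 0)"
  by (simp add: gen_def nat_op_def tens_words_def)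

lemma scl_simps:
  "scl a (scl b t) = scl (a * b) t" "scl 1 t = t" "scl c x * y = scl c (x * y)"
  "x * scl c y = scl c (x * y)" "scl c (x + y) = scl c x + scl c y" "scl c (x - y) = scl c x - scl c y"
  "scl c 0 = 0" "scl c (- x) = - scl c x"
  by (simp_all add: scl_def cst_mult cst_1 mult.assoc algebra_simps) (metis cst_comm mult.assoc)

lemma lin_scl: "lin f \<Longrightarrow> f (scl c t) = scl c (f t)"
  by (simp add: scl_def lin_simps)

definition kc :: "nat \<Rightarrow> nat \<Rightarrow> int" where "kc i x = of_bool (x = i)"

lemma nat_op_K: "nat_op n (GK i) (gen x) = (if x \<in> {1..n} then scl (vv powi kc i x) (gen x) else 0)"
  and nat_op_Ki: "nat_op n (GKinv i) (gen x) = (if x \<in> {1..n} then scl (vv powi (- kc i x)) (gen x) else 0)"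
  by (auto simp: nat_op_gen scl_def kc_def)

lemma nat_op_scl: "nat_op n g (scl c t) = scl c (nat_op n g t)"
  by (rule lin_scl[OF lin_nat_op])

lemma op_1: "tens_op n (Suc d) g 1 = 0"
  by (cases g) (simp_all add: tensor_op_1)

lemma op_K: "tens_op n (Suc d) (GK i) (gen x * t) =
    (if x \<in> {1..n} then scl (vv powi kc i x) (gen x * tens_op n d (GK i) t) else 0)"
  and op_Ki: "tens_op n (Suc d) (GKinv i) (gen x * t) =
    (if x \<in> {1..n} then scl (vv powi (- kc i x)) (gen x * tens_op n d (GKinv i) t) else 0)"
  by (simp_all add: tensor_op_cons lin_tens_op nat_op_K nat_op_Ki scl_simps)

lemma op_E: "tens_op n (Suc d) (GE i) (gen x * t) = (if x \<in> {1..n} then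
     (if x = Suc i then gen i * tens_op n d (GK i) (tens_op n d (GKinv (Suc i)) t) else 0)
     + gen x * tens_op n d (GE i) t else 0)"
  by (auto simp: tensor_op_cons lin_tens_op lin_comp nat_op_gen tens_id_1_gen)

lemma nat_op_KiK: "nat_op n (GKinv i) (nat_op n (GK (Suc i)) (gen x)) =
    (if x \<in> {1..n} then scl (vv powi (kc (Suc i) x - kc i x)) (gen x) else 0)"
  by (simp add: nat_op_K nat_op_Ki nat_op_scl scl_simps power_int_diff power_int_minus vv_nonzero
      field_simps lin_simps[OF lin_nat_op])

lemma op_F: "tens_op n (Suc d) (GF i) (gen x * t) = (if x \<in> {1..n} then
     (if x = i then gen (Suc i) * tens_id n d t else 0)
     + scl (vv powi (kc (Suc i) x - kc i x)) (gen x * tens_op n d (GF i) t) else 0)"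
  by (simp add: tensor_op_cons lin_tens_op lin_tens_id nat_op_KiK scl_simps nat_op_gen[of n "GF i"])

lemmas op_rules = op_1 op_K op_Ki op_E op_F tens_id_Suc_1 tens_id_cons
declare tens_op.simps(2) [simp del]

lemma tens_id_idem: "tens_id n d (tens_id n d t) = tens_id n d t"
  by (rule lin_eqI[of "\<lambda>t. tens_id n d (tens_id n d t)" "tens_id n d"])
    (auto simp: lin_tens_id tens_id_single lin_simps[OF lin_tens_id] intro: lin_comp[OF lin_tens_id lin_tens_id, unfolded o_def])

lemma op_id: "tens_op n d g (tens_id n d t) = tens_op n d g t"
proof (induction d arbitrary: g t)
  case 0
  then show ?case by (cases g) (simp_all add: tens_id_idem)
next
  case (Suc d)
  show ?case
    by (rule cons_eqI[of "\<lambda>t. tens_op n (Suc d) g (tens_id n (Suc d) t)" "tens_op n (Suc d) g"];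
       (cases g)?; auto simp: op_rules lin_tens_op lin_simps[OF lin_tens_op] Suc.IH tens_id_idem
         intro: lin_comp[OF lin_tens_op lin_tens_id, unfolded o_def])
qed

lemma id_op: "g \<in> uq_gens n \<Longrightarrow> tens_id n d (tens_op n d g t) = tens_op n d g t"
proof (induction d arbitrary: g t)
  case 0
  then show ?case by (cases g) (simp_all add: tens_id_idem lin_simps[OF lin_tens_id])
next
  case (Suc d)
  have KK: "tens_id n d (tens_op n d (GK i) s) = tens_op n d (GK i) s" if "i \<in> {1..n}" for i s
    using Suc.IH that by (auto simp: uq_gens_def)
  show ?case
  proof (rule cons_eqI[of "\<lambda>t. tens_id n (Suc d) (tens_op n (Suc d) g t)" "tens_op n (Suc d) g"])
    show "lin (\<lambda>t. tens_id n (Suc d) (tens_op n (Suc d) g t))"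
      by (intro lin_comp[OF lin_tens_id lin_tens_op, unfolded o_def])
    show "lin (tens_op n (Suc d) g)" by (rule lin_tens_op)
    show "tens_id n (Suc d) (tens_op n (Suc d) g 1) = tens_op n (Suc d) g 1"
      by (simp add: op_rules lin_simps[OF lin_tens_id])
    fix x t
    show "tens_id n (Suc d) (tens_op n (Suc d) g (gen x * t)) = tens_op n (Suc d) g (gen x * t)"
      using Suc.prems Suc.IH[OF Suc.prems]
      by (cases g) (auto simp: uq_gens_def op_rules lin_simps[OF lin_tens_id] lin_scl[OF lin_tens_id] KK tens_id_idem)
  qed
qed


lemma lookup_scl: "Poly_Mapping.lookup (scl c t) w = c * Poly_Mapping.lookup t w"
  by (simp add: scl_def lookup_cst)

lemma powi_mult: "vv powi a * vv powi b = vv powi (a + b)"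
  by (simp add: power_int_add vv_nonzero)

lemmas op_lin = lin_simps[OF lin_tens_op] lin_scl[OF lin_tens_op]

fun isK :: "uq_gen \<Rightarrow> bool" where
  "isK (GK i) = True" | "isK (GKinv i) = True" | "isK (GE i) = False" | "isK (GF i) = False"

lemma lin_op2: "lin (\<lambda>t. tens_op n d g (tens_op n d h t))"
  by (intro lin_comp[OF lin_tens_op lin_tens_op, unfolded o_def])
lemma lin_op3: "lin (\<lambda>t. tens_op n d g (tens_op n d h (tens_op n d k t)))"
  by (intro lin_comp[OF lin_tens_op lin_op2, unfolded o_def])
lemma lin_sclf: "lin f \<Longrightarrow> lin (\<lambda>t. scl c (f t))"
  unfolding scl_def by (rule lin_comp[OF lin_cst, unfolded o_def])
lemma lin_addf: "lin f \<Longrightarrow> lin g \<Longrightarrow> lin (\<lambda>t. f t + g t)"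
  using lin_add[of f g] by (simp add: plus_fun_def)
lemma lin_difff: "lin f \<Longrightarrow> lin g \<Longrightarrow> lin (\<lambda>t. f t - g t)"
  by (simp add: lin_def algebra_simps)
lemma lin_0f: "lin (\<lambda>t. 0)" by (simp add: lin_def)

lemmas lin_intros = lin_op2 lin_op3 lin_sclf lin_addf lin_difff lin_0f lin_tens_op lin_tens_id

lemma R_KK:
  "isK g \<Longrightarrow> isK h \<Longrightarrow> tens_op n d g (tens_op n d h t) = tens_op n d h (tens_op n d g t)"
proof (induction d arbitrary: t)
  case 0
  then show ?case by (cases g; cases h) auto
next
  case (Suc d)
  show ?case
    by (rule cons_eqI[of "\<lambda>t. tens_op n (Suc d) g (tens_op n (Suc d) h t)"
        "\<lambda>t. tens_op n (Suc d) h (tens_op n (Suc d) g t)"], rule lin_intros, rule lin_intros)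
      (insert Suc, (cases g; cases h; auto simp: op_rules op_lin scl_simps powi_mult mult.commute add.commute)+)
qed

lemma R_KKi: "tens_op n d (GK i) (tens_op n d (GKinv i) t) = tens_id n d t"
proof (induction d arbitrary: t)
  case 0
  then show ?case by (simp add: tens_id_idem)
next
  case (Suc d)
  show ?case
    by (rule cons_eqI[of "\<lambda>t. tens_op n (Suc d) (GK i) (tens_op n (Suc d) (GKinv i) t)"
        "tens_id n (Suc d)"], rule lin_intros, rule lin_intros)
      (insert Suc, (auto simp: op_rules op_lin scl_simps powi_mult)+)
qed

lemma R_KiK: "tens_op n d (GKinv i) (tens_op n d (GK i) t) = tens_id n d t"
  by (subst R_KK) (simp_all add: R_KKi)

definition ka :: "nat \<Rightarrow> nat \<Rightarrow> int" where "ka i j = kc i j - kc i (Suc j)"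

lemma R_KE:
  assumes j: "j \<in> {1..<n}"
  shows "tens_op n d (GK i) (tens_op n d (GE j) t) = scl (vv powi ka i j) (tens_op n d (GE j) (tens_op n d (GK i) t))"
proof (induction d arbitrary: t)
  case 0
  then show ?case by (simp add: lin_simps[OF lin_tens_id] scl_simps)
next
  case (Suc d)
  show ?case
    by (rule cons_eqI[of "\<lambda>t. tens_op n (Suc d) (GK i) (tens_op n (Suc d) (GE j) t)"
        "\<lambda>t. scl (vv powi ka i j) (tens_op n (Suc d) (GE j) (tens_op n (Suc d) (GK i) t))"],
        (intro lin_intros)+)
      (use j in \<open>auto simp: Suc op_rules op_lin scl_simps powi_mult ka_def add.commute
         R_KK[of "GK i" "GK j"] R_KK[of "GK i" "GKinv (Suc j)"]\<close>)
qed

lemma R_KiE: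
  assumes j: "j \<in> {1..<n}"
  shows "tens_op n d (GKinv i) (tens_op n d (GE j) t) = scl (vv powi (- ka i j)) (tens_op n d (GE j) (tens_op n d (GKinv i) t))"
proof (induction d arbitrary: t)
  case 0
  then show ?case by (simp add: lin_simps[OF lin_tens_id] scl_simps)
next
  case (Suc d)
  show ?case
    by (rule cons_eqI[of "\<lambda>t. tens_op n (Suc d) (GKinv i) (tens_op n (Suc d) (GE j) t)"
        "\<lambda>t. scl (vv powi (- ka i j)) (tens_op n (Suc d) (GE j) (tens_op n (Suc d) (GKinv i) t))"],
        (intro lin_intros)+)
      (use j in \<open>auto simp: Suc op_rules op_lin scl_simps powi_mult ka_def add.commute
         R_KK[of "GKinv i" "GK j"] R_KK[of "GKinv i" "GKinv (Suc j)"]\<close>)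
qed

lemma id_K': "isK g \<Longrightarrow> tens_id n d (tens_op n d g t) = tens_op n d g t"
proof (induction d arbitrary: t)
  case 0
  then show ?case by (cases g) (simp_all add: tens_id_idem)
next
  case (Suc d)
  show ?case
    by (rule cons_eqI[of "\<lambda>t. tens_id n (Suc d) (tens_op n (Suc d) g t)" "tens_op n (Suc d) g"],
       rule lin_comp[OF lin_tens_id lin_tens_op, unfolded o_def], rule lin_tens_op)
      (insert Suc, (cases g; auto simp: op_rules op_lin lin_simps[OF lin_tens_id] lin_scl[OF lin_tens_id])+)
qed

lemma R_KF:
  assumes j: "j \<in> {1..<n}"
  shows "tens_op n d (GK i) (tens_op n d (GF j) t) = scl (vv powi (- ka i j)) (tens_op n d (GF j) (tens_op n d (GK i) t))"
proof (induction d arbitrary: t)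
  case 0
  then show ?case by (simp add: lin_simps[OF lin_tens_id] scl_simps)
next
  case (Suc d)
  show ?case
    by (rule cons_eqI[of "\<lambda>t. tens_op n (Suc d) (GK i) (tens_op n (Suc d) (GF j) t)"
        "\<lambda>t. scl (vv powi (- ka i j)) (tens_op n (Suc d) (GF j) (tens_op n (Suc d) (GK i) t))"],
        (intro lin_intros)+)
      (use j in \<open>auto simp: Suc op_rules op_lin scl_simps powi_mult ka_def add.commute algebra_simps
         op_id id_K'\<close>)
qed

lemma R_KiF:
  assumes j: "j \<in> {1..<n}"
  shows "tens_op n d (GKinv i) (tens_op n d (GF j) t) = scl (vv powi (ka i j)) (tens_op n d (GF j) (tens_op n d (GKinv i) t))"
proof (induction d arbitrary: t)
  case 0
  then show ?case by (simp add: lin_simps[OF lin_tens_id] scl_simps)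
next
  case (Suc d)
  show ?case
    by (rule cons_eqI[of "\<lambda>t. tens_op n (Suc d) (GKinv i) (tens_op n (Suc d) (GF j) t)"
        "\<lambda>t. scl (vv powi (ka i j)) (tens_op n (Suc d) (GF j) (tens_op n (Suc d) (GKinv i) t))"],
        (intro lin_intros)+)
      (use j in \<open>auto simp: Suc op_rules op_lin scl_simps powi_mult ka_def add.commute algebra_simps
         op_id id_K'\<close>)
qed


lemma scl_0: "scl 0 t = 0" by (simp add: scl_def cst_def)

lemma vv_sq: "vv * vv \<noteq> 1"
proof
  assume "vv * vv = 1"
  then have "of_laurent (Poly_Mapping.single 1 1 * Poly_Mapping.single 1 1) = of_laurent 1"
    by (simp only: of_laurent_mult vv_def of_laurent_1)
  then have "(Poly_Mapping.single 2 1 :: laurent) = Poly_Mapping.single 0 1"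
    using inj_of_laurent by (simp add: inj_def mult_single)
  then show False
    by (metis lookup_single_eq lookup_single_not_eq zero_neq_numeral zero_neq_one)
qed

lemma vv_diff: "vv - inverse vv \<noteq> 0"
  using vv_sq vv_nonzero by (auto simp: field_simps)

lemma kc_simps [simp]: "kc i i = 1" "kc (Suc i) i = 0" "kc i (Suc i) = 0" "i \<noteq> x \<Longrightarrow> kc i x = 0"
  by (auto simp: kc_def)

lemma R_EF:
  assumes i: "i \<in> {1..<n}" and j: "j \<in> {1..<n}"
  shows "tens_op n d (GE i) (tens_op n d (GF j) t) - tens_op n d (GF j) (tens_op n d (GE i) t) =
    scl (if i = j then 1 / (vv - inverse vv) else 0)
      (tens_op n d (GK i) (tens_op n d (GKinv (Suc i)) t) - tens_op n d (GKinv i) (tens_op n d (GK (Suc i)) t))"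
proof (induction d arbitrary: t)
  case 0
  then show ?case by (simp add: scl_simps)
next
  case (Suc d)
  have IH: "tens_op n d (GE i) (tens_op n d (GF j) t) = tens_op n d (GF j) (tens_op n d (GE i) t) +
    scl (if i = j then 1 / (vv - inverse vv) else 0)
      (tens_op n d (GK i) (tens_op n d (GKinv (Suc i)) t) - tens_op n d (GKinv i) (tens_op n d (GK (Suc i)) t))" for t
    using Suc.IH[of t] by (simp add: algebra_simps)
  have v: "vv * vv - 1 \<noteq> 0" using vv_sq by simp
  show ?case
  proof (rule cons_eqI[of "\<lambda>t. tens_op n (Suc d) (GE i) (tens_op n (Suc d) (GF j) t) - tens_op n (Suc d) (GF j) (tens_op n (Suc d) (GE i) t)"
        "\<lambda>t. scl (if i = j then 1 / (vv - inverse vv) else 0)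
      (tens_op n (Suc d) (GK i) (tens_op n (Suc d) (GKinv (Suc i)) t) - tens_op n (Suc d) (GKinv i) (tens_op n (Suc d) (GK (Suc i)) t))"],
      intro lin_intros, intro lin_intros)
    show "tens_op n (Suc d) (GE i) (tens_op n (Suc d) (GF j) 1) - tens_op n (Suc d) (GF j) (tens_op n (Suc d) (GE i) 1)
     = scl (if i = j then 1 / (vv - inverse vv) else 0)
      (tens_op n (Suc d) (GK i) (tens_op n (Suc d) (GKinv (Suc i)) 1) - tens_op n (Suc d) (GKinv i) (tens_op n (Suc d) (GK (Suc i)) 1))"
      by (simp add: op_rules op_lin scl_simps)
    fix x t
    show "tens_op n (Suc d) (GE i) (tens_op n (Suc d) (GF j) (gen x * t)) - tens_op n (Suc d) (GF j) (tens_op n (Suc d) (GE i) (gen x * t))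
     = scl (if i = j then 1 / (vv - inverse vv) else 0)
      (tens_op n (Suc d) (GK i) (tens_op n (Suc d) (GKinv (Suc i)) (gen x * t)) - tens_op n (Suc d) (GKinv i) (tens_op n (Suc d) (GK (Suc i)) (gen x * t)))"
    proof (cases "i = j")
      case False
      then have IH': "tens_op n d (GE i) (tens_op n d (GF j) s) = tens_op n d (GF j) (tens_op n d (GE i) s)" for s
        using IH[of s] by (simp add: scl_0)
      from False i j show ?thesis
        by (auto simp: vv_nonzero op_rules op_lin scl_simps scl_0 powi_mult op_id id_op uq_gens_def IH' R_KF R_KiF ka_def id_K' kc_def)
    next
      case True
      have IH': "tens_op n d (GE i) (tens_op n d (GF i) s) = tens_op n d (GF i) (tens_op n d (GE i) s) +
        scl (1 / (vv - inverse vv))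
         (tens_op n d (GK i) (tens_op n d (GKinv (Suc i)) s) - tens_op n d (GKinv i) (tens_op n d (GK (Suc i)) s))" for s
        using IH[of s] True by simp
      consider "x = i" | "x = Suc i" | "x \<noteq> i" "x \<noteq> Suc i" by blast
      then show ?thesis
      proof cases
        case 1
        show ?thesis using i v vv_nonzero unfolding True[symmetric] 1
          by (auto simp: op_rules op_lin scl_simps powi_mult op_id id_op uq_gens_def IH' ka_def id_K' kc_def
              lookup_scl lookup_minus lookup_add field_simps intro!: poly_mapping_eqI)
      next
        case 2
        show ?thesis using i v vv_nonzero unfolding True[symmetric] 2
          by (auto simp: op_rules op_lin scl_simps powi_mult op_id id_op uq_gens_def IH' R_KF R_KiF ka_def id_K' kc_def
              lookup_scl lookup_minus lookup_add field_simps intro!: poly_mapping_eqI)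
      next
        case 3
        then show ?thesis using i v vv_nonzero unfolding True[symmetric]
          by (auto simp: op_rules op_lin scl_simps powi_mult op_id id_op uq_gens_def IH' ka_def id_K' kc_def
              lookup_scl lookup_minus lookup_add field_simps intro!: poly_mapping_eqI)
      qed
    qed
  qed
qed


lemma R_EE:
  assumes i: "i \<in> {1..<n}" and j: "j \<in> {1..<n}" and ij: "\<bar>int i - int j\<bar> \<noteq> 1"
  shows "tens_op n d (GE i) (tens_op n d (GE j) t) = tens_op n d (GE j) (tens_op n d (GE i) t)"
proof (induction d arbitrary: t)
  case 0
  then show ?case by simp
next
  case (Suc d)
  show ?case
  proof (cases "i = j")
    case False
    show ?thesis
      by (rule cons_eqI[of "\<lambda>t. tens_op n (Suc d) (GE i) (tens_op n (Suc d) (GE j) t)"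
        "\<lambda>t. tens_op n (Suc d) (GE j) (tens_op n (Suc d) (GE i) t)"], (intro lin_intros)+)
      (use i j ij False in \<open>auto simp: Suc op_rules op_lin scl_simps powi_mult ka_def kc_def add.commute R_KE R_KiE\<close>)
  qed simp
qed

lemma R_FF:
  assumes i: "i \<in> {1..<n}" and j: "j \<in> {1..<n}" and ij: "\<bar>int i - int j\<bar> \<noteq> 1"
  shows "tens_op n d (GF i) (tens_op n d (GF j) t) = tens_op n d (GF j) (tens_op n d (GF i) t)"
proof (induction d arbitrary: t)
  case 0
  then show ?case by simp
next
  case (Suc d)
  show ?case
  proof (cases "i = j")
    case False
    show ?thesis
      by (rule cons_eqI[of "\<lambda>t. tens_op n (Suc d) (GF i) (tens_op n (Suc d) (GF j) t)"
        "\<lambda>t. tens_op n (Suc d) (GF j) (tens_op n (Suc d) (GF i) t)"], (intro lin_intros)+)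
      (use i j ij False in \<open>auto simp: Suc op_rules op_lin scl_simps powi_mult ka_def kc_def add.commute op_id id_op uq_gens_def\<close>)
  qed simp
qed

lemma R_EEE:
  assumes i: "i \<in> {1..<n}" and j: "j \<in> {1..<n}" and ij: "i = Suc j \<or> j = Suc i"
  shows "tens_op n d (GE i) (tens_op n d (GE i) (tens_op n d (GE j) t))
     - scl (vv + inverse vv) (tens_op n d (GE i) (tens_op n d (GE j) (tens_op n d (GE i) t)))
     + tens_op n d (GE j) (tens_op n d (GE i) (tens_op n d (GE i) t)) = 0"
proof (induction d arbitrary: t)
  case 0
  then show ?case by (simp add: scl_simps)
next
  case (Suc d)
  have IH: "tens_op n d (GE j) (tens_op n d (GE i) (tens_op n d (GE i) t)) =
     scl (vv + inverse vv) (tens_op n d (GE i) (tens_op n d (GE j) (tens_op n d (GE i) t)))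
      - tens_op n d (GE i) (tens_op n d (GE i) (tens_op n d (GE j) t))" for t
    using Suc[of t] by (simp add: algebra_simps eq_neg_iff_add_eq_0)
  show ?case
  proof (rule cons_eqI[of "\<lambda>t. tens_op n (Suc d) (GE i) (tens_op n (Suc d) (GE i) (tens_op n (Suc d) (GE j) t))
     - scl (vv + inverse vv) (tens_op n (Suc d) (GE i) (tens_op n (Suc d) (GE j) (tens_op n (Suc d) (GE i) t)))
     + tens_op n (Suc d) (GE j) (tens_op n (Suc d) (GE i) (tens_op n (Suc d) (GE i) t))" "\<lambda>t. 0"], (intro lin_intros)+)
    show "tens_op n (Suc d) (GE i) (tens_op n (Suc d) (GE i) (tens_op n (Suc d) (GE j) 1))
     - scl (vv + inverse vv) (tens_op n (Suc d) (GE i) (tens_op n (Suc d) (GE j) (tens_op n (Suc d) (GE i) 1)))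
     + tens_op n (Suc d) (GE j) (tens_op n (Suc d) (GE i) (tens_op n (Suc d) (GE i) 1)) = 0"
      by (simp add: op_rules op_lin scl_simps)
    fix x t
    show "tens_op n (Suc d) (GE i) (tens_op n (Suc d) (GE i) (tens_op n (Suc d) (GE j) (gen x * t)))
     - scl (vv + inverse vv) (tens_op n (Suc d) (GE i) (tens_op n (Suc d) (GE j) (tens_op n (Suc d) (GE i) (gen x * t))))
     + tens_op n (Suc d) (GE j) (tens_op n (Suc d) (GE i) (tens_op n (Suc d) (GE i) (gen x * t))) = 0"
      using ij
    proof
      assume a: "i = Suc j"
      show ?thesis using i j unfolding a
        by (cases "x = Suc (Suc j)"; cases "x = Suc j"; auto simp: op_rules op_lin scl_simps powi_mult ka_def kc_def R_KE R_KiE IH[unfolded a] lookup_scl lookup_minus lookup_add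
           vv_nonzero field_simps power2_eq_square intro!: poly_mapping_eqI)
    next
      assume a: "j = Suc i"
      show ?thesis using i j unfolding a
        by (cases "x = Suc i"; cases "x = Suc (Suc i)"; auto simp: op_rules op_lin scl_simps powi_mult ka_def kc_def R_KE R_KiE IH[unfolded a] lookup_scl lookup_minus lookup_add
           vv_nonzero field_simps power2_eq_square intro!: poly_mapping_eqI)
    qed
  qed
qed

lemma R_FFF:
  assumes i: "i \<in> {1..<n}" and j: "j \<in> {1..<n}" and ij: "i = Suc j \<or> j = Suc i"
  shows "tens_op n d (GF i) (tens_op n d (GF i) (tens_op n d (GF j) t))
     - scl (vv + inverse vv) (tens_op n d (GF i) (tens_op n d (GF j) (tens_op n d (GF i) t)))
     + tens_op n d (GF j) (tens_op n d (GF i) (tens_op n d (GF i) t)) = 0"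
proof (induction d arbitrary: t)
  case 0
  then show ?case by (simp add: scl_simps)
next
  case (Suc d)
  have IH: "tens_op n d (GF j) (tens_op n d (GF i) (tens_op n d (GF i) t)) =
     scl (vv + inverse vv) (tens_op n d (GF i) (tens_op n d (GF j) (tens_op n d (GF i) t)))
      - tens_op n d (GF i) (tens_op n d (GF i) (tens_op n d (GF j) t))" for t
    using Suc[of t] by (simp add: algebra_simps eq_neg_iff_add_eq_0)
  show ?case
  proof (rule cons_eqI[of "\<lambda>t. tens_op n (Suc d) (GF i) (tens_op n (Suc d) (GF i) (tens_op n (Suc d) (GF j) t))
     - scl (vv + inverse vv) (tens_op n (Suc d) (GF i) (tens_op n (Suc d) (GF j) (tens_op n (Suc d) (GF i) t)))
     + tens_op n (Suc d) (GF j) (tens_op n (Suc d) (GF i) (tens_op n (Suc d) (GF i) t))" "\<lambda>t. 0"], (intro lin_intros)+)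
    show "tens_op n (Suc d) (GF i) (tens_op n (Suc d) (GF i) (tens_op n (Suc d) (GF j) 1))
     - scl (vv + inverse vv) (tens_op n (Suc d) (GF i) (tens_op n (Suc d) (GF j) (tens_op n (Suc d) (GF i) 1)))
     + tens_op n (Suc d) (GF j) (tens_op n (Suc d) (GF i) (tens_op n (Suc d) (GF i) 1)) = 0"
      by (simp add: op_rules op_lin scl_simps)
    fix x t
    show "tens_op n (Suc d) (GF i) (tens_op n (Suc d) (GF i) (tens_op n (Suc d) (GF j) (gen x * t)))
     - scl (vv + inverse vv) (tens_op n (Suc d) (GF i) (tens_op n (Suc d) (GF j) (tens_op n (Suc d) (GF i) (gen x * t))))
     + tens_op n (Suc d) (GF j) (tens_op n (Suc d) (GF i) (tens_op n (Suc d) (GF i) (gen x * t))) = 0"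
      using ij
    proof
      assume a: "i = Suc j"
      show ?thesis using i j unfolding a
        by (cases "x = Suc j"; cases "x = j"; auto simp: op_rules op_lin scl_simps powi_mult ka_def kc_def op_id id_op uq_gens_def IH[unfolded a] lookup_scl lookup_minus lookup_add
           vv_nonzero field_simps power2_eq_square intro!: poly_mapping_eqI)
    next
      assume a: "j = Suc i"
      show ?thesis using i j unfolding a
        by (cases "x = i"; cases "x = Suc i"; auto simp: op_rules op_lin scl_simps powi_mult ka_def kc_def op_id id_op uq_gens_def IH[unfolded a] lookup_scl lookup_minus lookup_add
           vv_nonzero field_simps power2_eq_square intro!: poly_mapping_eqI)
    qed
  qed
qed


lemma free_act_lin_ext: "free_act n d u t = lin_ext (\<lambda>w. word_op n d w t) u"
  by (simp add: free_act_def lin_ext_def)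

lemma lin_free_act: "lin (\<lambda>u. free_act n d u t)"
  unfolding free_act_lin_ext by (rule lin_lin_ext)

lemmas free_act_simps = lin_simps[OF lin_free_act]

lemma word_op_0: "word_op n d 0 = tens_id n d"
  by (simp add: word_op_def zero_fword_def)

lemma word_op_Cons: "word_op n d (FWord (g # w)) t = tens_op n d g (word_op n d (FWord w) t)"
  by (simp add: word_op_def)

lemma lin_word_op: "lin (word_op n d w)"
proof (cases w)
  case (FWord xs)
  show ?thesis unfolding FWord
  proof (induction xs)
    case Nil
    then show ?case by (simp add: word_op_def lin_tens_id)
  next
    case (Cons g xs)
    then show ?case
      using lin_comp[OF lin_tens_op Cons, of n d g] by (simp add: word_op_def o_def)
  qed
qed

lemma id_word_op: "set (letters w) \<subseteq> uq_gens n \<Longrightarrow> tens_id n d (word_op n d w t) = word_op n d w t"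
  by (cases w; cases "letters w") (auto simp: word_op_def tens_id_idem id_op)

lemma word_op_add:
  assumes "set (letters b) \<subseteq> uq_gens n"
  shows "word_op n d (a + b) t = word_op n d a (word_op n d b t)"
proof (cases a)
  case (FWord xs)
  show ?thesis unfolding FWord
  proof (induction xs)
    case Nil
    show ?case using id_word_op[OF assms] by (simp add: word_op_def plus_fword_def)
  next
    case (Cons g xs)
    then show ?case by (simp add: word_op_Cons plus_fword_def)
  qed
qed

lemma free_act_single: "free_act n d (Poly_Mapping.single w 1) t = word_op n d w t"
  by (simp add: free_act_lin_ext)

lemma free_act_mult:
  assumes "u' \<in> uq_free n"
  shows "free_act n d (u * u') t = free_act n d u (free_act n d u' t)"
proof (rule lin_eqI[of "\<lambda>u. free_act n d (u * u') t" "\<lambda>u. free_act n d u (free_act n d u' t)"])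
  show "lin (\<lambda>u. free_act n d (u * u') t)"
    by (simp add: lin_def distrib_right free_act_simps mult.assoc)
  show "lin (\<lambda>u. free_act n d u (free_act n d u' t))" by (rule lin_free_act)
  fix w :: "uq_gen fword"
  let ?s = "Poly_Mapping.single w (1 :: qfield)"
  have *: "free_act n d (?s * Poly_Mapping.single w' 1) t = word_op n d w (word_op n d w' t)"
    if "w' \<in> Poly_Mapping.keys u'" for w'
    using that assms by (simp add: mult_single free_act_single word_op_add uq_free_def)
  have "?s * u' = (\<Sum>w'\<in>Poly_Mapping.keys u'. ?s * (cst (Poly_Mapping.lookup u' w') * Poly_Mapping.single w' 1))"
    by (subst sum_keys[of u']) (simp only: sum_distrib_left)
  also have "\<dots> = (\<Sum>w'\<in>Poly_Mapping.keys u'. cst (Poly_Mapping.lookup u' w') * (?s * Poly_Mapping.single w' 1))"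
    by (simp only: mult.assoc[symmetric] cst_comm)
  finally have "free_act n d (?s * u') t
      = (\<Sum>w'\<in>Poly_Mapping.keys u'. cst (Poly_Mapping.lookup u' w') * free_act n d (?s * Poly_Mapping.single w' 1) t)"
    by (simp only: lin_sum[OF lin_free_act] free_act_simps(2))
  also have "\<dots> = (\<Sum>w'\<in>Poly_Mapping.keys u'. cst (Poly_Mapping.lookup u' w') * word_op n d w (word_op n d w' t))"
    by (intro sum.cong refl) (simp only: *)
  also have "\<dots> = word_op n d w (free_act n d u' t)"
    by (simp add: free_act_def lin_sum[OF lin_word_op] lin_simps[OF lin_word_op])
  finally show "free_act n d (?s * u') t = free_act n d ?s (free_act n d u' t)"
    by (simp add: free_act_single)
qed

lemma uq_free_add: "x \<in> uq_free n \<Longrightarrow> y \<in> uq_free n \<Longrightarrow> x + y \<in> uq_free n"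
  unfolding uq_free_def using Poly_Mapping.keys_add[of x y] by blast

lemma uq_free_diff: "x \<in> uq_free n \<Longrightarrow> y \<in> uq_free n \<Longrightarrow> x - y \<in> uq_free n"
  unfolding uq_free_def using Poly_Mapping.keys_diff[of x y] by blast

lemma uq_free_mult: "x \<in> uq_free n \<Longrightarrow> y \<in> uq_free n \<Longrightarrow> x * y \<in> uq_free n"
  unfolding uq_free_def using Poly_Mapping.keys_mult[of x y] by (fastforce simp: plus_fword_def)

lemma uq_free_cst: "cst c \<in> uq_free n"
  by (auto simp: uq_free_def cst_def zero_fword_def)

lemma uq_free_1: "1 \<in> uq_free n" and uq_free_0: "0 \<in> uq_free n"
  using uq_free_cst[of 1] uq_free_cst[of 0] by (simp_all add: cst_1) (simp add: cst_def)

lemma uq_free_gen: "g \<in> uq_gens n \<Longrightarrow> gen g \<in> uq_free n"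
  by (simp add: uq_free_def gen_def)

lemmas uq_frees = uq_free_add uq_free_diff uq_free_mult uq_free_cst uq_free_1 uq_free_0 uq_free_gen

lemma free_act_gen: "free_act n d (gen g) t = tens_op n d g t"
  by (simp add: gen_def free_act_single word_op_def op_id)

lemma free_act_1: "free_act n d 1 t = tens_id n d t"
  using free_act_single[of n d 0 t] by (simp add: word_op_0)

lemma free_act_mult_gen: "g \<in> uq_gens n \<Longrightarrow> free_act n d (u * gen g) t = free_act n d u (tens_op n d g t)"
  by (simp add: free_act_mult uq_free_gen free_act_gen)

lemma inner_prod_eps: "i \<in> {1..n} \<Longrightarrow> inner_prod n (eps i) y = y i"
proof -
  assume "i \<in> {1..n}"
  moreover have "inner_prod n (eps i) y = (\<Sum>k\<in>{1..n}. if k = i then y k else 0)"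
    unfolding inner_prod_def by (intro sum.cong) (auto simp: eps_def)
  ultimately show ?thesis by simp
qed

lemma inner_prod_ka: "i \<in> {1..n} \<Longrightarrow> inner_prod n (eps i) (root (j, j + 1)) = ka i j"
  by (simp add: inner_prod_eps) (auto simp: eps_def root_def ka_def kc_def)

lemma cst_0: "cst 0 = 0" by (simp add: cst_def)

lemma adjacent_iff: "\<bar>int i - int j\<bar> = 1 \<longleftrightarrow> i = Suc j \<or> j = Suc i" by auto

lemma uq_relators_free: "r \<in> uq_relators n \<Longrightarrow> r \<in> uq_free n"
  by (induction rule: uq_relators.induct)
    (auto intro!: uq_frees simp: power2_eq_square uq_gens_def)

lemma free_act_relator: "r \<in> uq_relators n \<Longrightarrow> free_act n d r t = 0"
proof (induction rule: uq_relators.induct)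
  case (EF i j)
  then show ?case using R_EF[of i n j d t]
    by (auto simp: free_act_simps free_act_mult_gen free_act_gen uq_gens_def scl_def cst_0)
next
  case (EEE i j)
  then show ?case using R_EEE[of i n j d t]
    by (auto simp: adjacent_iff free_act_simps free_act_mult_gen free_act_gen uq_gens_def scl_def power2_eq_square
      mult.assoc[symmetric])
next
  case (FFF i j)
  then show ?case using R_FFF[of i n j d t]
    by (auto simp: adjacent_iff free_act_simps free_act_mult_gen free_act_gen uq_gens_def scl_def power2_eq_square
      mult.assoc[symmetric])
next
  case (KE i j)
  then show ?case using R_KE[of j n d i t] inner_prod_ka[of i n j]
    by (simp add: free_act_simps mult.assoc free_act_mult uq_frees free_act_gen uq_gens_def scl_def)
next
  case (KF i j)
  then show ?case using R_KF[of j n d i t] inner_prod_ka[of i n j]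
    by (simp add: free_act_simps mult.assoc free_act_mult uq_frees free_act_gen uq_gens_def scl_def)
next
  case (KK i j)
  then show ?case using R_KK[of "GK i" "GK j" n d t]
    by (simp add: free_act_simps free_act_mult_gen free_act_gen uq_gens_def)
next
  case (KKinv i)
  then show ?case by (simp add: free_act_simps free_act_mult_gen free_act_gen uq_gens_def R_KKi free_act_1)
next
  case (KinvK i)
  then show ?case by (simp add: free_act_simps free_act_mult_gen free_act_gen uq_gens_def R_KiK free_act_1)
next
  case (EE i j)
  then show ?case using R_EE[of i n j d t]
    by (simp add: free_act_simps free_act_mult_gen free_act_gen uq_gens_def)
next
  case (FF i j)
  then show ?case using R_FF[of i n j d t]
    by (simp add: free_act_simps free_act_mult_gen free_act_gen uq_gens_def)
qed

lemma uq_ideal_free: "x \<in> uq_ideal n \<Longrightarrow> x \<in> uq_free n"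
  by (induction rule: uq_ideal.induct) (auto intro: uq_frees uq_relators_free)

lemma free_act_0_right: "free_act n d a 0 = 0"
  by (simp add: free_act_def lin_simps[OF lin_word_op])

lemma free_act_ideal: "x \<in> uq_ideal n \<Longrightarrow> free_act n d x t = 0"
  by (induction arbitrary: t rule: uq_ideal.induct)
    (simp_all add: free_act_relator free_act_simps free_act_mult uq_ideal_free free_act_0_right)

lemma equiv_uq_cong: "equiv (uq_free n) (uq_cong n)"
proof (rule equivI)
  show "uq_cong n \<subseteq> uq_free n \<times> uq_free n" by (auto simp: uq_cong_def)
  show "refl_on (uq_free n) (uq_cong n)" by (auto simp: refl_on_def uq_cong_def uq_ideal.zero)
  show "sym (uq_cong n)"
  proof (rule symI)
    fix x y assume "(x, y) \<in> uq_cong n"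
    then show "(y, x) \<in> uq_cong n"
      using uq_ideal.left[OF uq_free_cst[of "-1"], of "x - y" n]
      by (auto simp: uq_cong_def cst_def single_uminus)
  qed
  show "trans (uq_cong n)"
  proof (rule transI)
    fix x y z assume "(x, y) \<in> uq_cong n" "(y, z) \<in> uq_cong n"
    then show "(x, z) \<in> uq_cong n"
      using uq_ideal.add[of "x - y" n "y - z"] by (auto simp: uq_cong_def)
  qed
qed

lemma uq_rep_class:
  assumes "x \<in> uq_free n"
  shows "uq_rep n d (uq_class n x) = free_act n d x"
proof -
  have "free_act n d y = free_act n d x" if "y \<in> uq_class n x" for y
  proof
    fix t
    have "free_act n d (x - y) t = 0"
      using that by (intro free_act_ideal) (simp add: uq_class_def uq_cong_def)
    then show "free_act n d y t = free_act n d x t" by (simp add: free_act_simps)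
  qed
  moreover have "x \<in> uq_class n x"
    using assms by (simp add: uq_class_def uq_cong_def uq_ideal.zero)
  ultimately have "free_act n d ` uq_class n x = {free_act n d x}" by blast
  then show ?thesis by (simp add: uq_rep_def)
qed

lemma schur_elt_eq: "x \<in> uq_free n \<Longrightarrow> schur_elt n d x = free_act n d x"
  by (simp add: schur_elt_def uq_rep_class)

lemma schur_eq: "schur n d = free_act n d ` uq_free n"
proof -
  have "uq n = uq_class n ` uq_free n"
    by (auto simp: uq_def quotient_def uq_class_def)
  then show ?thesis
    by (simp add: schur_def image_image uq_rep_class cong: image_cong)
qed

end

theory Submission
  imports Defs "HOL.Vector_Spaces" "HOL-Combinatorics.Permutations"
begin

text \<open>
  An element of the integral Hecke algebra commutes with the right action of the Hecke operators,
  which produce every permutation of the word \<open>w = 1 2 \<dots> d\<close> from \<open>w\<close>; so it is determined by its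
  value at \<open>w\<close>, an \<open>\<A>\<close>-combination of the \<open>d!\<close> permutation words. It therefore suffices that
  every permutation word is an \<open>\<A>\<close>-combination of the vectors \<open>E\<^sub>A 1\<^sub>\<lambda> F\<^sub>C w\<close>, and that there are
  at most \<open>d!\<close> of these: linear independence then follows by counting dimensions.

  The weight and content conditions force \<open>A\<close> and \<open>C\<close> to have entries 0 and 1 and to describe the
  positions below and above their value, respectively, of a permutation \<open>s\<close>, which gives the count.
  Conversely, applying first the \<open>F\<close> root vectors of \<open>s\<close> with decreasing start and then its \<open>E\<close>
  root vectors with increasing end to \<open>w\<close> gives a unit times the word \<open>s\<close> plus smaller words.
  Such products reduce to the two given orders by straightening: interchanging two root vectors
  costs a unit and products with longer roots, whose sets of starts and of ends do not grow.
\<close>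

text \<open>The orders on \<Phi>+ are arbitrary, while leading terms are visible only for special
  orders; straightening bridges the two and must not leave the index set. Eliminating \<lambda>
  shows why it does not. For exponents 0 and 1 with supports S and T, the weight and content
  conditions say that all roots lie within 1..d, that starts are distinct and ends are distinct
  within S and within T, that no start of S is an end of T and no end of S a start of T, and that S
  and T have the same sum. Passing to fewer starts and ends with the same sum preserves all of this.
  Distinctness also leaves only disjoint, adjacent, crossing or strictly nested pairs of roots to
  interchange, and it reduces every divided power to a root vector or 1. The two halves of a product
  behave differently. Each F root vector turns a word into a multiple of a single word, because the
  letters to its left are still smaller. An E root vector produces further words; they are
  controlled by a weighted sum of letters in which earlier positions count more. All leading factors
  are units of \<A>, so the triangular system can be inverted over \<A>.\<close>

section \<open>Lattices of words\<close>

definition lau :: "qfield set" where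
  "lau = range of_laurent"

lemma lau_0: "0 \<in> lau" and lau_1: "1 \<in> lau"
proof -
  have "of_laurent 0 = 0" by (simp add: of_laurent_def Zero_fract_def)
  then show "0 \<in> lau" unfolding lau_def by (metis rangeI)
  show "1 \<in> lau" unfolding lau_def by (metis of_laurent_1 rangeI)
qed

lemma lau_add: "a \<in> lau \<Longrightarrow> b \<in> lau \<Longrightarrow> a + b \<in> lau"
  unfolding lau_def by (metis (no_types) imageE of_laurent_add rangeI)

lemma lau_mult: "a \<in> lau \<Longrightarrow> b \<in> lau \<Longrightarrow> a * b \<in> lau"
  unfolding lau_def by (metis (no_types) imageE of_laurent_mult rangeI)

lemma lau_uminus:
  assumes "a \<in> lau"
  shows "- a \<in> lau"
proof -
  obtain x where "a = of_laurent x"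
    using assms by (auto simp: lau_def)
  then have "- a = of_laurent (- x)"
    by (simp add: of_laurent_def)
  then show ?thesis by (simp add: lau_def)
qed

lemma lau_diff: "a \<in> lau \<Longrightarrow> b \<in> lau \<Longrightarrow> a - b \<in> lau"
  using lau_add[of a "- b"] lau_uminus[of b] by simp

lemma lau_vv: "vv \<in> lau"
  by (simp add: lau_def vv_def)

lemma lau_inverse_vv: "inverse vv \<in> lau"
proof -
  have "vv * of_laurent (Poly_Mapping.single (- 1) 1) = 1"
    by (simp add: vv_def of_laurent_mult[symmetric] mult_single of_laurent_1)
  then have "inverse vv = of_laurent (Poly_Mapping.single (- 1) 1)"
    by (rule inverse_unique)
  then show ?thesis by (simp add: lau_def)
qed

lemma lau_power: "a \<in> lau \<Longrightarrow> a ^ k \<in> lau"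
  by (induction k) (auto intro: lau_1 lau_mult)

definition lau_units :: "qfield set" where
  "lau_units = {c \<in> lau. c \<noteq> 0 \<and> inverse c \<in> lau}"

lemma lau_units_lau: "c \<in> lau_units \<Longrightarrow> c \<in> lau"
  by (simp add: lau_units_def)

lemma lau_units_inverse: "c \<in> lau_units \<Longrightarrow> inverse c \<in> lau_units"
  by (simp add: lau_units_def)

lemma lau_units_nz: "c \<in> lau_units \<Longrightarrow> c \<noteq> 0"
  by (simp add: lau_units_def)

lemma lau_units_mult: "a \<in> lau_units \<Longrightarrow> b \<in> lau_units \<Longrightarrow> a * b \<in> lau_units"
  by (simp add: lau_units_def lau_mult)

lemma lau_units_1: "1 \<in> lau_units" and lau_units_vv: "vv \<in> lau_units"
  by (simp_all add: lau_units_def lau_1 lau_vv lau_inverse_vv vv_nonzero)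

lemma lau_units_uminus: "c \<in> lau_units \<Longrightarrow> - c \<in> lau_units"
  by (simp add: lau_units_def lau_uminus)

lemma lau_units_power: "a \<in> lau_units \<Longrightarrow> a ^ k \<in> lau_units"
  by (induction k) (auto intro: lau_units_1 lau_units_mult)

lemma lau_units_powi: "vv powi k \<in> lau_units"
  using lau_units_power[OF lau_units_vv] lau_units_power[OF lau_units_inverse[OF lau_units_vv]]
  by (auto simp: power_int_def)

lemmas lau_intros = lau_0 lau_1 lau_add lau_mult lau_uminus lau_diff lau_vv lau_inverse_vv lau_power
  lau_units_lau lau_units_powi lau_units_1

section \<open>Word vectors and \<A>-submodules of tensor space\<close>

definition wd :: "nat list \<Rightarrow> tens" where
  "wd xs = Poly_Mapping.single (FWord xs) 1"

lemma wd_Nil: "wd [] = 1"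
  by (simp add: wd_def single_Nil)

lemma gen_wd: "gen x * wd xs = wd (x # xs)"
  by (simp add: wd_def gen_mult_single)

lemma wd_eqI:
  assumes "lin f" "lin g" "\<And>xs. f (wd xs) = g (wd xs)"
  shows "f t = g t"
  using assms(1,2)
proof (rule lin_eqI)
  show "f (Poly_Mapping.single w 1) = g (Poly_Mapping.single w 1)" for w
    using assms(3)[of "letters w"] by (simp add: wd_def)
qed

lemma lookup_wd: "Poly_Mapping.lookup (wd xs) w = of_bool (letters w = xs)"
  by (cases w) (auto simp: wd_def lookup_single when_def)

text \<open>The scalars are taken from \<open>lau\<close> inside \<rat>(v), so that preimages under
  \<rat>(v)-linear maps and scaling by field elements need no change of ring.\<close>

definition Asub :: "tens set \<Rightarrow> bool" where
  "Asub M \<longleftrightarrow> 0 \<in> M \<and> (\<forall>x\<in>M. \<forall>y\<in>M. x + y \<in> M) \<and> (\<forall>c\<in>lau. \<forall>x\<in>M. scl c x \<in> M)"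

lemma Asub_0: "Asub M \<Longrightarrow> 0 \<in> M"
  and Asub_add: "Asub M \<Longrightarrow> x \<in> M \<Longrightarrow> y \<in> M \<Longrightarrow> x + y \<in> M"
  and Asub_scl: "Asub M \<Longrightarrow> c \<in> lau \<Longrightarrow> x \<in> M \<Longrightarrow> scl c x \<in> M"
  by (simp_all add: Asub_def)

lemma Asub_uminus: "Asub M \<Longrightarrow> x \<in> M \<Longrightarrow> - x \<in> M"
  using Asub_scl[of M "- 1" x] by (simp add: lau_intros scl_def cst_def single_uminus)

lemma Asub_diff: "Asub M \<Longrightarrow> x \<in> M \<Longrightarrow> y \<in> M \<Longrightarrow> x - y \<in> M"
  using Asub_add[of M x "- y"] Asub_uminus[of M y] by simp

lemma Asub_sum: "Asub M \<Longrightarrow> (\<And>i. i \<in> I \<Longrightarrow> g i \<in> M) \<Longrightarrow> sum g I \<in> M"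
  by (induction I rule: infinite_finite_induct) (auto intro: Asub_0 Asub_add)

lemma Asub_vimage: "Asub M \<Longrightarrow> lin f \<Longrightarrow> Asub {t. f t \<in> M}"
  by (simp add: Asub_def lin_simps lin_scl)

text \<open>Interchange factors and leading coefficients are units of \<A>; by this lemma they can
  be ignored in any membership claim.\<close>

lemma Asub_unit:
  assumes "Asub M" "c \<in> lau_units"
  shows "scl c x \<in> M \<longleftrightarrow> x \<in> M"
proof
  assume "scl c x \<in> M"
  from Asub_scl[OF assms(1) _ this, of "inverse c"] have "scl (inverse c) (scl c x) \<in> M"
    using assms(2) by (auto intro: lau_units_lau lau_units_inverse)
  then show "x \<in> M" using assms(2) by (simp add: scl_simps lau_units_def)
qed (use assms in \<open>auto intro: Asub_scl lau_units_lau\<close>)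

text \<open>The \<A>-span of the words in \<open>S\<close>, given through coefficients rather than
  combinations; intersections and the case \<open>S = {}\<close> are then immediate.\<close>

definition asp :: "nat list set \<Rightarrow> tens set" where
  "asp S = {t. \<forall>w. Poly_Mapping.lookup t w \<in> lau \<and> (Poly_Mapping.lookup t w \<noteq> 0 \<longrightarrow> letters w \<in> S)}"

lemma Asub_asp: "Asub (asp S)"
  unfolding Asub_def asp_def
  by (auto simp: lookup_add lookup_scl intro: lau_intros) (metis add.right_neutral)

lemma asp_wd: "xs \<in> S \<Longrightarrow> wd xs \<in> asp S"
  by (auto simp: asp_def lookup_wd intro: lau_intros)

lemma asp_mono: "S \<subseteq> T \<Longrightarrow> asp S \<subseteq> asp T"
  by (auto simp: asp_def)

lemma asp_empty: "t \<in> asp {} \<Longrightarrow> t = 0"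
  by (auto simp: asp_def intro!: poly_mapping_eqI)

lemma asp_subset:
  assumes "t \<in> asp S" "Asub M" "\<And>xs. xs \<in> S \<Longrightarrow> wd xs \<in> M"
  shows "t \<in> M"
proof -
  have "t = (\<Sum>w\<in>Poly_Mapping.keys t. scl (Poly_Mapping.lookup t w) (wd (letters w)))"
    by (subst sum_keys) (simp add: scl_def wd_def)
  also have "\<dots> \<in> M"
    using assms by (intro Asub_sum Asub_scl) (auto simp: asp_def in_keys_iff)
  finally show ?thesis .
qed

lemma lin_asp:
  assumes "lin f" "Asub M" "\<And>xs. xs \<in> S \<Longrightarrow> f (wd xs) \<in> M" "t \<in> asp S"
  shows "f t \<in> M"
  using asp_subset[OF assms(4) Asub_vimage[OF assms(2,1)]] assms(3) by simp

lemma asp_cons: "t \<in> asp S \<Longrightarrow> (\<And>xs. xs \<in> S \<Longrightarrow> x # xs \<in> T) \<Longrightarrow> gen x * t \<in> asp T"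
  by (rule lin_asp[OF lin_lmult Asub_asp]) (auto simp: gen_wd intro: asp_wd)

lemma tens_lattice_asp: "tens_lattice n d = asp {xs. length xs = d \<and> set xs \<subseteq> {1..n}}"
  by (auto simp: tens_lattice_def asp_def tens_words_def lau_def in_keys_iff)

section \<open>Weights\<close>

definition words :: "nat \<Rightarrow> nat \<Rightarrow> nat list set" where
  "words n d = {xs. length xs = d \<and> set xs \<subseteq> {1..n}}"

definition wt :: "nat list \<Rightarrow> nat \<Rightarrow> int" where
  "wt xs k = int (count_list xs k)"

text \<open>The weight \<open>m\<close> is integer-valued, so that it can always be shifted by a
  root; a negative entry makes the set empty and thereby forces a vector to vanish.\<close>

definition wwords :: "nat \<Rightarrow> nat \<Rightarrow> (nat \<Rightarrow> int) \<Rightarrow> nat list set" where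
  "wwords n d m = {xs \<in> words n d. wt xs = m}"

lemma wt_Nil [simp]: "wt [] k = 0" and wt_Cons [simp]: "wt (x # xs) k = kc k x + wt xs k"
  by (auto simp: wt_def kc_def)

lemma words_0 [simp]: "xs \<in> words n 0 \<longleftrightarrow> xs = []"
  by (auto simp: words_def)

lemma words_Cons [simp]: "x # xs \<in> words n (Suc d) \<longleftrightarrow> x \<in> {1..n} \<and> xs \<in> words n d"
  by (auto simp: words_def)

lemma words_Suc: "xs \<in> words n (Suc d) \<longleftrightarrow> (\<exists>x ys. xs = x # ys \<and> x \<in> {1..n} \<and> ys \<in> words n d)"
  by (cases xs) (auto simp: words_def)

lemma tens_id_Nil: "tens_id n 0 1 = 1"
  unfolding single_Nil[symmetric] tens_id_single by (simp add: tens_words_def)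

lemma K_wd: "xs \<in> words n d \<Longrightarrow> tens_op n d (GK i) (wd xs) = scl (vv powi wt xs i) (wd xs)"
  by (induction d arbitrary: xs)
    (auto simp: words_Suc op_K scl_simps powi_mult wd_Nil tens_id_Nil simp flip: gen_wd)

lemma Kinv_wd: "xs \<in> words n d \<Longrightarrow> tens_op n d (GKinv i) (wd xs) = scl (vv powi (- wt xs i)) (wd xs)"
  by (induction d arbitrary: xs)
    (auto simp: words_Suc op_Ki scl_simps powi_mult wd_Nil tens_id_Nil simp flip: gen_wd)

lemma tens_id_wd: "xs \<in> words n d \<Longrightarrow> tens_id n d (wd xs) = wd xs"
  by (simp add: tens_id_single wd_def tens_words_def words_def)

lemma tens_id_asp: "t \<in> asp (words n d) \<Longrightarrow> tens_id n d t = t"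
proof -
  assume *: "t \<in> asp (words n d)"
  have "lin (\<lambda>t. tens_id n d t - t)"
    using lin_difff[OF lin_tens_id, of "\<lambda>t. t"] by (simp add: lin_def)
  from lin_asp[OF this Asub_asp[of "{}"] _ *] have "tens_id n d t - t \<in> asp {}"
    by (simp add: tens_id_wd Asub_0 Asub_asp)
  then show ?thesis by (auto dest: asp_empty)
qed

lemma E_wd:
  assumes "i \<in> {1..<n}" "xs \<in> wwords n d m"
  shows "tens_op n d (GE i) (wd xs) \<in> asp (wwords n d (\<lambda>k. m k + root (i, Suc i) k))"
  using assms(2)
proof (induction d arbitrary: xs m)
  case 0
  then show ?case by (simp add: Asub_0 Asub_asp)
next
  case (Suc d)
  then obtain x ys where xs: "xs = x # ys" "x \<in> {1..n}" "ys \<in> words n d" "m = wt (x # ys)"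
    by (auto simp: wwords_def words_Suc)
  have *: "gen x * tens_op n d (GE i) (wd ys) \<in> asp (wwords n (Suc d) (\<lambda>k. m k + root (i, Suc i) k))"
    by (rule asp_cons[OF Suc.IH[of ys "wt ys"]])
      (use xs in \<open>auto simp: wwords_def fun_eq_iff\<close>)
  have "gen i * tens_op n d (GK i) (tens_op n d (GKinv (Suc i)) (wd ys))
      \<in> asp (wwords n (Suc d) (\<lambda>k. m k + root (i, Suc i) k))" if "x = Suc i"
    using xs that assms(1)
    by (auto simp: Kinv_wd K_wd op_lin scl_simps gen_wd wwords_def root_def eps_def kc_def fun_eq_iff
      intro!: Asub_scl Asub_asp asp_wd lau_mult lau_units_lau[OF lau_units_powi])
  with * show ?case using xs
    by (auto simp: op_E gen_wd[symmetric] intro: Asub_add Asub_asp)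
qed

lemma F_wd:
  assumes "i \<in> {1..<n}" "xs \<in> wwords n d m"
  shows "tens_op n d (GF i) (wd xs) \<in> asp (wwords n d (\<lambda>k. m k - root (i, Suc i) k))"
  using assms(2)
proof (induction d arbitrary: xs m)
  case 0
  then show ?case by (simp add: Asub_0 Asub_asp)
next
  case (Suc d)
  then obtain x ys where xs: "xs = x # ys" "x \<in> {1..n}" "ys \<in> words n d" "m = wt (x # ys)"
    by (auto simp: wwords_def words_Suc)
  have *: "scl (vv powi (kc (Suc i) x - kc i x)) (gen x * tens_op n d (GF i) (wd ys))
     \<in> asp (wwords n (Suc d) (\<lambda>k. m k - root (i, Suc i) k))"
    by (intro Asub_scl Asub_asp lau_intros, rule asp_cons[OF Suc.IH[of ys "wt ys"]])
      (use xs in \<open>auto simp: wwords_def fun_eq_iff\<close>)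
  have "gen (Suc i) * tens_id n d (wd ys)
      \<in> asp (wwords n (Suc d) (\<lambda>k. m k - root (i, Suc i) k))" if "x = i"
    using xs that assms(1)
    by (auto simp: tens_id_wd gen_wd wwords_def root_def eps_def kc_def fun_eq_iff
      intro!: asp_wd)
  with * show ?case using xs
    by (auto simp: op_F gen_wd[symmetric] intro: Asub_add Asub_asp)
qed

lemma E_asp: "i \<in> {1..<n} \<Longrightarrow> t \<in> asp (wwords n d m) \<Longrightarrow>
    tens_op n d (GE i) t \<in> asp (wwords n d (\<lambda>k. m k + root (i, Suc i) k))"
  by (rule lin_asp[OF lin_tens_op Asub_asp E_wd])

lemma F_asp: "i \<in> {1..<n} \<Longrightarrow> t \<in> asp (wwords n d m) \<Longrightarrow>
    tens_op n d (GF i) t \<in> asp (wwords n d (\<lambda>k. m k - root (i, Suc i) k))"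
  by (rule lin_asp[OF lin_tens_op Asub_asp F_wd])

section \<open>Root vectors of a quantum Serre system\<close>

text \<open>
  With \<open>u = v\<^sup>-\<^sup>1\<close> this is the recursion of \<open>X\<^bsub>\<alpha>\<^esub>\<close> for \<open>e = E\<close>, and that of \<open>X\<^bsub>-\<alpha>\<^esub>\<close> up to a power of
  \<open>-v\<close> for \<open>e = F\<close>.
\<close>

function brk :: "qfield \<Rightarrow> (nat \<Rightarrow> tens \<Rightarrow> tens) \<Rightarrow> nat \<Rightarrow> nat \<Rightarrow> tens \<Rightarrow> tens" where
  "brk u e i l = (if l \<le> Suc i then e i
     else (\<lambda>t. scl u (e i (brk u e (Suc i) l t)) - brk u e (Suc i) l (e i t)))"
  by auto
termination by (relation "measure (\<lambda>(u, e, i, l). l - i)") auto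

declare brk.simps [simp del]

text \<open>Only the quantum Serre relations are kept, so that the E and F root vectors share one
  calculus. The last assumption makes \<open>u + inverse u\<close> invertible.\<close>

locale serre =
  fixes n :: nat and e :: "nat \<Rightarrow> tens \<Rightarrow> tens" and u :: qfield
  assumes lin_e: "lin (e i)"
    and e_comm: "\<lbrakk>i \<in> {1..<n}; j \<in> {1..<n}; \<bar>int i - int j\<bar> \<noteq> 1\<rbrakk> \<Longrightarrow> e i (e j t) = e j (e i t)"
    and e_serre: "\<lbrakk>i \<in> {1..<n}; j \<in> {1..<n}; i = Suc j \<or> j = Suc i\<rbrakk> \<Longrightarrow>
      e i (e i (e j t)) - scl (u + inverse u) (e i (e j (e i t))) + e j (e i (e i t)) = 0"
    and u_nz: "u \<noteq> 0" and u_sq: "u * u + 1 \<noteq> 0"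
begin

abbreviation X :: "nat \<Rightarrow> nat \<Rightarrow> tens \<Rightarrow> tens" where "X \<equiv> brk u e"

lemma X_base: "X i (Suc i) = e i"
  by (simp add: brk.simps)

lemma X_rec: "Suc i < l \<Longrightarrow> X i l t = scl u (e i (X (Suc i) l t)) - X (Suc i) l (e i t)"
  by (simp add: brk.simps[of u e i l])

lemma lin_X: "lin (X i l)"
proof (induction "l - i" arbitrary: i)
  case (Suc m)
  have *: "lin (X (Suc i) l)" by (rule Suc) (use Suc in linarith)
  show ?case
    by (subst brk.simps) (auto intro!: lin_difff lin_sclf lin_e
      lin_comp[OF lin_e *, unfolded o_def] lin_comp[OF * lin_e, unfolded o_def])
qed (simp add: brk.simps lin_e)

lemmas X_lin = lin_simps[OF lin_X] lin_scl[OF lin_X] lin_simps[OF lin_e] lin_scl[OF lin_e]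

text \<open>\<open>X j l\<close> is built from \<open>e j\<close>, ..., \<open>e (l - 1)\<close>,
  whose indices all differ from \<open>k\<close> by at least 2.\<close>

lemma e_X_far:
  assumes "1 \<le> k" "k < n" "1 \<le> j" "j < l" "l \<le> n" "Suc k < j \<or> l < k"
  shows "e k (X j l t) = X j l (e k t)"
  using assms
proof (induction "l - j" arbitrary: j t)
  case (Suc m)
  show ?case
  proof (cases "Suc j < l")
    case True
    have IH: "e k (X (Suc j) l t) = X (Suc j) l (e k t)" for t
      by (rule Suc.hyps(1)) (use Suc True in auto)
    have "e k (e j t) = e j (e k t)" for t
      by (rule e_comm) (use Suc True in auto)
    with True IH show ?thesis by (simp add: X_rec[of j l] X_lin)
  next
    case False
    then have "l = Suc j" using Suc by auto
    with Suc show ?thesis by (auto simp: X_base intro!: e_comm)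
  qed
qed auto

lemma X_X_far:
  assumes "1 \<le> i" "i < j" "j < k" "k < l" "l \<le> n"
  shows "X i j (X k l t) = X k l (X i j t)"
  using assms
proof (induction "j - i" arbitrary: i t)
  case (Suc m)
  show ?case
  proof (cases "Suc i < j")
    case True
    have IH: "X (Suc i) j (X k l t) = X k l (X (Suc i) j t)" for t
      by (rule Suc.hyps(1)) (use Suc True in auto)
    have "e i (X k l t) = X k l (e i t)" for t
      by (rule e_X_far) (use Suc True in auto)
    with True IH show ?thesis by (simp add: X_rec[of i j] X_lin)
  next
    case False
    then have "j = Suc i" using Suc by auto
    with Suc show ?thesis by (auto simp: X_base intro!: e_X_far)
  qed
qed auto

text \<open>The recursion cuts a root after its first letter. It may be cut at any interior
  \<open>j\<close>, because \<open>e i\<close> commutes with \<open>X j l\<close> as long as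
  \<open>Suc i < j\<close>. The remaining relations come from choosing the cut well.\<close>

lemma X_split:
  assumes "1 \<le> i" "i < j" "j < l" "l \<le> n"
  shows "X i l t = scl u (X i j (X j l t)) - X j l (X i j t)"
  using assms
proof (induction "j - i" arbitrary: i t)
  case (Suc m)
  show ?case
  proof (cases "Suc i < j")
    case True
    have IH: "X (Suc i) l t = scl u (X (Suc i) j (X j l t)) - X j l (X (Suc i) j t)" for t
      by (rule Suc.hyps(1)) (use Suc True in auto)
    have "e i (X j l t) = X j l (e i t)" for t
      by (rule e_X_far) (use Suc True in auto)
    with True Suc.prems show ?thesis
      by (simp add: X_rec[of i l] X_rec[of i j] X_lin scl_simps IH)
  next
    case False
    then have "j = Suc i" using Suc by auto
    with Suc.prems show ?thesis by (simp add: X_base X_rec[of i l])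
  qed
qed auto

lemma serre_end:
  assumes "i \<in> {1..<n}" "j \<in> {1..<n}" "i = Suc j \<or> j = Suc i"
  shows "e i (e i (e j t)) = scl (u + inverse u) (e i (e j (e i t))) - e j (e i (e i t))"
proof -
  have "x - y + z = 0 \<Longrightarrow> x = y - z" for x y z :: tens
    by (simp add: eq_diff_eq diff_add_eq)
  then show ?thesis using e_serre[OF assms] by blast
qed

text \<open>The condition on \<open>q\<close> makes it the inverse of \<open>u + inverse u\<close>,
  so the Serre relation can be solved for the word with \<open>e j\<close> in the middle.\<close>

lemma serre_mid:
  assumes "i \<in> {1..<n}" "j \<in> {1..<n}" "i = Suc j \<or> j = Suc i" and q: "q * (u * u + 1) = u"
  shows "e i (e j (e i t)) = scl q (e i (e i (e j t)) + e j (e i (e i t)))"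
proof -
  have "q * (u + inverse u) * u = u"
    using q u_nz by (simp add: distrib_left distrib_right mult.assoc)
  then have *: "q * (u + inverse u) = 1"
    using u_nz by simp
  show ?thesis
    unfolding serre_end[OF assms(1-3)] diff_add_cancel scl_simps(1) * scl_simps(2) ..
qed

text \<open>The difference of the two sides is \<open>u\<close> times the Serre relation.\<close>

lemma e_X_start2:
  assumes "1 \<le> i" "Suc i < n"
  shows "e i (X i (Suc (Suc i)) t) = scl u (X i (Suc (Suc i)) (e i t))"
proof -
  have *: "e i (e i (e (Suc i) t)) = scl (u + inverse u) (e i (e (Suc i) (e i t))) - e (Suc i) (e i (e i t))"
    by (rule serre_end) (use assms in auto)
  have "u * (u + inverse u) = u * u + 1"
    using u_nz by (simp add: distrib_left)
  with * show ?thesis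
    by (simp add: X_rec[of i "Suc (Suc i)"] X_base X_lin scl_simps)
      (rule poly_mapping_eqI, simp add: lookup_scl lookup_minus lookup_add distrib_right)
qed

text \<open>
  In the difference of the two sides every \<open>e\<^sub>2 e\<^sub>1 e\<^sub>2\<close> and \<open>e\<^sub>2 e\<^sub>3 e\<^sub>2\<close> can be eliminated since
  \<open>u + u\<^sup>-\<^sup>1\<close> is invertible, and what remains cancels.
\<close>

lemma e_X_mid3:
  assumes "1 \<le> i" "Suc (Suc i) < n"
  shows "e (Suc i) (X i (Suc (Suc (Suc i))) t) = X i (Suc (Suc (Suc i))) (e (Suc i) t)"
proof -
  let ?a = "e i" and ?b = "e (Suc i)" and ?c = "e (Suc (Suc i))"
  define q where "q = u / (u * u + 1)"
  have q: "q * (u * u + 1) = u"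
    using u_sq by (simp add: q_def)
  have ca: "?c (?a s) = ?a (?c s)" for s by (rule e_comm) (use assms in auto)
  have bab: "?b (?a (?b s)) = scl q (?b (?b (?a s)) + ?a (?b (?b s)))" for s
    by (rule serre_mid[OF _ _ _ q]) (use assms in auto)
  have bcb: "?b (?c (?b s)) = scl q (?b (?b (?c s)) + ?c (?b (?b s)))" for s
    by (rule serre_mid[OF _ _ _ q]) (use assms in auto)
  have zero: "u * u * q * x + (q * x - u * x) = 0" for x
  proof -
    have "u * u * q * x + (q * x - u * x) = (q * (u * u + 1) - u) * x"
      by (simp add: algebra_simps)
    then show ?thesis by (simp add: q)
  qed
  show ?thesis
  proof (rule poly_mapping_eqI)
    fix w
    show "Poly_Mapping.lookup (?b (X i (Suc (Suc (Suc i))) t)) w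
        = Poly_Mapping.lookup (X i (Suc (Suc (Suc i))) (?b t)) w"
      by (simp add: X_rec[of i "Suc (Suc (Suc i))"] X_rec[of "Suc i" "Suc (Suc (Suc i))"]
          X_base X_lin scl_simps ca bab bcb lookup_scl lookup_minus lookup_add)
        (simp add: mult.assoc[symmetric] zero)
  qed
qed

text \<open>Only the letters next to \<open>k\<close> matter. Cutting at \<open>k - 1\<close> and
  \<open>k + 2\<close> leaves a three-letter root with \<open>k\<close> in the middle, treated by
  \<open>e_X_mid3\<close>, and outer pieces that are far from \<open>k\<close>.\<close>

lemma e_X_inside:
  assumes "1 \<le> i" "i < k" "Suc k < l" "l \<le> n"
  shows "e k (X i l t) = X i l (e k t)"
proof -
  have 1: "e (Suc j) (X j l t) = X j l (e (Suc j) t)" if "1 \<le> j" "Suc (Suc j) < l" for j t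
  proof (cases "l = Suc (Suc (Suc j))")
    case True
    then show ?thesis using e_X_mid3[of j t] that assms by simp
  next
    case False
    have "e (Suc j) (X (Suc (Suc (Suc j))) l t) = X (Suc (Suc (Suc j))) l (e (Suc j) t)" for t
      by (rule e_X_far) (use that False assms in auto)
    moreover have "e (Suc j) (X j (Suc (Suc (Suc j))) t) = X j (Suc (Suc (Suc j))) (e (Suc j) t)" for t
      by (rule e_X_mid3) (use that False assms in auto)
    ultimately show ?thesis
      using X_split[of j "Suc (Suc (Suc j))" l] that False assms by (simp add: X_lin)
  qed
  obtain j where k: "k = Suc j" using assms by (cases k) auto
  show ?thesis
  proof (cases "i = j")
    case True
    then show ?thesis using 1[of j t] assms k by simp
  next
    case False
    have "e k (X i j t) = X i j (e k t)" for t
      by (rule e_X_far) (use False assms k in auto)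
    with 1[of j] show ?thesis
      using X_split[of i j l] False assms k by (simp add: X_lin)
  qed
qed

text \<open>Every letter of the inner root lies strictly inside the outer root, so
  \<open>e_X_inside\<close> applies to each of them.\<close>

lemma X_nested:
  assumes "1 \<le> i" "i < k" "k < l" "l < j" "j \<le> n"
  shows "X k l (X i j t) = X i j (X k l t)"
  using assms(2,3)
proof (induction "l - k" arbitrary: k t)
  case (Suc m)
  have ek: "e k (X i j t) = X i j (e k t)" for t
    by (rule e_X_inside) (use Suc assms in auto)
  show ?case
  proof (cases "Suc k < l")
    case True
    have IH: "X (Suc k) l (X i j t) = X i j (X (Suc k) l t)" for t
      by (rule Suc.hyps(1)) (use Suc True in auto)
    with True ek show ?thesis by (simp add: X_rec[of k l] X_lin)
  next
    case False
    then have "l = Suc k" using Suc by auto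
    with ek show ?thesis by (simp add: X_base)
  qed
qed auto

lemma e_X_start:
  assumes "1 \<le> i" "Suc i < l" "l \<le> n"
  shows "e i (X i l t) = scl u (X i l (e i t))"
proof (cases "l = Suc (Suc i)")
  case True
  then show ?thesis using e_X_start2[of i t] assms by simp
next
  case False
  have "e i (X (Suc (Suc i)) l t) = X (Suc (Suc i)) l (e i t)" for t
    by (rule e_X_far) (use False assms in auto)
  moreover have "e i (X i (Suc (Suc i)) t) = scl u (X i (Suc (Suc i)) (e i t))" for t
    by (rule e_X_start2) (use False assms in auto)
  ultimately show ?thesis
    using X_split[of i "Suc (Suc i)" l] False assms by (simp add: X_lin scl_simps)
qed

text \<open>The factor \<open>u\<close> comes from the common first letter alone; the other letters
  of the shorter root lie strictly inside the longer one and commute with it.\<close>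

lemma X_same_start:
  assumes "1 \<le> i" "i < j" "j < l" "l \<le> n"
  shows "X i j (X i l t) = scl u (X i l (X i j t))"
proof (cases "j = Suc i")
  case True
  then show ?thesis using e_X_start assms by (simp add: X_base)
next
  case False
  have "X (Suc i) j (X i l t) = X i l (X (Suc i) j t)" for t
    by (rule X_nested) (use False assms in auto)
  moreover have "e i (X i l t) = scl u (X i l (e i t))" for t
    by (rule e_X_start) (use False assms in auto)
  ultimately show ?thesis using assms False
    by (simp add: X_rec[of i j] X_lin scl_simps)
qed

text \<open>Cut \<open>X i j\<close> at \<open>k\<close>. Then \<open>X k j\<close> passes
  \<open>X k l\<close> by the rule for a common start, and \<open>X i k\<close> passes
  \<open>X k l\<close> at the cost of the joined root \<open>X i l\<close>. The two occurrences of
  \<open>X i l\<close> carry \<open>u\<close> and \<open>- inverse u\<close>.\<close>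

lemma X_crossing:
  assumes "1 \<le> i" "i < k" "k < j" "j < l" "l \<le> n"
  shows "X i j (X k l t) = X k l (X i j t) + scl (u - inverse u) (X i l (X k j t))"
proof -
  have a: "X i j t = scl u (X i k (X k j t)) - X k j (X i k t)" for t
    by (rule X_split) (use assms in auto)
  have b: "X k j (X k l t) = scl u (X k l (X k j t))" for t
    by (rule X_same_start) (use assms in auto)
  have c: "X i l t = scl u (X i k (X k l t)) - X k l (X i k t)" for t
    by (rule X_split) (use assms in auto)
  have d: "X i k (X k l t) = scl (inverse u) (X i l t + X k l (X i k t))" for t
    using c[of t] u_nz by (simp add: scl_simps)
  have f: "X k j (X i l t) = X i l (X k j t)" for t
    by (rule X_nested) (use assms in auto)
  show ?thesis using u_nz
    by (simp add: a b d f X_lin scl_simps)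
      (rule poly_mapping_eqI, simp add: lookup_scl lookup_minus lookup_add field_simps)
qed

end

section \<open>Straightening products of root vectors\<close>

text \<open>Insertion sort: the head of \<open>A\<close> is moved to the front of \<open>B\<close>,
  behind the part \<open>pre\<close> that is already in place. Fixing the multiset \<open>m\<close>
  means that swaps are assumed only for rearrangements of the same entries.\<close>

lemma adjacent_swaps:
  assumes swap: "\<And>L1 a b L2. mset (L1 @ a # b # L2) = m \<Longrightarrow> P (L1 @ a # b # L2) \<longleftrightarrow> P (L1 @ b # a # L2)"
    and "mset (pre @ A) = m" "mset A = mset B"
  shows "P (pre @ A) \<longleftrightarrow> P (pre @ B)"
  using assms(2,3)
proof (induction A arbitrary: pre B)
  case (Cons a A)
  have move: "P (pre @ C @ a # D) \<longleftrightarrow> P (pre @ a # C @ D)" if "mset (pre @ C @ a # D) = m" for C D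
    using that
  proof (induction C arbitrary: D rule: rev_induct)
    case (snoc c C)
    have "P ((pre @ C) @ c # a # D) \<longleftrightarrow> P ((pre @ C) @ a # c # D)"
      by (rule swap) (use snoc.prems in simp)
    also have "\<dots> \<longleftrightarrow> P (pre @ a # C @ c # D)"
      using snoc.IH[of "c # D"] snoc.prems by (simp add: add_mset_commute)
    finally show ?case by simp
  qed simp
  have "a \<in> set B" using Cons.prems(2) by (metis list.set_intros(1) set_mset_mset)
  then obtain C D where B: "B = C @ a # D" by (meson split_list)
  have "P ((pre @ [a]) @ A) \<longleftrightarrow> P ((pre @ [a]) @ C @ D)"
    by (rule Cons.IH) (use Cons.prems B in auto)
  moreover have "mset (pre @ C @ a # D) = m" using Cons.prems B by simp
  ultimately show ?case using move B by simp
qed simp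

definition rsum :: "(nat \<times> nat) list \<Rightarrow> nat \<Rightarrow> int" where
  "rsum L k = (\<Sum>\<alpha>\<leftarrow>L. root \<alpha> k)"

text \<open>The sum of the squared lengths grows when two roots are joined or uncrossed.\<close>

definition defect :: "nat \<Rightarrow> (nat \<times> nat) list \<Rightarrow> int" where
  "defect n L = (\<Sum>\<alpha>\<leftarrow>L. int n * int n - (int (snd \<alpha>) - int (fst \<alpha>))\<^sup>2)"

text \<open>Distinct starts and ends rule out pairs of roots with a common start or end, and
  repetitions, so the list is determined by its set up to order.\<close>

definition matching :: "nat \<Rightarrow> (nat \<times> nat) list \<Rightarrow> bool" where
  "matching n L \<longleftrightarrow> set L \<subseteq> pos_roots n \<and> distinct (map fst L) \<and> distinct (map snd L)"

text \<open>Starts and ends are compared as sets under inclusion, since joining (i, j) and (j, l)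
  loses the start j and the end j. The strictly smaller defect makes the relation
  well-founded.\<close>

definition refines :: "nat \<Rightarrow> (nat \<times> nat) list \<Rightarrow> (nat \<times> nat) list \<Rightarrow> bool" where
  "refines n R L \<longleftrightarrow> matching n R \<and> fst ` set R \<subseteq> fst ` set L \<and> snd ` set R \<subseteq> snd ` set L \<and>
     rsum R = rsum L \<and> defect n R < defect n L"

lemma defect_nonneg: "set L \<subseteq> pos_roots n \<Longrightarrow> 0 \<le> defect n L"
proof (induction L)
  case (Cons \<alpha> L)
  then have "(int (snd \<alpha>) - int (fst \<alpha>))\<^sup>2 \<le> (int n)\<^sup>2"
    by (intro power_mono) (auto simp: pos_roots_def)
  with Cons show ?case by (simp add: defect_def power2_eq_square)
qed (simp add: defect_def)

text \<open>The starts of \<open>R\<close> are among those of the replaced pair, hence still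
  different from the starts of the other roots; likewise for ends. Sums and defects are
  additive.\<close>

lemma refines_append:
  assumes "refines n R [\<alpha>, \<beta>]" "matching n (L1 @ \<alpha> # \<beta> # L2)"
  shows "refines n (L1 @ R @ L2) (L1 @ \<alpha> # \<beta> # L2)"
proof -
  have *: "distinct (map f (L1 @ R @ L2)) \<and> f ` set (L1 @ R @ L2) \<subseteq> f ` set (L1 @ \<alpha> # \<beta> # L2)"
    if "distinct (map f R)" "f ` set R \<subseteq> f ` set [\<alpha>, \<beta>]" "distinct (map f (L1 @ \<alpha> # \<beta> # L2))"
    for f :: "nat \<times> nat \<Rightarrow> nat"
  proof -
    define A B C where "A = f ` set L1" and "B = f ` set R" and "C = f ` set L2"
    have "B \<subseteq> {f \<alpha>, f \<beta>}" using that by (simp add: B_def)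
    moreover have "f \<alpha> \<notin> A \<union> C" "f \<beta> \<notin> A \<union> C" "A \<inter> C = {}"
      using that(3) by (auto simp: A_def C_def)
    ultimately have "A \<inter> B = {}" "A \<inter> C = {}" "B \<inter> C = {}" "A \<union> (B \<union> C) \<subseteq> A \<union> ({f \<alpha>, f \<beta>} \<union> C)"
      by blast+
    then show ?thesis using that unfolding A_def B_def C_def
      by (simp add: image_Un Int_Un_distrib)
  qed
  have "set (L1 @ R @ L2) \<subseteq> pos_roots n"
    using assms by (simp add: refines_def matching_def)
  moreover have "rsum (L1 @ R @ L2) = rsum (L1 @ \<alpha> # \<beta> # L2)"
    "defect n (L1 @ R @ L2) < defect n (L1 @ \<alpha> # \<beta> # L2)"
    using assms(1) by (simp_all add: refines_def rsum_def defect_def fun_eq_iff)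
  ultimately show ?thesis
    using *[of fst] *[of snd] assms by (simp only: refines_def matching_def set_map)
qed

lemma matching_perm:
  assumes "mset L = mset L'"
  shows "matching n L \<longleftrightarrow> matching n L'"
proof -
  have "distinct (map f L) \<longleftrightarrow> distinct (map f L')" for f :: "nat \<times> nat \<Rightarrow> nat"
    by (rule mset_eq_imp_distinct_iff) (simp add: assms)
  with mset_eq_setD[OF assms] show ?thesis by (simp add: matching_def)
qed

lemma refines_perm:
  assumes "mset L = mset L'"
  shows "refines n R L \<longleftrightarrow> refines n R L'"
proof -
  have "(\<Sum>\<alpha>\<leftarrow>L. f \<alpha>) = (\<Sum>\<alpha>\<leftarrow>L'. f \<alpha>)" for f :: "nat \<times> nat \<Rightarrow> int"
    using assms by (metis mset_map sum_mset_sum_list)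
  with mset_eq_setD[OF assms] show ?thesis
    by (simp add: refines_def rsum_def[abs_def] defect_def)
qed

lemma refines_trans:
  assumes "refines n R L" "refines n L L'"
  shows "refines n R L'"
proof -
  have "fst ` set R \<subseteq> fst ` set L'" "snd ` set R \<subseteq> snd ` set L'"
    using assms unfolding refines_def by (meson order_trans)+
  with assms show ?thesis by (simp add: refines_def)
qed

locale straight =
  fixes n :: nat and Y :: "nat \<times> nat \<Rightarrow> tens \<Rightarrow> tens"
  assumes lin_Y: "lin (Y \<alpha>)"
    and Y_comm: "\<lbrakk>(i, j) \<in> pos_roots n; (k, l) \<in> pos_roots n; i < k; j < k \<or> l < j\<rbrakk> \<Longrightarrow>
      Y (i, j) (Y (k, l) t) = Y (k, l) (Y (i, j) t)"
    and Y_cross: "\<lbrakk>(i, j) \<in> pos_roots n; (k, l) \<in> pos_roots n; i < k; k < j; j < l\<rbrakk> \<Longrightarrow>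
      \<exists>a\<in>lau. \<forall>t. Y (i, j) (Y (k, l) t) = Y (k, l) (Y (i, j) t) + scl a (Y (i, l) (Y (k, j) t))"
    and Y_join: "\<lbrakk>(i, j) \<in> pos_roots n; (j, l) \<in> pos_roots n\<rbrakk> \<Longrightarrow>
      \<exists>a\<in>lau_units. \<exists>b\<in>lau. \<forall>t. Y (i, j) (Y (j, l) t) = scl a (Y (j, l) (Y (i, j) t)) + scl b (Y (i, l) t)"
begin

lemma lin_foldr_Y: "lin (foldr Y L)"
proof (induction L)
  case (Cons \<alpha> L)
  then show ?case using lin_comp[OF lin_Y, of "foldr Y L" \<alpha>] by (simp add: o_def)
qed (simp add: lin_def)

text \<open>Disjoint and nested roots commute, which is encoded by \<open>b = 0\<close>; adjacent
  roots produce the joined root; crossing roots produce the uncrossed, nested pair.\<close>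

lemma Y_swap_less:
  assumes "\<alpha> \<in> pos_roots n" "\<beta> \<in> pos_roots n" "fst \<alpha> < fst \<beta>" "snd \<alpha> \<noteq> snd \<beta>"
  shows "\<exists>a\<in>lau_units. \<exists>b\<in>lau. \<exists>R. (b = 0 \<or> refines n R [\<alpha>, \<beta>]) \<and>
    (\<forall>t. Y \<alpha> (Y \<beta> t) = scl a (Y \<beta> (Y \<alpha> t)) + scl b (foldr Y R t))"
proof -
  obtain i j k l where ab: "\<alpha> = (i, j)" "\<beta> = (k, l)" by (cases \<alpha>; cases \<beta>)
  have r: "1 \<le> i" "i < j" "j \<le> n" "k < l" "l \<le> n" "i < k" "j \<noteq> l"
    using assms by (auto simp: ab pos_roots_def)
  consider "j < k \<or> l < j" | "k = j" | "k < j" "j < l" using r by linarith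
  then show ?thesis
  proof cases
    case 1
    then show ?thesis using Y_comm[of i j k l] assms
      by (intro bexI[of _ 1] bexI[of _ 0]) (auto simp: ab scl_simps scl_0 intro: lau_intros)
  next
    case 2
    then obtain a b where *: "a \<in> lau_units" "b \<in> lau"
      "\<And>t. Y (i, j) (Y (j, l) t) = scl a (Y (j, l) (Y (i, j) t)) + scl b (Y (i, l) t)"
      using Y_join[of i j l] assms ab by auto
    \<comment> \<open>Squared length is superadditive, and joining also removes one root, hence one
      summand \<open>n * n\<close> of the defect.\<close>
    have "(int l - int i)\<^sup>2 = (int l - int j)\<^sup>2 + (int j - int i)\<^sup>2 + 2 * ((int l - int j) * (int j - int i))"
      by (simp add: power2_eq_square algebra_simps)
    moreover have "0 \<le> (int l - int j) * (int j - int i)" "0 < int n * int n" using r 2 by auto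
    ultimately have "(int l - int j)\<^sup>2 + (int j - int i)\<^sup>2 < int n * int n + (int l - int i)\<^sup>2"
      by linarith
    then have "refines n [(i, l)] [\<alpha>, \<beta>]"
      using r 2 by (auto simp: ab refines_def matching_def pos_roots_def rsum_def defect_def root_def fun_eq_iff)
    with * show ?thesis
      by (intro bexI[of _ a] bexI[of _ b] exI[of _ "[(i, l)]"]) (auto simp: ab 2)
  next
    case 3
    then obtain a where *: "a \<in> lau"
      "\<And>t. Y (i, j) (Y (k, l) t) = Y (k, l) (Y (i, j) t) + scl a (Y (i, l) (Y (k, j) t))"
      using Y_cross[of i j k l] assms ab r by auto
    have "(int l - int i)\<^sup>2 + (int j - int k)\<^sup>2 = (int l - int k)\<^sup>2 + (int j - int i)\<^sup>2
       + 2 * ((int l - int j) * (int k - int i))"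
      by (simp add: power2_eq_square algebra_simps)
    moreover have "0 < (int l - int j) * (int k - int i)" using r 3 by auto
    ultimately have "(int l - int k)\<^sup>2 + (int j - int i)\<^sup>2 < (int l - int i)\<^sup>2 + (int j - int k)\<^sup>2"
      by linarith
    then have "refines n [(i, l), (k, j)] [\<alpha>, \<beta>]"
      using r 3 by (auto simp: ab refines_def matching_def pos_roots_def rsum_def defect_def root_def fun_eq_iff)
    with * show ?thesis
      by (intro bexI[of _ 1] bexI[of _ a] exI[of _ "[(i, l), (k, j)]"]) (auto simp: ab scl_simps intro: lau_intros)
  qed
qed

text \<open>In the opposite order the relation is solved for the other product, which stays over
  \<A> because \<open>a\<close> is a unit.\<close>

lemma Y_swap:
  assumes "matching n [\<alpha>, \<beta>]"
  shows "\<exists>a\<in>lau_units. \<exists>b\<in>lau. \<exists>R. (b = 0 \<or> refines n R [\<alpha>, \<beta>]) \<and>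
    (\<forall>t. Y \<alpha> (Y \<beta> t) = scl a (Y \<beta> (Y \<alpha> t)) + scl b (foldr Y R t))"
proof (cases "fst \<alpha> < fst \<beta>")
  case True
  then show ?thesis using assms by (intro Y_swap_less) (auto simp: matching_def)
next
  case False
  then obtain a b R where *: "a \<in> lau_units" "b \<in> lau" "b = 0 \<or> refines n R [\<beta>, \<alpha>]"
    "\<And>t. Y \<beta> (Y \<alpha> t) = scl a (Y \<alpha> (Y \<beta> t)) + scl b (foldr Y R t)"
    using Y_swap_less[of \<beta> \<alpha>] assms by (fastforce simp: matching_def)
  have "refines n R [\<alpha>, \<beta>] \<longleftrightarrow> refines n R [\<beta>, \<alpha>]"
    by (rule refines_perm) simp
  moreover have "Y \<alpha> (Y \<beta> t) = scl (inverse a) (Y \<beta> (Y \<alpha> t)) + scl (- (inverse a * b)) (foldr Y R t)" for t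
    using lau_units_nz[OF *(1)]
    by (simp add: *(4) scl_simps) (rule poly_mapping_eqI, simp add: lookup_scl lookup_add)
  ultimately show ?thesis using *
    by (intro bexI[of _ "inverse a"] bexI[of _ "- (inverse a * b)"] exI[of _ R])
      (auto intro: lau_intros lau_units_inverse)
qed

text \<open>Modulo refinements, which lie in \<open>M\<close> by assumption, an interchange is
  multiplication by a unit.\<close>

lemma straighten_swap:
  assumes "Asub M" "matching n (L1 @ \<alpha> # \<beta> # L2)"
    and "\<And>R. refines n R (L1 @ \<alpha> # \<beta> # L2) \<Longrightarrow> foldr Y R t \<in> M"
  shows "foldr Y (L1 @ \<alpha> # \<beta> # L2) t \<in> M \<longleftrightarrow> foldr Y (L1 @ \<beta> # \<alpha> # L2) t \<in> M"
proof -
  have "matching n [\<alpha>, \<beta>]" using assms(2) by (auto simp: matching_def)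
  then obtain a b R where *: "a \<in> lau_units" "b \<in> lau" "b = 0 \<or> refines n R [\<alpha>, \<beta>]"
    "\<And>t. Y \<alpha> (Y \<beta> t) = scl a (Y \<beta> (Y \<alpha> t)) + scl b (foldr Y R t)"
    using Y_swap by blast
  have eq: "foldr Y (L1 @ \<alpha> # \<beta> # L2) t
      = scl a (foldr Y (L1 @ \<beta> # \<alpha> # L2) t) + scl b (foldr Y (L1 @ R @ L2) t)"
    using lin_foldr_Y[of L1] by (simp add: *(4) lin_simps lin_scl)
  have "scl b (foldr Y (L1 @ R @ L2) t) \<in> M"
  proof (cases "b = 0")
    case False
    then have "refines n (L1 @ R @ L2) (L1 @ \<alpha> # \<beta> # L2)"
      using * by (intro refines_append assms) auto
    from Asub_scl[OF assms(1) *(2) assms(3)[OF this]] show ?thesis .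
  qed (use assms(1) in \<open>simp add: scl_0 Asub_0\<close>)
  then have "foldr Y (L1 @ \<alpha> # \<beta> # L2) t \<in> M \<longleftrightarrow> scl a (foldr Y (L1 @ \<beta> # \<alpha> # L2) t) \<in> M"
    unfolding eq using assms(1) by (metis Asub_add Asub_diff add_diff_cancel_right')
  then show ?thesis using Asub_unit[OF assms(1) *(1)] by simp
qed

text \<open>\<open>M\<close> is an arbitrary submodule so that the result can be used for a preimage
  as well: F factors are reordered underneath a fixed product of E factors.\<close>

lemma straighten:
  assumes "Asub M" "matching n L" "distinct rs" "set rs = pos_roots n"
    and "\<And>S. \<lbrakk>S \<subseteq> pos_roots n; inj_on fst S; inj_on snd S; fst ` S \<subseteq> fst ` set L; snd ` S \<subseteq> snd ` set L;
      \<And>k. (\<Sum>\<alpha>\<in>S. root \<alpha> k) = (\<Sum>\<alpha>\<in>set L. root \<alpha> k)\<rbrakk> \<Longrightarrow> foldr Y (filter (\<lambda>\<alpha>. \<alpha> \<in> S) rs) t \<in> M"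
  shows "foldr Y L t \<in> M"
proof -
  have dist: "distinct L'" if "matching n L'" for L'
    using that by (auto simp: matching_def distinct_map)
  have sum: "rsum L' k = (\<Sum>\<alpha>\<in>set L'. root \<alpha> k)" if "matching n L'" for L' k
    using dist[OF that] by (simp add: rsum_def sum_list_distinct_conv_sum_set)
  \<comment> \<open>Strengthening the claim to all refinements of \<open>L\<close> makes the error
    terms of every swap available by induction on the defect.\<close>
  have "foldr Y L' t \<in> M" if "L' = L \<or> refines n L' L" for L'
    using that
  proof (induction "nat (defect n L')" arbitrary: L' rule: less_induct)
    case less
    have m: "matching n L'" using less.prems assms(2) by (auto simp: refines_def)
    let ?s = "filter (\<lambda>\<alpha>. \<alpha> \<in> set L') rs"
    have low: "foldr Y R t \<in> M" if "refines n R L'" for R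
    proof (rule less.hyps)
      have "0 \<le> defect n R" using that by (intro defect_nonneg) (auto simp: refines_def matching_def)
      then show "nat (defect n R) < nat (defect n L')" using that by (auto simp: refines_def)
      show "R = L \<or> refines n R L" using less.prems refines_trans[OF that] that by blast
    qed
    have "set ?s = set L'" using m assms(4) by (auto simp: matching_def)
    then have ms: "mset L' = mset ?s"
      using iffD1[OF set_eq_iff_mset_eq_distinct[of L' ?s]] dist[OF m] distinct_filter[OF assms(3)] by blast
    have sw: "foldr Y (L1 @ a # b # L2) t \<in> M \<longleftrightarrow> foldr Y (L1 @ b # a # L2) t \<in> M"
      if p: "mset (L1 @ a # b # L2) = mset L'" for L1 a b L2
      using matching_perm[OF p] m refines_perm[OF p] low by (intro straighten_swap assms(1)) blast+
    have "foldr Y ([] @ L') t \<in> M \<longleftrightarrow> foldr Y ([] @ ?s) t \<in> M"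
      by (rule adjacent_swaps[of "mset L'" "\<lambda>L. foldr Y L t \<in> M", OF sw _ ms]) simp_all
    moreover have "foldr Y ?s t \<in> M"
    proof (rule assms(5))
      show "set L' \<subseteq> pos_roots n" "inj_on fst (set L')" "inj_on snd (set L')"
        using m by (auto simp: matching_def distinct_map)
      show "fst ` set L' \<subseteq> fst ` set L" "snd ` set L' \<subseteq> snd ` set L"
        using less.prems by (auto simp: refines_def)
      show "(\<Sum>\<alpha>\<in>set L'. root \<alpha> k) = (\<Sum>\<alpha>\<in>set L. root \<alpha> k)" for k
        using less.prems sum[OF m] sum[OF assms(2)] by (auto simp: refines_def)
    qed
    ultimately show ?case by simp
  qed
  then show ?thesis by blast
qed

end

section \<open>Root vectors on tensor space\<close>

definition XE :: "nat \<Rightarrow> nat \<Rightarrow> nat \<Rightarrow> nat \<Rightarrow> tens \<Rightarrow> tens" where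
  "XE n d = brk (inverse vv) (\<lambda>i. tens_op n d (GE i))"

definition XF :: "nat \<Rightarrow> nat \<Rightarrow> nat \<Rightarrow> nat \<Rightarrow> tens \<Rightarrow> tens" where
  "XF n d = brk (inverse vv) (\<lambda>i. tens_op n d (GF i))"

lemma vv_sq_plus_1: "inverse vv * inverse vv + 1 \<noteq> 0"
proof
  assume "inverse vv * inverse vv + 1 = 0"
  moreover have "vv * vv * (inverse vv * inverse vv + 1) = vv * vv + 1"
    using vv_nonzero by (simp add: field_simps)
  ultimately have "vv * vv + 1 = 0" by simp
  then have "of_laurent (Poly_Mapping.single 1 1 * Poly_Mapping.single 1 1 + 1) = of_laurent 0"
    by (simp only: of_laurent_add of_laurent_mult vv_def of_laurent_1)
      (simp add: of_laurent_def Zero_fract_def)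
  then have "(Poly_Mapping.single 2 1 + 1 :: laurent) = 0"
    using inj_of_laurent by (simp add: inj_def mult_single)
  then have "Poly_Mapping.lookup (Poly_Mapping.single 2 1 + 1 :: laurent) 2 = 0" by simp
  then show False by (simp add: lookup_add lookup_one)
qed

lemma serre_E: "serre n (\<lambda>i. tens_op n d (GE i)) (inverse vv)"
  using R_EEE vv_sq_plus_1
  by unfold_locales (auto simp: lin_tens_op R_EE vv_nonzero add.commute[of "inverse vv" vv])

lemma serre_F: "serre n (\<lambda>i. tens_op n d (GF i)) (inverse vv)"
  using R_FFF vv_sq_plus_1
  by unfold_locales (auto simp: lin_tens_op R_FF vv_nonzero add.commute[of "inverse vv" vv])

lemmas XE_base = serre.X_base[OF serre_E, folded XE_def]
lemmas XF_base = serre.X_base[OF serre_F, folded XF_def]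
lemmas XE_rec = serre.X_rec[OF serre_E, folded XE_def]
lemmas XF_rec = serre.X_rec[OF serre_F, folded XF_def]
lemmas lin_XE = serre.lin_X[OF serre_E, folded XE_def]
lemmas lin_XF = serre.lin_X[OF serre_F, folded XF_def]
lemmas XE_lin = lin_simps[OF lin_XE] lin_scl[OF lin_XE]
lemmas XF_lin = lin_simps[OF lin_XF] lin_scl[OF lin_XF]
lemmas E_XE_far = serre.e_X_far[OF serre_E, folded XE_def]

text \<open>Follows the recursion of the root vectors: \<open>l\<close> is fixed and
  \<open>i\<close> descends from \<open>l - 1\<close>.\<close>

lemma root_interval_induct [consumes 3, case_names base step]:
  assumes "1 \<le> i" "i < l" "l \<le> (n :: nat)"
    and "\<And>i. \<lbrakk>1 \<le> i; i < n; l = Suc i\<rbrakk> \<Longrightarrow> P i"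
    and "\<And>i. \<lbrakk>1 \<le> i; Suc i < l; i < n; P (Suc i)\<rbrakk> \<Longrightarrow> P i"
  shows "P i"
  using assms(1-3)
proof (induction "l - i" arbitrary: i)
  case (Suc m)
  show ?case
  proof (cases "l = Suc i")
    case True
    with Suc.prems show ?thesis by (simp add: assms(4))
  next
    case False
    have "P (Suc i)" by (rule Suc.hyps(1)) (use Suc.hyps(2) Suc.prems False in linarith)+
    then show ?thesis by (rule assms(5)[rotated -1]) (use Suc.prems False in linarith)+
  qed
qed auto

section \<open>Root vectors and the comultiplication\<close>

lemma K_XE:
  assumes "1 \<le> i" "i < l" "l \<le> n"
  shows "tens_op n d (GK k) (XE n d i l t) = scl (vv powi (kc k i - kc k l)) (XE n d i l (tens_op n d (GK k) t))"
  using assms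
proof (induction i arbitrary: t rule: root_interval_induct)
  case (step i)
  then show ?case
    by (simp add: XE_rec[of i l] op_lin XE_lin R_KE scl_simps powi_mult ka_def mult.commute)
qed (simp add: XE_base R_KE ka_def)

lemma Kinv_XE:
  assumes "1 \<le> i" "i < l" "l \<le> n"
  shows "tens_op n d (GKinv k) (XE n d i l t) = scl (vv powi (kc k l - kc k i)) (XE n d i l (tens_op n d (GKinv k) t))"
  using assms
proof (induction i arbitrary: t rule: root_interval_induct)
  case (step i)
  then show ?case
    by (simp add: XE_rec[of i l] op_lin XE_lin R_KiE scl_simps powi_mult ka_def mult.commute)
qed (simp add: XE_base R_KiE ka_def)

text \<open>The coproduct of an E root vector on a first letter \<open>x\<close>. The letter
  \<open>l\<close> may drop to \<open>i\<close>; the root vector may act on the rest alone; or an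
  intermediate \<open>x\<close> drops to \<open>i\<close> while the remaining root from
  \<open>x\<close> to \<open>l\<close> acts on the rest. The third kind is the source of the
  non-leading words.\<close>

lemma XE_cons:
  assumes "1 \<le> i" "i < l" "l \<le> n" "x \<in> {1..n}"
  shows "XE n (Suc d) i l (gen x * t) =
    (if x = l then scl (inverse vv ^ (l - Suc i)) (gen i * tens_op n d (GK i) (tens_op n d (GKinv l) t)) else 0)
    + gen x * XE n d i l t
    + (if i < x \<and> x < l then scl ((inverse vv - vv) * inverse vv ^ (x - Suc i))
        (gen i * tens_op n d (GK i) (tens_op n d (GKinv x) (XE n d x l t))) else 0)"
  using assms
proof (induction i arbitrary: x t rule: root_interval_induct)
  case (base i)
  then show ?case by (auto simp: XE_base op_E scl_simps)
next
  case (step i)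
  have l: "l \<le> n" by fact
  have c: "tens_op n d (GK i) (tens_op n d (GKinv (Suc i)) (tens_op n d (GK (Suc i)) (tens_op n d (GKinv y) s)))
    = tens_op n d (GK i) (tens_op n d (GKinv y) s)" for y s
    by (simp add: R_KiK id_K')
  have e: "tens_op n d (GE i) (XE n d y l s) = XE n d y l (tens_op n d (GE i) s)" if "Suc i < y" "y < l" for y s
    by (rule E_XE_far) (use that step l in auto)
  have p: "inverse vv ^ (y - Suc i) = inverse vv * inverse vv ^ (y - Suc (Suc i))" if "Suc i < y" for y
  proof -
    have "y - Suc i = Suc (y - Suc (Suc i))" using that by simp
    then show ?thesis by simp
  qed
  consider "x = l" | "x = Suc i" | "Suc i < x" "x < l" | "x \<le> i \<or> l < x" by linarith
  then show ?case
  proof cases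
    case 1
    then show ?thesis using step l
      by (simp add: XE_rec[of i l] step.IH op_E op_lin XE_lin scl_simps c R_KE R_KiE ka_def p)
        (rule poly_mapping_eqI, simp add: lookup_scl lookup_minus lookup_add power_int_minus right_diff_distrib scl_simps)
  next
    case 2
    then show ?thesis using step l vv_nonzero
      by (simp add: XE_rec[of i l] step.IH op_E op_lin XE_lin scl_simps K_XE Kinv_XE)
        (rule poly_mapping_eqI, simp add: lookup_scl lookup_minus lookup_add power_int_minus right_diff_distrib scl_simps field_simps)
  next
    case 3
    then show ?thesis using step l
      by (simp add: XE_rec[of i l] step.IH op_E op_lin XE_lin scl_simps c R_KE R_KiE ka_def p e K_XE Kinv_XE)
        (rule poly_mapping_eqI, simp add: lookup_scl lookup_minus lookup_add power_int_minus right_diff_distrib scl_simps)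
  next
    case 4
    then show ?thesis using step l
      by (auto simp: XE_rec[of i l] step.IH op_E op_lin XE_lin scl_simps right_diff_distrib)
  qed
qed

lemma XF_id:
  assumes "1 \<le> i" "i < l" "l \<le> n"
  shows "XF n d i l (tens_id n d t) = XF n d i l t"
  using assms by (induction i arbitrary: t rule: root_interval_induct) (simp_all add: XF_base XF_rec op_id)

lemma id_XF:
  assumes "1 \<le> i" "i < l" "l \<le> n"
  shows "tens_id n d (XF n d i l t) = XF n d i l t"
  using assms
  by (induction i arbitrary: t rule: root_interval_induct)
    (simp_all add: XF_base XF_rec id_op uq_gens_def lin_simps[OF lin_tens_id] lin_scl[OF lin_tens_id])

text \<open>For \<open>x \<le> i\<close> there is no intermediate term. This is the only situation
  that arises when F root vectors are applied with decreasing start, since the letters to the left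
  are then still small.\<close>

lemma XF_cons:
  assumes "1 \<le> i" "i < l" "l \<le> n" "1 \<le> x" "x \<le> i"
  shows "XF n (Suc d) i l (gen x * t) =
    (if x = i then scl ((- 1) ^ (l - Suc i)) (gen l * tens_id n d t) else 0)
    + scl (vv powi (- kc x i)) (gen x * XF n d i l t)"
  using assms
proof (induction i arbitrary: x t rule: root_interval_induct)
  case (base i)
  then show ?case by (auto simp: XF_base op_F scl_simps kc_def)
next
  case (step i)
  have l: "l \<le> n" by fact
  have p: "(- 1 :: qfield) ^ (l - Suc i) = - ((- 1) ^ (l - Suc (Suc i)))"
  proof -
    have "l - Suc i = Suc (l - Suc (Suc i))" using step by simp
    then show ?thesis by simp
  qed
  show ?case using step.hyps step.prems l
    by (auto simp: XF_rec[of i l] step.IH op_F op_lin XF_lin scl_simps p kc_def op_id id_op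
      right_diff_distrib id_XF XF_id tens_id_idem lookup_scl lookup_minus lookup_add intro!: poly_mapping_eqI)
qed

section \<open>Weight shifts and vanishing\<close>

lemma XE_asp:
  assumes "1 \<le> i" "i < l" "l \<le> n" "t \<in> asp (wwords n d m)"
  shows "XE n d i l t \<in> asp (wwords n d (\<lambda>k. m k + root (i, l) k))"
  using assms
proof (induction i arbitrary: t m rule: root_interval_induct)
  case (base i)
  then show ?case by (simp add: XE_base E_asp)
next
  case (step i)
  have "tens_op n d (GE i) (XE n d (Suc i) l t) \<in> asp (wwords n d (\<lambda>k. m k + root (Suc i, l) k + root (i, Suc i) k))"
    using step by (intro E_asp step.IH) auto
  moreover have "XE n d (Suc i) l (tens_op n d (GE i) t) \<in> asp (wwords n d (\<lambda>k. m k + root (i, Suc i) k + root (Suc i, l) k))"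
    using step by (intro E_asp step.IH) auto
  ultimately show ?case
    using step by (auto simp: XE_rec[of i l] root_def intro!: Asub_diff Asub_scl Asub_asp lau_intros)
qed

lemma XF_asp:
  assumes "1 \<le> i" "i < l" "l \<le> n" "t \<in> asp (wwords n d m)"
  shows "XF n d i l t \<in> asp (wwords n d (\<lambda>k. m k - root (i, l) k))"
  using assms
proof (induction i arbitrary: t m rule: root_interval_induct)
  case (base i)
  then show ?case by (simp add: XF_base F_asp)
next
  case (step i)
  have "tens_op n d (GF i) (XF n d (Suc i) l t) \<in> asp (wwords n d (\<lambda>k. m k - root (Suc i, l) k - root (i, Suc i) k))"
    using step by (intro F_asp step.IH) auto
  moreover have "XF n d (Suc i) l (tens_op n d (GF i) t) \<in> asp (wwords n d (\<lambda>k. m k - root (i, Suc i) k - root (Suc i, l) k))"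
    using step by (intro F_asp step.IH) auto
  moreover have "(\<lambda>k. m k - root (Suc i, l) k - root (i, Suc i) k) = (\<lambda>k. m k - root (i, l) k)"
    "(\<lambda>k. m k - root (i, Suc i) k - root (Suc i, l) k) = (\<lambda>k. m k - root (i, l) k)"
    by (simp_all add: root_def fun_eq_iff)
  ultimately show ?case
    using step by (auto simp: XF_rec[of i l] intro!: Asub_diff Asub_scl Asub_asp lau_intros)
qed

lemma wwords_empty: "m k < 0 \<Longrightarrow> wwords n d m = {}"
  by (auto simp: wwords_def wt_def)

text \<open>The image would have weight -1 at \<open>l\<close>.\<close>

lemma XE_absent:
  assumes "1 \<le> i" "i < l" "l \<le> n" "xs \<in> words n d" "l \<notin> set xs"
  shows "XE n d i l (wd xs) = 0"
proof -
  have "XE n d i l (wd xs) \<in> asp (wwords n d (\<lambda>k. wt xs k + root (i, l) k))"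
    using assms by (intro XE_asp asp_wd) (auto simp: wwords_def)
  moreover have "wwords n d (\<lambda>k. wt xs k + root (i, l) k) = {}"
    by (rule wwords_empty[of _ l]) (use assms in \<open>simp add: wt_def root_def eps_def\<close>)
  ultimately show ?thesis using asp_empty by simp
qed

lemma XF_absent:
  assumes "1 \<le> i" "i < l" "l \<le> n" "xs \<in> words n d" "i \<notin> set xs"
  shows "XF n d i l (wd xs) = 0"
proof -
  have "XF n d i l (wd xs) \<in> asp (wwords n d (\<lambda>k. wt xs k - root (i, l) k))"
    using assms by (intro XF_asp asp_wd) (auto simp: wwords_def)
  moreover have "wwords n d (\<lambda>k. wt xs k - root (i, l) k) = {}"
    by (rule wwords_empty[of _ i]) (use assms in \<open>simp add: wt_def root_def eps_def\<close>)
  ultimately show ?thesis using asp_empty by simp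
qed

lemma serre_straight:
  assumes "serre n e (inverse vv)"
  shows "straight n (\<lambda>(i, l). brk (inverse vv) e i l)"
proof -
  interpret serre n e "inverse vv" by (rule assms)
  show ?thesis
  proof
    show "lin (case \<alpha> of (i, l) \<Rightarrow> X i l)" for \<alpha>
      by (cases \<alpha>) (simp add: lin_X)
  next
    fix i j k l t
    assume "(i, j) \<in> pos_roots n" "(k, l) \<in> pos_roots n" "i < k" "j < k \<or> l < j"
    then show "(case (i, j) of (i, l) \<Rightarrow> X i l) ((case (k, l) of (i, l) \<Rightarrow> X i l) t)
      = (case (k, l) of (i, l) \<Rightarrow> X i l) ((case (i, j) of (i, l) \<Rightarrow> X i l) t)"
      using X_X_far[of i j k l t] X_nested[of i k l j t] by (auto simp: pos_roots_def)
  next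
    fix i j k l
    assume "(i, j) \<in> pos_roots n" "(k, l) \<in> pos_roots n" "i < k" "k < j" "j < l"
    then show "\<exists>a\<in>lau. \<forall>t. (case (i, j) of (i, l) \<Rightarrow> X i l) ((case (k, l) of (i, l) \<Rightarrow> X i l) t)
      = (case (k, l) of (i, l) \<Rightarrow> X i l) ((case (i, j) of (i, l) \<Rightarrow> X i l) t)
        + scl a ((case (i, l) of (i, l) \<Rightarrow> X i l) ((case (k, j) of (i, l) \<Rightarrow> X i l) t))"
      using X_crossing[of i k j l]
      by (intro bexI[of _ "inverse vv - inverse (inverse vv)"])
        (auto simp: pos_roots_def intro: lau_intros)
  next
    fix i j l
    assume "(i, j) \<in> pos_roots n" "(j, l) \<in> pos_roots n"
    then have "X i l t = scl (inverse vv) (X i j (X j l t)) - X j l (X i j t)" for t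
      by (intro X_split) (auto simp: pos_roots_def)
    then have "X i j (X j l t) = scl vv (X j l (X i j t)) + scl vv (X i l t)" for t
      using vv_nonzero by (simp add: scl_simps)
    then show "\<exists>a\<in>lau_units. \<exists>b\<in>lau. \<forall>t. (case (i, j) of (i, l) \<Rightarrow> X i l) ((case (j, l) of (i, l) \<Rightarrow> X i l) t)
      = scl a ((case (j, l) of (i, l) \<Rightarrow> X i l) ((case (i, j) of (i, l) \<Rightarrow> X i l) t))
        + scl b ((case (i, l) of (i, l) \<Rightarrow> X i l) t)"
      using lau_vv lau_units_vv by auto
  qed
qed

lemmas straight_E = serre_straight[OF serre_E, folded XE_def]
lemmas straight_F = serre_straight[OF serre_F, folded XF_def]

section \<open>Root vectors in the free algebra\<close>

lemma root_vec_pos_action: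
  assumes "1 \<le> i" "i < l" "l \<le> n"
  shows "root_vec_pos i l \<in> uq_free n \<and> free_act n d (root_vec_pos i l) t = XE n d i l t"
  using assms
proof (induction i arbitrary: t rule: root_interval_induct)
  case (base i)
  then show ?case
    by (simp add: root_vec_pos.simps XE_base free_act_gen uq_free_gen uq_gens_def)
next
  case (step i)
  have "gen (GE i) \<in> uq_free n" using step by (intro uq_free_gen) (auto simp: uq_gens_def)
  with step show ?case
    by (subst (1 2) root_vec_pos.simps)
      (simp add: XE_rec[of i l] uq_frees mult.assoc free_act_simps free_act_mult free_act_gen scl_def)
qed

text \<open>Since v X F - F X = -v (v^-1 F X - X F), each step of the recursion for the negative
  root vectors differs from that of \<open>brk\<close> by the factor -v.\<close>

lemma root_vec_neg_action:
  assumes "1 \<le> i" "i < l" "l \<le> n"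
  shows "root_vec_neg i l \<in> uq_free n \<and>
    free_act n d (root_vec_neg i l) t = scl ((- vv) ^ (l - Suc i)) (XF n d i l t)"
  using assms
proof (induction i arbitrary: t rule: root_interval_induct)
  case (base i)
  then show ?case
    by (simp add: root_vec_neg.simps XF_base free_act_gen uq_free_gen uq_gens_def scl_simps)
next
  case (step i)
  have 1: "gen (GF i) \<in> uq_free n" using step by (intro uq_free_gen) (auto simp: uq_gens_def)
  have "l - Suc i = Suc (l - Suc (Suc i))" using step by simp
  then have 2: "(- vv) ^ (l - Suc i) = - vv * (- vv) ^ (l - Suc (Suc i))" by simp
  have 3: "root_vec_neg i l = cst vv * (root_vec_neg (Suc i) l * F i) - F i * root_vec_neg (Suc i) l"
    using step by (subst root_vec_neg.simps) (simp add: mult.assoc)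
  have IH: "root_vec_neg (Suc i) l \<in> uq_free n"
    "free_act n d (root_vec_neg (Suc i) l) t = scl ((- vv) ^ (l - Suc (Suc i))) (XF n d (Suc i) l t)" for t
    using step.IH by blast+
  have "free_act n d (root_vec_neg i l) t = scl vv (scl ((- vv) ^ (l - Suc (Suc i))) (XF n d (Suc i) l (tens_op n d (GF i) t)))
      - tens_op n d (GF i) (scl ((- vv) ^ (l - Suc (Suc i))) (XF n d (Suc i) l t))"
    by (simp add: 3 1 IH free_act_simps free_act_mult free_act_gen scl_def)
  also have "\<dots> = scl ((- vv) ^ (l - Suc i)) (XF n d i l t)"
    using step vv_nonzero
    by (simp add: XF_rec[of i l] op_lin scl_simps 2)
      (rule poly_mapping_eqI, simp add: lookup_scl lookup_minus)
  finally show ?case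
    using 1 3 IH(1) by (simp add: uq_frees)
qed

section \<open>The Hecke action on positions\<close>

text \<open>The standard generator T of the Hecke algebra acting on the letters with 0-based
  positions \<open>k\<close> and \<open>k + 1\<close>, normalised so that (T - v)(T + v^-1) = 0 and
  so that it commutes with the chosen comultiplication.\<close>

primrec hecke_op :: "nat \<Rightarrow> tens \<Rightarrow> tens" where
  "hecke_op 0 = lin_ext (\<lambda>w. case letters w of
      a # b # xs \<Rightarrow> if a = b then scl vv (wd (a # b # xs)) else if a < b then wd (b # a # xs)
        else wd (b # a # xs) + scl (vv - inverse vv) (wd (a # b # xs))
    | _ \<Rightarrow> 0)"
| "hecke_op (Suc k) = lin_ext (\<lambda>w. case letters w of [] \<Rightarrow> 0 | x # xs \<Rightarrow> gen x * hecke_op k (wd xs))"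

lemma lin_hecke_op: "lin (hecke_op k)"
  by (cases k) (simp_all add: lin_lin_ext)

lemmas hecke_lin = lin_simps[OF lin_hecke_op] lin_scl[OF lin_hecke_op]

lemma hecke_op_0_wd: "hecke_op 0 (wd (a # b # xs)) =
    (if a = b then scl vv (wd (a # b # xs)) else if a < b then wd (b # a # xs)
     else wd (b # a # xs) + scl (vv - inverse vv) (wd (a # b # xs)))"
  by (subst wd_def) simp

lemma hecke_op_Suc_wd: "hecke_op (Suc k) (wd (x # xs)) = gen x * hecke_op k (wd xs)"
  by (subst wd_def) simp

declare hecke_op.simps [simp del]

lemma lin_gen_comp: "lin f \<Longrightarrow> lin (\<lambda>t. gen x * f t)"
  using lin_comp[OF lin_lmult, of f "gen x"] by (simp add: o_def)

lemma lin_comp_gen: "lin f \<Longrightarrow> lin (\<lambda>t. f (gen x * t))"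
  using lin_comp[OF _ lin_lmult, of f "gen x"] by (simp add: o_def)

lemma hecke_op_0: "hecke_op 0 (gen a * (gen b * t)) =
    (if a = b then scl vv (gen a * (gen b * t)) else if a < b then gen b * (gen a * t)
     else gen b * (gen a * t) + scl (vv - inverse vv) (gen a * (gen b * t)))"
proof (rule wd_eqI[where t = t])
  show "lin (\<lambda>t. hecke_op 0 (gen a * (gen b * t)))"
    by (intro lin_comp_gen[of "\<lambda>t. hecke_op 0 (gen a * t)"] lin_comp_gen lin_hecke_op)
  have *: "lin (\<lambda>t. gen a * (gen b * t))" for a b :: nat
    by (intro lin_gen_comp lin_lmult)
  show "lin (\<lambda>t. if a = b then scl vv (gen a * (gen b * t)) else if a < b then gen b * (gen a * t)
     else gen b * (gen a * t) + scl (vv - inverse vv) (gen a * (gen b * t)))"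
    by (cases "a = b"; cases "a < b"; simp; intro lin_addf lin_sclf *)
qed (simp add: gen_wd hecke_op_0_wd)

lemma hecke_op_Suc: "hecke_op (Suc k) (gen x * t) = gen x * hecke_op k t"
  by (rule wd_eqI[where t = t], intro lin_comp_gen lin_hecke_op, intro lin_gen_comp lin_hecke_op)
    (simp add: gen_wd hecke_op_Suc_wd)

lemma hecke_op_Suc_1: "hecke_op (Suc k) 1 = 0"
  by (subst wd_Nil[symmetric], subst wd_def) (simp add: hecke_op.simps)

lemma hecke_op_0_short: "hecke_op 0 1 = 0" "hecke_op 0 (gen x) = 0"
  by (subst wd_Nil[symmetric], subst wd_def, simp add: hecke_op.simps)
    (simp add: gen_def hecke_op.simps)

lemma tens_id_hecke: "Suc k < d \<Longrightarrow> tens_id n d (hecke_op k t) = hecke_op k (tens_id n d t)"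
proof (induction k arbitrary: d t)
  case 0
  show ?case
  proof (rule wd_eqI[where t = t])
    show "lin (\<lambda>t. tens_id n d (hecke_op 0 t))"
      by (rule lin_comp[OF lin_tens_id lin_hecke_op, unfolded o_def])
    show "lin (\<lambda>t. hecke_op 0 (tens_id n d t))"
      by (rule lin_comp[OF lin_hecke_op lin_tens_id, unfolded o_def])
    fix xs :: "nat list"
    have id: "tens_id n d (wd ys) = (if ys \<in> words n d then wd ys else 0)" for ys
      by (simp add: tens_id_single wd_def tens_words_def words_def)
    consider "xs = []" | x where "xs = [x]" | a b ys where "xs = a # b # ys"
      by (metis list.exhaust)
    then show "tens_id n d (hecke_op 0 (wd xs)) = hecke_op 0 (tens_id n d (wd xs))"
    proof cases
      case (3 a b ys)
      have "b # a # ys \<in> words n d \<longleftrightarrow> a # b # ys \<in> words n d" by (auto simp: words_def)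
      then show ?thesis
        by (simp add: 3 hecke_op_0_wd id lin_simps[OF lin_tens_id] lin_scl[OF lin_tens_id] hecke_lin scl_simps)
    qed (simp_all add: id hecke_op_0_short[folded wd_Nil] hecke_op_0_short[unfolded gen_def, folded wd_def] hecke_lin lin_simps[OF lin_tens_id])
  qed
next
  case (Suc k)
  then obtain e where d: "d = Suc e" by (cases d) auto
  with Suc have IH: "tens_id n e (hecke_op k t) = hecke_op k (tens_id n e t)" for t by simp
  show ?case
  proof (rule cons_eqI[where t = t])
    show "lin (\<lambda>t. tens_id n d (hecke_op (Suc k) t))"
      by (rule lin_comp[OF lin_tens_id lin_hecke_op, unfolded o_def])
    show "lin (\<lambda>t. hecke_op (Suc k) (tens_id n d t))"
      by (rule lin_comp[OF lin_hecke_op lin_tens_id, unfolded o_def])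
  qed (simp_all add: d IH hecke_op_Suc hecke_op_Suc_1 tens_id_cons tens_id_Suc_1 hecke_lin lin_simps[OF lin_tens_id])
qed

text \<open>The case of the first two tensor factors, where the commutation is a direct check over
  the generators and the order of the two letters.\<close>

lemma tens_op_hecke_0:
  "tens_op n (Suc (Suc e)) g (hecke_op 0 (gen a * (gen b * t))) = hecke_op 0 (tens_op n (Suc (Suc e)) g (gen a * (gen b * t)))"
proof (cases g)
  case (GE i)
  show ?thesis unfolding GE using vv_nonzero
    by (auto simp: op_rules op_lin hecke_op_0 hecke_lin scl_simps powi_mult kc_def distrib_left
        lookup_scl lookup_add field_simps intro!: poly_mapping_eqI)
next
  case (GF i)
  show ?thesis unfolding GF using vv_nonzero
    by (auto simp: op_rules op_lin hecke_op_0 hecke_lin scl_simps powi_mult kc_def distrib_left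
        lookup_scl lookup_add field_simps intro!: poly_mapping_eqI)
next
  case (GK i)
  show ?thesis unfolding GK
    by (auto simp: op_rules op_lin hecke_op_0 hecke_lin scl_simps powi_mult ac_simps)
next
  case (GKinv i)
  show ?thesis unfolding GKinv
    by (auto simp: op_rules op_lin hecke_op_0 hecke_lin scl_simps powi_mult ac_simps)
qed

text \<open>A Hecke operator at a later position acts inside the second factor of V \<otimes>
  V^(d-1), so the comultiplication reduces the claim to the first two positions.\<close>

lemma tens_op_hecke: "Suc k < d \<Longrightarrow> tens_op n d g (hecke_op k t) = hecke_op k (tens_op n d g t)"
proof (induction k arbitrary: d g t)
  case 0
  then obtain e where d: "d = Suc (Suc e)" by (metis less_imp_Suc_add add_0 add_Suc)
  show ?case
  proof (rule wd_eqI[where t = t])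
    show "lin (\<lambda>t. tens_op n d g (hecke_op 0 t))"
      by (rule lin_comp[OF lin_tens_op lin_hecke_op, unfolded o_def])
    show "lin (\<lambda>t. hecke_op 0 (tens_op n d g t))"
      by (rule lin_comp[OF lin_hecke_op lin_tens_op, unfolded o_def])
    fix xs :: "nat list"
    consider "xs = []" | x where "xs = [x]" | a b ys where "xs = a # b # ys"
      by (metis list.exhaust)
    then show "tens_op n d g (hecke_op 0 (wd xs)) = hecke_op 0 (tens_op n d g (wd xs))"
    proof cases
      case 2
      \<comment> \<open>Here d is at least 2, so a one-letter word lies outside the tensor space and
        is killed.\<close>
      have "tens_op n d g (tens_id n d (wd xs)) = 0"
        by (simp add: 2 d wd_def tens_id_single tens_words_def op_lin)
      then show ?thesis by (simp add: op_id 2 wd_def gen_def[symmetric] hecke_op_0_short hecke_lin op_lin)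
    qed (simp_all add: d wd_Nil op_1 op_lin hecke_lin hecke_op_0_short gen_wd[symmetric] tens_op_hecke_0)
  qed
next
  case (Suc k)
  then obtain e where d: "d = Suc e" by (cases d) auto
  with Suc have IH: "tens_op n e g (hecke_op k t) = hecke_op k (tens_op n e g t)" for g t by simp
  have id: "tens_id n e (hecke_op k t) = hecke_op k (tens_id n e t)" for t
    using Suc.prems d by (intro tens_id_hecke) simp
  show ?case
  proof (rule cons_eqI[where t = t])
    show "lin (\<lambda>t. tens_op n d g (hecke_op (Suc k) t))"
      by (rule lin_comp[OF lin_tens_op lin_hecke_op, unfolded o_def])
    show "lin (\<lambda>t. hecke_op (Suc k) (tens_op n d g t))"
      by (rule lin_comp[OF lin_hecke_op lin_tens_op, unfolded o_def])
    show "tens_op n d g (hecke_op (Suc k) 1) = hecke_op (Suc k) (tens_op n d g 1)"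
      by (simp add: hecke_op_Suc_1 d op_1 op_lin hecke_lin)
    fix x t
    show "tens_op n d g (hecke_op (Suc k) (gen x * t)) = hecke_op (Suc k) (tens_op n d g (gen x * t))"
      by (cases g) (auto simp: hecke_op_Suc d op_rules hecke_lin IH id)
  qed
qed

lemma free_act_hecke:
  assumes "Suc k < d"
  shows "free_act n d u (hecke_op k t) = hecke_op k (free_act n d u t)"
proof -
  have "word_op n d w (hecke_op k t) = hecke_op k (word_op n d w t)" for w
  proof (cases w)
    case (FWord xs)
    show ?thesis unfolding FWord
      by (induction xs) (simp_all add: word_op_Cons tens_op_hecke tens_id_hecke assms word_op_def)
  qed
  then show ?thesis by (simp add: free_act_def lin_sum[OF lin_hecke_op] hecke_lin)
qed

lemma hecke_op_swap:
  "a < b \<Longrightarrow> hecke_op (length ps) (wd (ps @ a # b # qs)) = wd (ps @ b # a # qs)"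
  by (induction ps) (simp_all add: hecke_op_0_wd hecke_op_Suc_wd gen_wd)

lemma free_act_tens_id: "free_act n d u (tens_id n d t) = free_act n d u t"
proof -
  have "word_op n d w (tens_id n d t) = word_op n d w t" for w
  proof (cases w)
    case (FWord xs)
    show ?thesis unfolding FWord
      by (induction xs) (simp_all add: word_op_Cons word_op_def tens_id_idem)
  qed
  then show ?thesis by (simp add: free_act_def)
qed

section \<open>Weight idempotents\<close>

lemma vv_powi_diff:
  assumes "k \<ge> 1"
  shows "vv powi int k - vv powi (- int k) \<noteq> 0"
proof
  assume "vv powi int k - vv powi (- int k) = 0"
  then have "vv ^ k = inverse (vv ^ k)" by (simp add: power_int_minus)
  then have "vv ^ k * vv ^ k = 1" using vv_nonzero by (metis power_not_zero right_inverse)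
  then have "vv ^ (k + k) = 1" by (simp add: power_add)
  moreover have "vv ^ m = of_laurent (Poly_Mapping.single (int m) 1)" for m
    by (induction m) (simp_all add: of_laurent_1 vv_def of_laurent_mult[symmetric] mult_single)
  ultimately have "(Poly_Mapping.single (int (k + k)) 1 :: laurent) = 1"
    using inj_of_laurent by (metis injD of_laurent_1)
  then have "Poly_Mapping.lookup (Poly_Mapping.single (int (k + k)) 1 :: laurent) 0 = 1" by simp
  then show False using assms by (simp add: lookup_single)
qed

lemma lin_sum_fun: "(\<And>w. lin (f w)) \<Longrightarrow> lin (\<lambda>t. \<Sum>w\<in>S. f w t)"
  by (induction S rule: infinite_finite_induct) (auto intro: lin_0f lin_addf)

lemma lin_free_act_right: "lin (free_act n d u)"
  unfolding free_act_def[abs_def]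
  by (intro lin_sum_fun lin_sclf[unfolded scl_def] lin_word_op)

lemma free_act_prod_wd:
  assumes "xs \<in> words n d"
    and "\<And>s. s \<in> set L \<Longrightarrow> f s \<in> uq_free n \<and> free_act n d (f s) (wd xs) = scl (g s) (wd xs)"
  shows "(\<Prod>s\<leftarrow>L. f s) \<in> uq_free n \<and> free_act n d (\<Prod>s\<leftarrow>L. f s) (wd xs) = scl (\<Prod>s\<leftarrow>L. g s) (wd xs)"
  using assms(2)
proof (induction L)
  case Nil
  then show ?case using assms(1) by (simp add: uq_free_1 free_act_1 tens_id_wd scl_simps)
next
  case (Cons s L)
  then show ?case
    by (simp add: uq_free_mult free_act_mult lin_scl[OF lin_free_act_right] scl_simps mult.commute)
qed

text \<open>The eigenvalue is the Gaussian binomial coefficient of \<open>wt xs i\<close> over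
  \<open>t\<close>.\<close>

lemma K_binom_wd:
  assumes "i \<in> {1..n}" "xs \<in> words n d"
  shows "K_binom i t \<in> uq_free n \<and> free_act n d (K_binom i t) (wd xs) =
    scl (\<Prod>s\<leftarrow>[1..<Suc t]. (vv powi (wt xs i + 1 - int s) - vv powi (int s - 1 - wt xs i)) / (vv powi int s - vv powi (- int s))) (wd xs)"
  unfolding K_binom_def
proof (rule free_act_prod_wd[OF assms(2)])
  fix s
  have k: "gen (GK i) \<in> uq_free n" "gen (GKinv i) \<in> uq_free n"
    using assms(1) by (auto intro!: uq_free_gen simp: uq_gens_def)
  have p: "vv powi (1 - int s) * vv powi wt xs i = vv powi (wt xs i + 1 - int s)"
    "vv powi (int s - 1) * vv powi (- wt xs i) = vv powi (int s - 1 - wt xs i)"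
    unfolding powi_mult by (rule arg_cong[of _ _ "power_int vv"], simp)+
  from k show "cst (1 / (vv powi int s - vv powi (- int s))) *
         (cst (vv powi (1 - int s)) * K i - cst (vv powi (int s - 1)) * Kinv i) \<in> uq_free n \<and>
         free_act n d (cst (1 / (vv powi int s - vv powi (- int s))) *
           (cst (vv powi (1 - int s)) * K i - cst (vv powi (int s - 1)) * Kinv i)) (wd xs) =
         scl ((vv powi (wt xs i + 1 - int s) - vv powi (int s - 1 - wt xs i)) / (vv powi int s - vv powi (- int s))) (wd xs)"
    using assms(2)
    by (simp add: uq_frees mult.assoc free_act_simps free_act_mult free_act_gen K_wd Kinv_wd)
      (rule poly_mapping_eqI, simp only: lookup_scl lookup_cst lookup_minus diff_divide_distrib left_diff_distrib
        right_diff_distrib times_divide_eq_left times_divide_eq_right mult_1,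
        simp only: mult.assoc[symmetric] p)
qed

lemma gauss_binom_0:
  assumes "k < t"
  shows "(\<Prod>s\<leftarrow>[1..<Suc t]. (vv powi (int k + 1 - int s) - vv powi (int s - 1 - int k)) / (vv powi int s - vv powi (- int s))) = 0"
  unfolding prod_list_zero_iff set_map
  \<comment> \<open>The numerator vanishes for s = k + 1, where both exponents are 0.\<close>
  by (rule image_eqI[of _ _ "Suc k"]) (use assms in \<open>auto simp del: upt_Suc\<close>)

text \<open>The numerators are the denominators in reverse order, by s -> t + 1 - s.\<close>

lemma gauss_binom_1:
  "(\<Prod>s\<leftarrow>[1..<Suc t]. (vv powi (int t + 1 - int s) - vv powi (int s - 1 - int t)) / (vv powi int s - vv powi (- int s))) = 1"
proof -
  let ?f = "\<lambda>s. vv powi int s - vv powi (- int s)"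
  have "(\<Prod>s\<leftarrow>[1..<Suc t]. (vv powi (int t + 1 - int s) - vv powi (int s - 1 - int t)) / ?f s)
      = (\<Prod>s\<in>{1..t}. (vv powi (int t + 1 - int s) - vv powi (int s - 1 - int t)) / ?f s)"
    by (subst prod.distinct_set_conv_list[symmetric])
      (simp_all add: atLeastLessThanSuc_atLeastAtMost del: upt_Suc)
  also have "\<dots> = (\<Prod>s\<in>{1..t}. ?f (t + 1 - s)) / (\<Prod>s\<in>{1..t}. ?f s)"
    by (subst prod_dividef, rule arg_cong2[of _ _ _ _ "(/)"], rule prod.cong) (auto simp: of_nat_diff algebra_simps)
  also have "(\<Prod>s\<in>{1..t}. ?f (t + 1 - s)) = (\<Prod>s\<in>{1..t}. ?f s)"
    by (rule prod.reindex_bij_witness[of _ "\<lambda>s. t + 1 - s" "\<lambda>s. t + 1 - s"]) auto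
  also have "(\<Prod>s\<in>{1..t}. ?f s) / (\<Prod>s\<in>{1..t}. ?f s) = 1"
    using vv_powi_diff by (simp del: power_int_of_nat)
  finally show ?thesis .
qed

text \<open>A binomial vanishes only if the letter occurs too rarely. Both weights sum to
  \<open>d\<close>, so if they differ then some letter does occur fewer than \<open>l i\<close>
  times.\<close>

lemma weight_idem_wd:
  assumes "l \<in> Lam n d" "xs \<in> words n d"
  shows "weight_idem n l \<in> uq_free n \<and>
    free_act n d (weight_idem n l) (wd xs) = (if wt xs = (\<lambda>k. int (l k)) then wd xs else 0)"
proof -
  define g where "g i = (\<Prod>s\<leftarrow>[1..<Suc (l i)].
    (vv powi (wt xs i + 1 - int s) - vv powi (int s - 1 - wt xs i)) / (vv powi int s - vv powi (- int s)))" for i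
  have *: "weight_idem n l \<in> uq_free n \<and> free_act n d (weight_idem n l) (wd xs) = scl (\<Prod>i\<leftarrow>[1..<Suc n]. g i) (wd xs)"
    unfolding weight_idem_def
    by (rule free_act_prod_wd[OF assms(2)], unfold g_def, rule K_binom_wd[OF _ assms(2)]) auto
  show ?thesis
  proof (cases "wt xs = (\<lambda>k. int (l k))")
    case True
    then have "g i = 1" for i by (simp only: g_def gauss_binom_1)
    then have "(\<Prod>i\<leftarrow>L. g i) = 1" for L by (induction L) simp_all
    with * True show ?thesis by (simp add: scl_simps)
  next
    case False
    have "\<exists>i\<in>{1..n}. count_list xs i < l i"
    proof (rule ccontr)
      assume "\<not> ?thesis"
      then have le: "l i \<le> count_list xs i" if "i \<in> {1..n}" for i using that by force
      have "(\<Sum>i\<in>{1..n}. count_list xs i) = d"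
        using assms(2) by (subst sum_count_set) (auto simp: words_def)
      then have "(\<Sum>i\<in>{1..n}. count_list xs i) = (\<Sum>i\<in>{1..n}. l i)"
        using assms(1) by (simp add: Lam_def)
      then have "count_list xs i = l i" if "i \<in> {1..n}" for i
        using sum_mono_inv[of l "{1..n}" "count_list xs" i] le that by auto
      moreover have "count_list xs i = l i" if "i \<notin> {1..n}" for i
        using that assms by (auto simp: Lam_def words_def intro!: count_notin)
      ultimately show False using False by (auto simp: wt_def fun_eq_iff)
    qed
    then obtain i where i: "i \<in> {1..n}" "count_list xs i < l i" by blast
    then have "g i = 0" unfolding g_def wt_def by (intro gauss_binom_0)
    then have "(\<Prod>i\<leftarrow>[1..<Suc n]. g i) = 0"
      unfolding prod_list_zero_iff set_map by (intro image_eqI[of _ _ i]) (use i(1) in \<open>auto simp del: upt_Suc\<close>)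
    with * False show ?thesis by (simp add: scl_0)
  qed
qed

section \<open>Triangularity\<close>

text \<open>Letters are weighted d, d - 1, ..., 1 from left to right. This one statistic drives both
  the triangularity of the E products and the sorting by Hecke operators.\<close>

fun stat :: "nat list \<Rightarrow> nat" where
  "stat [] = 0"
| "stat (x # xs) = Suc (length xs) * x + stat xs"

lemma stat_replace: "i \<le> y \<Longrightarrow> stat (ps @ i # qs) + (y - i) * Suc (length qs) = stat (ps @ y # qs)"
proof -
  assume "i \<le> y"
  then obtain k where "y = i + k" using le_Suc_ex by blast
  then show ?thesis by (induction ps) (simp_all add: algebra_simps)
qed

lemma K_asp:
  assumes "S \<subseteq> words n d" "t \<in> asp S"
  shows "tens_op n d (GK i) t \<in> asp S" "tens_op n d (GKinv i) t \<in> asp S"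
  using assms
  by (auto intro!: lin_asp[OF lin_tens_op Asub_asp _ assms(2)] Asub_scl[OF Asub_asp] asp_wd lau_units_lau[OF lau_units_powi]
      simp: K_wd Kinv_wd subset_iff)

text \<open>\<open>m\<close> is a guaranteed drop of the statistic. The last clause says that
  letters change only into letters smaller than \<open>l\<close>, so no letter from \<open>l\<close>
  upwards is ever created.\<close>

definition below :: "nat \<Rightarrow> nat \<Rightarrow> nat \<Rightarrow> nat list \<Rightarrow> nat \<Rightarrow> nat list set" where
  "below n d l xs m = {zs \<in> words n d. stat zs + m \<le> stat xs \<and> (\<forall>p<d. zs ! p = xs ! p \<or> zs ! p < l)}"

lemma below_mono: "m \<le> m' \<Longrightarrow> below n d l xs m' \<subseteq> below n d l xs m"
  by (auto simp: below_def)

lemma below_Cons: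
  assumes "zs \<in> below n e l xs m" "length xs = e" "i \<in> {1..n}" "i = x \<or> i < l" "Suc e * i + k \<le> Suc e * x + m"
  shows "i # zs \<in> below n (Suc e) l (x # xs) k"
  using assms by (auto simp: below_def words_def nth_Cons split: nat.splits)

text \<open>
  Among the terms, the one lowering the last possible \<open>l\<close>, at the position of \<open>y\<close>, has the largest
  \<^const>\<open>stat\<close>, as earlier positions weigh more.
\<close>

lemma XE_leading:
  assumes "1 \<le> i" "i < l" "l \<le> n" "ps @ y # qs \<in> words n d" "l \<notin> set qs"
  shows "\<exists>c\<in>lau_units. XE n d i l (wd (ps @ y # qs)) - (if y = l then scl c (wd (ps @ i # qs)) else 0)
    \<in> asp (below n d l (ps @ y # qs) (Suc ((l - i) * Suc (length qs))))"
  using assms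
proof (induction ps arbitrary: i d)
  case Nil
  then obtain e where e: "d = Suc e" "qs \<in> words n e" "y \<in> {1..n}"
    by (auto simp: words_Suc words_def)
  \<comment> \<open>As \<open>l\<close> is absent from \<open>qs\<close>, only the term acting on
    the first letter survives.\<close>
  have 0: "XE n e j l (wd qs) = 0" if "1 \<le> j" "j < l" for j
    using that Nil e by (intro XE_absent) auto
  let ?c = "inverse vv ^ (l - Suc i) * (vv powi (- wt qs l) * vv powi wt qs i)"
  have "XE n d i l (wd (y # qs)) = (if y = l then scl ?c (wd (i # qs)) else 0)"
    using Nil e by (simp add: e(1) XE_cons 0 op_lin Kinv_wd K_wd scl_simps flip: gen_wd)
  moreover have "?c \<in> lau_units"
    by (intro lau_units_mult lau_units_power lau_units_inverse lau_units_vv lau_units_powi)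
  ultimately show ?case
    by (intro bexI[of _ ?c]) (auto simp: Asub_0[OF Asub_asp])
next
  case (Cons x ps)
  let ?rest = "ps @ y # qs" and ?b = "Suc (length qs)"
  obtain e where e: "d = Suc e" "?rest \<in> words n e" "x \<in> {1..n}"
    using Cons.prems(4) by (cases d) auto
  then have len: "length ?rest = e" and b: "?b \<le> e" by (auto simp: words_def)
  let ?M = "asp (below n d l (x # ?rest) (Suc ((l - i) * ?b)))"
  obtain c where c: "c \<in> lau_units"
    "XE n e i l (wd ?rest) - (if y = l then scl c (wd (ps @ i # qs)) else 0) \<in> asp (below n e l ?rest (Suc ((l - i) * ?b)))"
    using Cons.IH[of i e] Cons.prems e by auto
  have 1: "scl a (gen i * tens_op n e (GK i) (tens_op n e (GKinv l) (wd ?rest))) \<in> ?M" if "x = l" "a \<in> lau" for a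
  proof -
    have "(l - i) * ?b < (l - i) * Suc e" using b Cons.prems by (intro mult_strict_left_mono) auto
    then have "Suc e * i + Suc ((l - i) * ?b) \<le> Suc e * l + 0"
      using Cons.prems by (simp add: diff_mult_distrib) (simp add: algebra_simps)
    moreover have "?rest \<in> below n e l ?rest 0" using e by (simp add: below_def)
    ultimately have "i # ?rest \<in> below n d l (x # ?rest) (Suc ((l - i) * ?b))"
      unfolding e(1) by (intro below_Cons[where m = 0]) (use len Cons.prems that in auto)
    moreover have "tens_op n e (GK i) (tens_op n e (GKinv l) (wd ?rest)) \<in> asp {?rest}"
      using e by (intro K_asp asp_wd) auto
    ultimately show ?thesis
      using that by (intro Asub_scl Asub_asp asp_cons) auto
  qed
  have 2: "gen x * XE n e i l (wd ?rest) - (if y = l then scl c (wd (x # ps @ i # qs)) else 0) \<in> ?M"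
  proof -
    have "gen x * (XE n e i l (wd ?rest) - (if y = l then scl c (wd (ps @ i # qs)) else 0)) \<in> ?M"
      unfolding e(1) by (rule asp_cons[OF c(2)]) (rule below_Cons, use len e in auto)
    then show ?thesis by (auto simp: right_diff_distrib scl_simps gen_wd)
  qed
  \<comment> \<open>The front letter loses x - i with the larger weight \<open>Suc e\<close>, and
    the rest loses at least (l - x) * b, where b is the weight of the position of \<open>y\<close>.
    Together this exceeds (l - i) * b.\<close>
  have 3: "scl a (gen i * tens_op n e (GK i) (tens_op n e (GKinv x) (XE n e x l (wd ?rest)))) \<in> ?M"
    if "i < x" "x < l" "a \<in> lau" for a
  proof -
    note xl = that(2)
    obtain c where c: "c \<in> lau_units"
      "XE n e x l (wd ?rest) - (if y = l then scl c (wd (ps @ x # qs)) else 0) \<in> asp (below n e l ?rest (Suc ((l - x) * ?b)))"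
      using Cons.IH[OF _ xl Cons.prems(3) e(2) Cons.prems(5)] e(3) by (meson atLeastAtMost_iff)
    have "(if y = l then scl c (wd (ps @ x # qs)) else 0) \<in> asp (below n e l ?rest ((l - x) * ?b))"
    proof (cases "y = l")
      case True
      have "ps @ x # qs \<in> below n e l ?rest ((l - x) * ?b)"
        using stat_replace[of x l ps qs] that e True by (auto simp: below_def words_def nth_append nth_Cons split: nat.splits)
      with True c(1) show ?thesis by (auto intro: Asub_scl Asub_asp asp_wd lau_units_lau)
    qed (auto simp: Asub_0[OF Asub_asp])
    moreover have "XE n e x l (wd ?rest) - (if y = l then scl c (wd (ps @ x # qs)) else 0) \<in> asp (below n e l ?rest ((l - x) * ?b))"
      by (rule subsetD[OF asp_mono[OF below_mono[OF le_SucI[OF order_refl]]] c(2)])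
    ultimately have "XE n e x l (wd ?rest) \<in> asp (below n e l ?rest ((l - x) * ?b))"
      using Asub_add[OF Asub_asp] by fastforce
    then have "tens_op n e (GK i) (tens_op n e (GKinv x) (XE n e x l (wd ?rest))) \<in> asp (below n e l ?rest ((l - x) * ?b))"
      by (intro K_asp) (auto simp: below_def)
    moreover have "(x - i) * ?b < (x - i) * Suc e" using b that by (intro mult_strict_left_mono) auto
    then have "Suc e * i + Suc ((l - i) * ?b) \<le> Suc e * x + (l - x) * ?b"
    proof -
      have "(l - i) * ?b = (l - x) * ?b + (x - i) * ?b" using that by (simp flip: add_mult_distrib)
      moreover have "Suc e * x = Suc e * i + (x - i) * Suc e"
        using that by (metis add_mult_distrib2 le_add_diff_inverse less_imp_le mult.commute)
      ultimately show ?thesis using \<open>(x - i) * ?b < (x - i) * Suc e\<close> by linarith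
    qed
    ultimately show ?thesis
      unfolding e(1) using len Cons.prems that
      by (intro Asub_scl Asub_asp asp_cons below_Cons) auto
  qed
  have "XE n d i l (wd ((x # ps) @ y # qs)) - (if y = l then scl c (wd ((x # ps) @ i # qs)) else 0) =
    (if x = l then scl (inverse vv ^ (l - Suc i)) (gen i * tens_op n e (GK i) (tens_op n e (GKinv l) (wd ?rest))) else 0)
    + (gen x * XE n e i l (wd ?rest) - (if y = l then scl c (wd (x # ps @ i # qs)) else 0))
    + (if i < x \<and> x < l then scl ((inverse vv - vv) * inverse vv ^ (x - Suc i))
        (gen i * tens_op n e (GK i) (tens_op n e (GKinv x) (XE n e x l (wd ?rest)))) else 0)"
    using Cons.prems e(3) by (simp add: e(1) gen_wd[symmetric, of x] XE_cons)
  also have "\<dots> \<in> ?M"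
  proof -
    have "inverse vv ^ k \<in> lau" "(inverse vv - vv) * inverse vv ^ k \<in> lau" for k
      by (intro lau_intros)+
    with 1 2 3 show ?thesis by (intro Asub_add[OF Asub_asp]) (simp_all add: Asub_0[OF Asub_asp])
  qed
  finally show ?case using c(1) by auto
qed

lemma XE_below:
  assumes "1 \<le> i" "i < l" "l \<le> n" "ps @ y # qs \<in> words n d" "l \<notin> set qs"
  shows "XE n d i l (wd (ps @ y # qs)) \<in> asp (below n d l (ps @ y # qs) ((l - i) * Suc (length qs)))"
proof -
  obtain c where c: "c \<in> lau_units"
    "XE n d i l (wd (ps @ y # qs)) - (if y = l then scl c (wd (ps @ i # qs)) else 0)
    \<in> asp (below n d l (ps @ y # qs) (Suc ((l - i) * Suc (length qs))))"
    using XE_leading[OF assms] by blast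
  have "(if y = l then scl c (wd (ps @ i # qs)) else 0) \<in> asp (below n d l (ps @ y # qs) ((l - i) * Suc (length qs)))"
  proof (cases "y = l")
    case True
    have "ps @ i # qs \<in> below n d l (ps @ y # qs) ((l - i) * Suc (length qs))"
      using stat_replace[of i l ps qs] assms True by (auto simp: below_def words_def nth_append nth_Cons split: nat.splits)
    with True c(1) show ?thesis by (auto intro: Asub_scl Asub_asp asp_wd lau_units_lau)
  qed (auto simp: Asub_0[OF Asub_asp])
  moreover have "XE n d i l (wd (ps @ y # qs)) - (if y = l then scl c (wd (ps @ i # qs)) else 0)
    \<in> asp (below n d l (ps @ y # qs) ((l - i) * Suc (length qs)))"
    by (rule subsetD[OF asp_mono[OF below_mono[OF le_SucI[OF order_refl]]] c(2)])
  ultimately show ?thesis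
    using Asub_add[OF Asub_asp] by fastforce
qed

text \<open>Letters smaller than \<open>i\<close> are passed without a factor, and behind the single
  \<open>i\<close> nothing is left to act on, by \<open>XF_absent\<close>.\<close>

lemma XF_leading:
  assumes "1 \<le> i" "i < l" "l \<le> n" "ps @ i # qs \<in> words n d" "i \<notin> set qs" "set ps \<subseteq> {..<i}"
  shows "XF n d i l (wd (ps @ i # qs)) = scl ((- 1) ^ (l - Suc i)) (wd (ps @ l # qs))"
  using assms(4,6)
proof (induction ps arbitrary: d)
  case Nil
  then obtain e where e: "d = Suc e" "qs \<in> words n e"
    by (auto simp: words_Suc words_def)
  with assms show ?case by (simp add: gen_wd[symmetric] XF_cons XF_absent tens_id_wd scl_simps)
next
  case (Cons x ps)
  then obtain e where e: "d = Suc e" "ps @ i # qs \<in> words n e" "x \<in> {1..n}"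
    by (cases d) auto
  with Cons assms show ?case
    by (simp add: e(1) gen_wd[symmetric, of x] XF_cons scl_simps)
qed

text \<open>\<open>foldr\<close> applies the last entry first. Hence this increasing list applies
  the largest start first, and the reversed list in \<open>deficient\<close> applies the smallest
  end first.\<close>

definition exceed :: "(nat \<Rightarrow> nat) \<Rightarrow> nat \<Rightarrow> nat \<Rightarrow> (nat \<times> nat) list" where
  "exceed s m d = map (\<lambda>k. (k, s k)) (filter (\<lambda>k. k < s k) [m..<Suc d])"

definition deficient :: "(nat \<Rightarrow> nat) \<Rightarrow> nat \<Rightarrow> (nat \<times> nat) list" where
  "deficient s m = map (\<lambda>k. (s k, k)) (filter (\<lambda>k. s k < k) (rev [1..<m]))"

text \<open>When \<open>m\<close> is processed, the positions before it carry 1, ..., m - 1 and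
  those after it carry letters larger than \<open>m\<close>, so \<open>XF_leading\<close> applies at
  position \<open>m\<close>.\<close>

lemma F_stage:
  assumes s: "s permutes {1..d}" and "d \<le> n" "1 \<le> m" "m \<le> Suc d"
  shows "\<exists>c\<in>lau_units. foldr (\<lambda>(i, l). XF n d i l) (exceed s m d) (wd [1..<Suc d])
    = scl c (wd (map (\<lambda>p. if m \<le> p \<and> p < s p then s p else p) [1..<Suc d]))"
  using assms(4,3)
proof (induction m rule: inc_induct)
  case base
  have "map (\<lambda>p. if Suc d \<le> p \<and> p < s p then s p else p) [1..<Suc d] = [1..<Suc d]"
    by (rule map_idI) (auto simp del: upt_Suc)
  then show ?case
    by (intro bexI[of _ 1]) (simp_all del: upt_Suc add: exceed_def scl_simps lau_units_1)
next
  case (step m)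
  let ?f = "\<lambda>m p. if m \<le> p \<and> p < s p then s p else p"
  obtain c where c: "c \<in> lau_units"
    "foldr (\<lambda>(i, l). XF n d i l) (exceed s (Suc m) d) (wd [1..<Suc d]) = scl c (wd (map (?f (Suc m)) [1..<Suc d]))"
    using step by auto
  have up: "[m..<Suc d] = m # [Suc m..<Suc d]" using step by (simp add: upt_conv_Cons)
  have split: "[1..<Suc d] = [1..<m] @ m # [Suc m..<Suc d]"
    using step upt_add_eq_append[of 1 m "Suc d - m"] up by (simp del: upt_Suc)
  have sd: "s p \<in> {1..d}" if "p \<in> {1..d}" for p using permutes_in_image[OF s] that by blast
  show ?case
  proof (cases "m < s m")
    case True
    let ?qs = "map (?f (Suc m)) [Suc m..<Suc d]"
    have a: "map (?f (Suc m)) [1..<Suc d] = [1..<m] @ m # ?qs"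
      unfolding split by (auto intro!: map_idI simp del: upt_Suc)
    have b: "map (?f m) [1..<Suc d] = [1..<m] @ s m # ?qs"
      unfolding split using True by (auto intro!: map_idI simp del: upt_Suc)
    have "?f (Suc m) p \<in> {1..n}" if "p \<in> {1..d}" for p
      using sd[OF that] that assms(2) by auto
    then have "set (map (?f (Suc m)) [1..<Suc d]) \<subseteq> {1..n}"
      unfolding set_map set_upt atLeastLessThanSuc_atLeastAtMost by (rule image_subsetI)
    then have "[1..<m] @ m # ?qs \<in> words n d" unfolding a[symmetric] by (simp add: words_def del: upt_Suc)
    then have XF: "XF n d m (s m) (wd ([1..<m] @ m # ?qs)) = scl ((- 1) ^ (s m - Suc m)) (wd ([1..<m] @ s m # ?qs))"
      using True step assms(2) sd[of m] by (intro XF_leading) (auto simp del: upt_Suc)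
    have "foldr (\<lambda>(i, l). XF n d i l) (exceed s m d) (wd [1..<Suc d])
        = XF n d m (s m) (foldr (\<lambda>(i, l). XF n d i l) (exceed s (Suc m) d) (wd [1..<Suc d]))"
      using True by (simp add: exceed_def up del: upt_Suc)
    also have "\<dots> = scl (c * (- 1) ^ (s m - Suc m)) (wd (map (?f m) [1..<Suc d]))"
      by (simp only: c(2) a b XF lin_scl[OF lin_XF] scl_simps(1))
    finally show ?thesis
      using c(1) by (blast intro: lau_units_mult lau_units_power lau_units_uminus lau_units_1)
  next
    case False
    then have "map (?f (Suc m)) [1..<Suc d] = map (?f m) [1..<Suc d]"
      by (auto simp: Suc_le_eq le_less)
    moreover have "exceed s m d = exceed s (Suc m) d"
      using False by (simp add: exceed_def up del: upt_Suc)
    ultimately show ?thesis by (intro bexI[OF _ c(1)]) (simp only: c(2))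
  qed
qed

text \<open>The word \<open>g m\<close> has received its final letters before position
  \<open>m\<close>. With \<open>p\<close> counted from 0, the last clause says that a letter
  \<open>k\<close> with \<open>k \<ge> m\<close> never stands to the right of position
  \<open>k\<close>. This is what allows the next root vector, ending at \<open>m\<close>, to be
  compared at position \<open>m\<close> in every error word.\<close>

lemma E_stage:
  assumes s: "s permutes {1..d}" and "d \<le> n" "1 \<le> m" "m \<le> Suc d"
  defines "g \<equiv> \<lambda>m. map (\<lambda>p. if p < m \<or> p \<le> s p then s p else p) [1..<Suc d]"
  shows "\<exists>c\<in>lau_units. foldr (\<lambda>(i, l). XE n d i l) (deficient s m) (wd (g 1)) - scl c (wd (g m))
    \<in> asp {zs \<in> words n d. stat zs < stat (g m) \<and> (\<forall>k p. m \<le> k \<longrightarrow> k \<le> p \<longrightarrow> p < d \<longrightarrow> zs ! p \<noteq> k)}"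
  using assms(3,4)
proof (induction m rule: dec_induct)
  case base
  then show ?case
    by (intro bexI[of _ 1]) (simp_all add: deficient_def scl_simps lau_units_1 Asub_0[OF Asub_asp])
next
  case (step m)
  let ?S = "\<lambda>m. {zs \<in> words n d. stat zs < stat (g m) \<and> (\<forall>k p. m \<le> k \<longrightarrow> k \<le> p \<longrightarrow> p < d \<longrightarrow> zs ! p \<noteq> k)}"
  let ?t = "foldr (\<lambda>(i, l). XE n d i l) (deficient s m) (wd (g 1))"
  obtain c where c: "c \<in> lau_units" "?t - scl c (wd (g m)) \<in> asp (?S m)"
    using step by auto
  have sd: "s p \<in> {1..d}" if "p \<in> {1..d}" for p using permutes_in_image[OF s] that by blast
  have g_words: "g k \<in> words n d" for k
    using sd assms(2) unfolding g_def words_def by (force simp del: upt_Suc)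
  have g_nth: "g k ! p = (if Suc p < k \<or> Suc p \<le> s (Suc p) then s (Suc p) else Suc p)" if "p < d" for k p
    using that by (simp add: g_def del: upt_Suc)
  show ?case
  proof (cases "s m < m")
    case True
    let ?b = "Suc (d - m)"
    let ?ps = "take (m - 1) (g m)" and ?qs = "drop m (g m)"
    have len: "length (g k) = d" for k by (simp add: g_def)
    have split: "zs = take (m - 1) zs @ zs ! (m - 1) # drop m zs" if "length zs = d" for zs :: "nat list"
      using that step id_take_nth_drop[of "m - 1" zs] by simp
    have gm: "g m = ?ps @ m # ?qs"
      using split[OF len, of m] g_nth[of "m - 1" m] True step by simp
    have gSm: "g (Suc m) = ?ps @ s m # ?qs"
    proof (rule nth_equalityI)
      fix p assume "p < length (g (Suc m))"
      then have p: "p < d" by (simp add: len)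
      consider "p < m - 1" | "p = m - 1" | "m \<le> p" by linarith
      then show "g (Suc m) ! p = (?ps @ s m # ?qs) ! p"
        using p step by cases (auto simp: len g_nth nth_append nth_Cons' min_def)
    qed (use step in \<open>simp add: len\<close>)
    have st: "stat (g (Suc m)) + (m - s m) * ?b = stat (g m)"
    proof -
      have "stat (?ps @ s m # ?qs) + (m - s m) * Suc (length ?qs) = stat (?ps @ m # ?qs)"
        by (rule stat_replace) (use True in simp)
      then show ?thesis by (simp only: gSm[symmetric] gm[symmetric] length_drop len)
    qed
    have sm: "1 \<le> s m" "m \<le> n" using sd[of m] step assms(2) by auto
    \<comment> \<open>The next root vector only creates letters below \<open>m\<close>, so the
      clause on letters from m + 1 upwards survives.\<close>
    have low: "below n d m zs k \<subseteq> ?S (Suc m)"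
      if "\<And>j p. Suc m \<le> j \<Longrightarrow> j \<le> p \<Longrightarrow> p < d \<Longrightarrow> zs ! p \<noteq> j" "stat zs < stat (g (Suc m)) + k" for zs k
      using that unfolding below_def by fastforce
    \<comment> \<open>An error word drops by at least the amount separating \<open>g m\<close> from
      \<open>g (Suc m)\<close>, so it stays smaller than the leading word.\<close>
    have "XE n d (s m) m (wd zs) \<in> asp (?S (Suc m))" if zs: "zs \<in> ?S m" for zs
    proof -
      have "length zs = d" using zs by (simp add: words_def)
      note sp = split[OF this]
      have "m \<notin> set (drop m zs)"
        using zs \<open>length zs = d\<close> by (auto simp: in_set_conv_nth)
      then have "XE n d (s m) m (wd zs) \<in> asp (below n d m zs ((m - s m) * ?b))"
        using XE_below[of "s m" m n "take (m - 1) zs" "zs ! (m - 1)" "drop m zs" d] True zs sm sp \<open>length zs = d\<close> by simp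
      moreover have "below n d m zs ((m - s m) * ?b) \<subseteq> ?S (Suc m)"
        using zs st by (intro low) auto
      ultimately show ?thesis using asp_mono by blast
    qed
    then have 1: "XE n d (s m) m (?t - scl c (wd (g m))) \<in> asp (?S (Suc m))"
      by (rule lin_asp[OF lin_XE Asub_asp _ c(2)])
    have notin: "m \<notin> set ?qs"
      by (auto simp: in_set_conv_nth len g_nth)
    obtain c' where c': "c' \<in> lau_units"
      "XE n d (s m) m (wd (g m)) - scl c' (wd (g (Suc m))) \<in> asp (below n d m (g m) (Suc ((m - s m) * ?b)))"
    proof -
      have "\<exists>c\<in>lau_units. XE n d (s m) m (wd (?ps @ m # ?qs)) - (if m = m then scl c (wd (?ps @ s m # ?qs)) else 0)
        \<in> asp (below n d m (?ps @ m # ?qs) (Suc ((m - s m) * Suc (length ?qs))))"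
        using True sm notin g_words[of m] by (intro XE_leading) (simp_all only: gm[symmetric] not_False_eq_True)
      then show ?thesis
        unfolding gSm[symmetric] gm[symmetric] length_drop len using that by auto
    qed
    have sub: "below n d m (g m) (Suc ((m - s m) * ?b)) \<subseteq> ?S (Suc m)"
      using st by (intro low) (auto simp: g_nth)
    have 2: "scl c (XE n d (s m) m (wd (g m)) - scl c' (wd (g (Suc m)))) \<in> asp (?S (Suc m))"
      by (rule Asub_scl[OF Asub_asp lau_units_lau[OF c(1)] subsetD[OF asp_mono[OF sub] c'(2)]])
    have "XE n d (s m) m ?t - scl (c * c') (wd (g (Suc m)))
      = XE n d (s m) m (?t - scl c (wd (g m))) + scl c (XE n d (s m) m (wd (g m)) - scl c' (wd (g (Suc m))))"
      by (simp add: XE_lin scl_simps)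
    also have "\<dots> \<in> asp (?S (Suc m))" by (rule Asub_add[OF Asub_asp 1 2])
    finally show ?thesis
      using True c(1) c'(1) step lau_units_mult by (intro bexI[of _ "c * c'"]) (simp_all add: deficient_def)
  next
    case False
    then have "g (Suc m) = g m" by (auto simp: g_def less_Suc_eq)
    moreover have "asp (?S m) \<subseteq> asp {zs \<in> words n d. stat zs < stat (g m) \<and> (\<forall>k p. Suc m \<le> k \<longrightarrow> k \<le> p \<longrightarrow> p < d \<longrightarrow> zs ! p \<noteq> k)}"
      by (rule asp_mono) (use Suc_leD in blast)
    ultimately show ?thesis
      using False c step by (auto simp: deficient_def)
  qed
qed

section \<open>The index set\<close>

text \<open>The index conditions rewritten for the supports of A and C. The disjointness clauses
  come from the content condition, and the equal sums express that both weight equations have the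
  same \<lambda>.\<close>

definition matched :: "nat \<Rightarrow> (nat \<times> nat) set \<Rightarrow> (nat \<times> nat) set \<Rightarrow> bool" where
  "matched d S T \<longleftrightarrow> S \<subseteq> pos_roots d \<and> T \<subseteq> pos_roots d \<and> inj_on fst S \<and> inj_on snd S \<and>
     inj_on fst T \<and> inj_on snd T \<and> fst ` S \<inter> snd ` T = {} \<and> snd ` S \<inter> fst ` T = {} \<and>
     (\<forall>k. (\<Sum>\<alpha>\<in>S. root \<alpha> k) = (\<Sum>\<alpha>\<in>T. root \<alpha> k))"

text \<open>For matched pairs \<open>nat\<close> does not truncate: a start of \<open>S\<close> is
  not an end of \<open>T\<close>, and being at most \<open>d\<close> it has \<omega>-weight
  1.\<close>

definition index_of :: "nat \<Rightarrow> (nat \<times> nat) set \<Rightarrow> (nat \<times> nat) set \<Rightarrow>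
    (nat \<times> nat \<Rightarrow> nat) \<times> (nat \<Rightarrow> nat) \<times> (nat \<times> nat \<Rightarrow> nat)" where
  "index_of d S T = (\<lambda>\<alpha>. of_bool (\<alpha> \<in> S), \<lambda>k. nat (int (omega d k) - (\<Sum>\<alpha>\<in>S. root \<alpha> k)), \<lambda>\<alpha>. of_bool (\<alpha> \<in> T))"

definition hecke_index ::
  "nat \<Rightarrow> nat \<Rightarrow> ((nat \<times> nat \<Rightarrow> nat) \<times> (nat \<Rightarrow> nat) \<times> (nat \<times> nat \<Rightarrow> nat)) set" where
  "hecke_index n d = {(A, l, C) \<in> Y_plus_index n d.
     add_roots n l A = (\<lambda>k. int (omega d k)) \<and> (\<lambda>k. int (omega d k)) = add_roots n l C}"

text \<open>For \<open>g = fst\<close> or \<open>g = snd\<close>, the number of roots of A, with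
  multiplicity, that start or end at \<open>k\<close>. A sum of roots is then starts minus ends, and
  the content counts ends.\<close>

definition hits :: "nat \<Rightarrow> (nat \<times> nat \<Rightarrow> nat) \<Rightarrow> (nat \<times> nat \<Rightarrow> nat) \<Rightarrow> nat \<Rightarrow> nat" where
  "hits n g A k = (\<Sum>\<alpha>\<in>pos_roots n. A \<alpha> * of_bool (g \<alpha> = k))"

lemma finite_pos_roots: "finite (pos_roots n)"
  by (rule finite_subset[of _ "{1..n} \<times> {1..n}"]) (auto simp: pos_roots_def)

lemma pos_roots_mono: "d \<le> n \<Longrightarrow> pos_roots d \<subseteq> pos_roots n"
  by (auto simp: pos_roots_def)

lemma root_eq: "root \<alpha> k = of_bool (fst \<alpha> = k) - of_bool (snd \<alpha> = k)"
  by (auto simp: root_def eps_def split: prod.split)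

lemma sum_root_hits: "(\<Sum>\<alpha>\<in>pos_roots n. int (A \<alpha>) * root \<alpha> k) = int (hits n fst A k) - int (hits n snd A k)"
  by (simp add: hits_def root_eq right_diff_distrib sum_subtractf)

lemma content_hits: "content n A C k = hits n snd A k + hits n snd C k"
  by (simp add: content_def hits_def distrib_right sum.distrib)

lemma hits_ge: "\<alpha> \<in> pos_roots n \<Longrightarrow> A \<alpha> \<le> hits n g A (g \<alpha>)"
  unfolding hits_def
  using member_le_sum[of \<alpha> "pos_roots n" "\<lambda>\<beta>. A \<beta> * of_bool (g \<beta> = g \<alpha>)"] finite_pos_roots by simp

lemma hits_inj:
  assumes "\<And>k. hits n g A k \<le> 1" "S = {\<alpha> \<in> pos_roots n. A \<alpha> \<noteq> 0}"
  shows "inj_on g S"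
proof (rule inj_onI, rule ccontr)
  fix \<alpha> \<beta> assume *: "\<alpha> \<in> S" "\<beta> \<in> S" "g \<alpha> = g \<beta>" "\<alpha> \<noteq> \<beta>"
  have "(\<Sum>\<gamma>\<in>{\<alpha>, \<beta>}. A \<gamma> * of_bool (g \<gamma> = g \<alpha>)) \<le> hits n g A (g \<alpha>)"
    unfolding hits_def by (rule sum_mono2) (use * assms(2) finite_pos_roots in auto)
  with * assms(1)[of "g \<alpha>"] assms(2) show False by auto
qed

lemma hits_indicator:
  assumes "S \<subseteq> pos_roots n" "inj_on g S"
  shows "hits n g (\<lambda>\<alpha>. of_bool (\<alpha> \<in> S)) k = of_bool (k \<in> g ` S)"
proof -
  have "hits n g (\<lambda>\<alpha>. of_bool (\<alpha> \<in> S)) k = (\<Sum>\<alpha>\<in>S. of_bool (g \<alpha> = k))"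
    unfolding hits_def by (rule sum.mono_neutral_cong_right) (use assms finite_pos_roots in auto)
  also have "\<dots> = (\<Sum>j\<in>g ` S. of_bool (j = k))"
    by (simp add: sum.reindex[OF assms(2)])
  also have "\<dots> = of_bool (k \<in> g ` S)"
    using finite_subset[OF assms(1) finite_pos_roots] by (simp add: of_bool_def)
  finally show ?thesis .
qed

lemma sum_root_indicator:
  assumes "S \<subseteq> pos_roots n"
  shows "(\<Sum>\<alpha>\<in>pos_roots n. int (of_bool (\<alpha> \<in> S)) * root \<alpha> k) = (\<Sum>\<alpha>\<in>S. root \<alpha> k)"
  by (rule sum.mono_neutral_cong_right) (use assms finite_pos_roots in auto)

lemma sum_root_matching:
  assumes "S \<subseteq> pos_roots n" "inj_on fst S" "inj_on snd S"
  shows "(\<Sum>\<alpha>\<in>S. root \<alpha> k) = of_bool (k \<in> fst ` S) - of_bool (k \<in> snd ` S)"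
  unfolding sum_root_indicator[OF assms(1), symmetric] sum_root_hits
    hits_indicator[OF assms(1,2)] hits_indicator[OF assms(1,3)] by simp

lemma hecke_index_matched:
  assumes "(A, l, C) \<in> hecke_index n d"
  shows "\<exists>S T. matched d S T \<and> (A, l, C) = index_of d S T"
proof -
  define S T where "S = {\<alpha> \<in> pos_roots n. A \<alpha> \<noteq> 0}" and "T = {\<alpha> \<in> pos_roots n. C \<alpha> \<noteq> 0}"
  have A: "A \<in> root_exps n" and C: "C \<in> root_exps n" and le: "content n A C k \<le> l k"
    and "add_roots n l A = (\<lambda>k. int (omega d k))" and "(\<lambda>k. int (omega d k)) = add_roots n l C" for k
    using assms by (auto simp: hecke_index_def Y_plus_index_def le_fun_def)
  then have addA: "add_roots n l A k = int (omega d k)" and addC: "add_roots n l C k = int (omega d k)" for k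
    by (metis fun_cong)+
  \<comment> \<open>Substituting \<lambda> from either weight equation into the content condition
    bounds starts plus ends by \<omega>. As \<omega> has entries 0 and 1, this gives the exponents,
    the injectivity, the disjointness and the range.\<close>
  have w1: "hits n fst A k + hits n snd C k \<le> omega d k" and w2: "hits n fst C k + hits n snd A k \<le> omega d k" for k
    using le[of k] addA[of k] addC[of k] by (auto simp: add_roots_def sum_root_hits content_hits)
  have om: "omega d k \<le> 1" for k by (simp add: omega_def)
  have h: "hits n fst A k \<le> 1" "hits n snd A k \<le> 1" "hits n fst C k \<le> 1" "hits n snd C k \<le> 1" for k
    using w1[of k] w2[of k] om[of k] by linarith+
  have A1: "A = (\<lambda>\<alpha>. of_bool (\<alpha> \<in> S))"
  proof
    fix \<alpha> show "A \<alpha> = of_bool (\<alpha> \<in> S)"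
      using hits_ge[of \<alpha> n A fst] h(1)[of "fst \<alpha>"] A by (cases \<alpha>) (auto simp: S_def root_exps_def)
  qed
  have C1: "C = (\<lambda>\<alpha>. of_bool (\<alpha> \<in> T))"
  proof
    fix \<alpha> show "C \<alpha> = of_bool (\<alpha> \<in> T)"
      using hits_ge[of \<alpha> n C fst] h(3)[of "fst \<alpha>"] C by (cases \<alpha>) (auto simp: T_def root_exps_def)
  qed
  have inj: "inj_on fst S" "inj_on snd S" "inj_on fst T" "inj_on snd T"
    using hits_inj[OF h(1) S_def] hits_inj[OF h(2) S_def] hits_inj[OF h(3) T_def] hits_inj[OF h(4) T_def] by auto
  have sub: "S \<subseteq> pos_roots n" "T \<subseteq> pos_roots n" by (auto simp: S_def T_def)
  note ind = hits_indicator[OF sub(1) inj(1), folded A1] hits_indicator[OF sub(1) inj(2), folded A1]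
    hits_indicator[OF sub(2) inj(3), folded C1] hits_indicator[OF sub(2) inj(4), folded C1]
  have w: "of_bool (k \<in> fst ` S) + of_bool (k \<in> snd ` T) \<le> omega d k"
    "of_bool (k \<in> fst ` T) + of_bool (k \<in> snd ` S) \<le> omega d k" for k
    using w1[of k] w2[of k] by (simp_all add: ind)
  have disj: "fst ` S \<inter> snd ` T = {}" "snd ` S \<inter> fst ` T = {}"
  proof -
    have "\<not> (k \<in> fst ` S \<and> k \<in> snd ` T)" "\<not> (k \<in> fst ` T \<and> k \<in> snd ` S)" for k
      using w[of k] om[of k] by (intro notI; elim conjE; simp)+
    then show "fst ` S \<inter> snd ` T = {}" "snd ` S \<inter> fst ` T = {}" by blast+
  qed
  have range: "k \<in> {1..d}" if "k \<in> fst ` S \<union> snd ` S \<union> fst ` T \<union> snd ` T" for k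
  proof (rule ccontr)
    assume "k \<notin> {1..d}"
    then have "omega d k = 0" by (auto simp: omega_def)
    with w[of k] have "k \<notin> fst ` S" "k \<notin> snd ` S" "k \<notin> fst ` T" "k \<notin> snd ` T"
      by simp_all
    with that show False by blast
  qed
  have "S \<subseteq> pos_roots d" "T \<subseteq> pos_roots d"
    using sub range by (force simp: pos_roots_def)+
  moreover have l: "int (l k) = int (omega d k) - (\<Sum>\<alpha>\<in>S. root \<alpha> k)" "int (l k) = int (omega d k) - (\<Sum>\<alpha>\<in>T. root \<alpha> k)" for k
    using addA[of k] addC[of k]
    by (simp_all add: add_roots_def sum_root_hits ind sum_root_matching[OF sub(1) inj(1,2)] sum_root_matching[OF sub(2) inj(3,4)])
  have "(\<Sum>\<alpha>\<in>S. root \<alpha> k) = (\<Sum>\<alpha>\<in>T. root \<alpha> k)" "l k = nat (int (omega d k) - (\<Sum>\<alpha>\<in>S. root \<alpha> k))" for k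
    using l[of k] by linarith+
  ultimately have "matched d S T \<and> (A, l, C) = index_of d S T"
    using inj disj A1 C1 by (auto simp: matched_def index_of_def)
  then show ?thesis by blast
qed

lemma matched_hecke_index:
  assumes "matched d S T" "d \<le> n"
  shows "index_of d S T \<in> hecke_index n d"
proof -
  let ?A = "\<lambda>\<alpha>. of_bool (\<alpha> \<in> S) :: nat" and ?C = "\<lambda>\<alpha>. of_bool (\<alpha> \<in> T) :: nat"
  have m: "S \<subseteq> pos_roots d" "T \<subseteq> pos_roots d" "inj_on fst S" "inj_on snd S" "inj_on fst T" "inj_on snd T"
    "fst ` S \<inter> snd ` T = {}" "snd ` S \<inter> fst ` T = {}"
    and eq: "(\<Sum>\<alpha>\<in>S. root \<alpha> k) = (\<Sum>\<alpha>\<in>T. root \<alpha> k)" for k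
    using assms(1) by (auto simp: matched_def)
  have sub: "S \<subseteq> pos_roots n" "T \<subseteq> pos_roots n"
    using m pos_roots_mono[OF assms(2)] by auto
  note ind = hits_indicator[OF sub(1) m(3)] hits_indicator[OF sub(1) m(4)]
    hits_indicator[OF sub(2) m(5)] hits_indicator[OF sub(2) m(6)]
  note sums = sum_root_matching[OF sub(1) m(3,4)] sum_root_matching[OF sub(2) m(5,6)]
  define l where "l k = nat (int (omega d k) - (\<Sum>\<alpha>\<in>S. root \<alpha> k))" for k
  have range: "k \<in> {1..d}" if "k \<in> fst ` S \<union> snd ` S \<union> fst ` T \<union> snd ` T" for k
    using that m(1,2) by (force simp: pos_roots_def)
  have om: "of_bool (k \<in> fst ` S) + of_bool (k \<in> snd ` T) \<le> omega d k" for k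
    using range[of k] m(7) by (auto simp: omega_def)
  have l: "int (l k) = int (omega d k) - (\<Sum>\<alpha>\<in>S. root \<alpha> k)" for k
    using om[of k] unfolding l_def sums(1) by (cases "k \<in> fst ` S"; cases "k \<in> snd ` S") simp_all
  have "content n ?A ?C k \<le> l k" for k
  proof -
    have "int (content n ?A ?C k) \<le> int (l k)"
      using om[of k] by (cases "k \<in> fst ` S"; cases "k \<in> snd ` S"; cases "k \<in> snd ` T")
        (simp_all add: content_hits ind l sums(1))
    then show ?thesis by simp
  qed
  moreover have "l \<in> Lam n d"
  proof -
    have "l k = 0" if "k \<notin> {1..n}" for k
    proof -
      have "k \<notin> {1..d}" using that assms(2) by auto
      then have "k \<notin> fst ` S" "k \<notin> snd ` S" "omega d k = 0" using range[of k] by (auto simp: omega_def)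
      then show ?thesis by (simp add: l_def sums(1))
    qed
    moreover have "(\<Sum>k=1..n. int (l k)) = int d"
    proof -
      have "(\<Sum>k=1..n. root \<alpha> k) = 0" if "\<alpha> \<in> S" for \<alpha>
        using that sub by (auto simp: root_eq sum_subtractf pos_roots_def of_bool_def)
      then have "(\<Sum>k=1..n. \<Sum>\<alpha>\<in>S. root \<alpha> k) = 0" by (subst sum.swap) simp
      moreover have "(\<Sum>k=1..n. int (omega d k)) = (\<Sum>k=1..d. 1)"
        by (rule sum.mono_neutral_cong_right) (use assms(2) in \<open>auto simp: omega_def\<close>)
      ultimately show ?thesis by (simp add: l sum_subtractf)
    qed
    then have "(\<Sum>k=1..n. l k) = d" by (simp flip: of_nat_sum)
    ultimately show ?thesis by (simp add: Lam_def)
  qed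
  moreover have "add_roots n l ?A k = int (omega d k)" "add_roots n l ?C k = int (omega d k)" for k
    unfolding add_roots_def sum_root_indicator[OF sub(1)] sum_root_indicator[OF sub(2)] l by (simp_all add: eq)
  ultimately show ?thesis
    using sub unfolding hecke_index_def Y_plus_index_def index_of_def l_def[abs_def, symmetric]
    by (auto simp: root_exps_def le_fun_def fun_eq_iff)
qed

text \<open>\<open>s\<close> sends the end of a root of \<open>S\<close> to its start and the start
  of a root of \<open>T\<close> to its end, and fixes every other point. The disjointness clauses
  make this single-valued and injective on moved points; equality of the sums gives
  \<open>same\<close>, which keeps fixed points apart from images of moved points.\<close>

lemma matched_permutation:
  assumes "matched d S T"
  shows "\<exists>s. s permutes {1..d} \<and> S = {(s k, k) | k. k \<in> {1..d} \<and> s k < k} \<and> T = {(k, s k) | k. k \<in> {1..d} \<and> k < s k}"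
proof -
  have m: "S \<subseteq> pos_roots d" "T \<subseteq> pos_roots d" "inj_on fst S" "inj_on snd S" "inj_on fst T" "inj_on snd T"
    "fst ` S \<inter> snd ` T = {}" "snd ` S \<inter> fst ` T = {}"
    and eq: "(\<Sum>\<alpha>\<in>S. root \<alpha> k) = (\<Sum>\<alpha>\<in>T. root \<alpha> k)" for k
    using assms by (auto simp: matched_def)
  have same: "k \<in> fst ` S \<union> snd ` T \<longleftrightarrow> k \<in> snd ` S \<union> fst ` T" for k
    using eq[of k] m(7,8) unfolding sum_root_matching[OF m(1,3,4)] sum_root_matching[OF m(2,5,6)]
    by (auto simp: of_bool_def split: if_splits)
  define R where "R = {(k, j). (j, k) \<in> S \<or> (k, j) \<in> T \<or> k = j \<and> k \<notin> snd ` S \<union> fst ` T}"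
  have func: "j = j'" if "(k, j) \<in> R" "(k, j') \<in> R" for k j j'
  proof -
    have "j = j'" if "(j, k) \<in> S" "(j', k) \<in> S" using inj_onD[OF m(4), of "(j, k)" "(j', k)"] that by simp
    moreover have "j = j'" if "(k, j) \<in> T" "(k, j') \<in> T" using inj_onD[OF m(5), of "(k, j)" "(k, j')"] that by simp
    moreover have "k \<in> snd ` S" if "(i, k) \<in> S" for i using that by force
    moreover have "k \<in> fst ` T" if "(k, i) \<in> T" for i using that by force
    ultimately show ?thesis using that m(8) unfolding R_def by blast
  qed
  have inj: "k = k'" if "(k, j) \<in> R" "(k', j) \<in> R" for k k' j
  proof -
    have "k = k'" if "(j, k) \<in> S" "(j, k') \<in> S" using inj_onD[OF m(3), of "(j, k)" "(j, k')"] that by simp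
    moreover have "k = k'" if "(k, j) \<in> T" "(k', j) \<in> T" using inj_onD[OF m(6), of "(k, j)" "(k', j)"] that by simp
    moreover have "j \<in> fst ` S" if "(j, i) \<in> S" for i using that by force
    moreover have "j \<in> snd ` T" if "(i, j) \<in> T" for i using that by force
    ultimately show ?thesis using that m(7) same[of j] unfolding R_def by blast
  qed
  have ex: "\<exists>j. (k, j) \<in> R" for k
  proof -
    consider "k \<in> snd ` S" | "k \<in> fst ` T" | "k \<notin> snd ` S \<union> fst ` T" by blast
    then show ?thesis by cases (auto simp: R_def)
  qed
  define s where "s k = (THE j. (k, j) \<in> R)" for k
  have s: "(k, j) \<in> R \<longleftrightarrow> j = s k" for k j
    unfolding s_def using theI'[of "\<lambda>j. (k, j) \<in> R"] ex[of k] func by blast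
  have sR: "(k, s k) \<in> R" for k using s by blast
  have lt: "i < j" "i \<in> {1..d}" "j \<in> {1..d}" if "(i, j) \<in> S \<or> (i, j) \<in> T" for i j
    using that m(1,2) by (auto simp: pos_roots_def)
  have "s permutes {1..d}"
  proof (rule bij_imp_permutes)
    have "inj_on s {1..d}" using inj sR by (metis inj_onI)
    moreover have "s ` {1..d} \<subseteq> {1..d}"
    proof (rule image_subsetI)
      fix k assume k: "k \<in> {1..d}"
      consider "(s k, k) \<in> S" | "(k, s k) \<in> T" | "s k = k"
        using sR[of k] unfolding R_def by auto
      then show "s k \<in> {1..d}" using lt(2)[of "s k" k] lt(3)[of k "s k"] k by cases auto
    qed
    ultimately show "bij_betw s {1..d} {1..d}"
      by (simp add: bij_betw_def endo_inj_surj)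
    show "s k = k" if "k \<notin> {1..d}" for k
      using sR[of k] that lt unfolding R_def by blast
  qed
  moreover have "(i, k) \<in> S \<longleftrightarrow> i = s k \<and> k \<in> {1..d} \<and> s k < k" for i k
    using s[of k i] lt[of i k] lt[of k i] unfolding R_def by auto
  moreover have "(k, j) \<in> T \<longleftrightarrow> j = s k \<and> k \<in> {1..d} \<and> k < s k" for j k
    using s[of k j] lt[of j k] lt[of k j] unfolding R_def by auto
  ultimately show ?thesis by (intro exI[of _ s]) auto
qed

text \<open>Covers every outcome of straightening, with \<open>S\<close> and \<open>T\<close>
  varying independently. Starts of \<open>S\<close> and ends of \<open>T\<close> lie in the
  \<open>s\<close>-images of disjoint sets of positions, and \<open>s\<close> is injective; ends of
  \<open>S\<close> and starts of \<open>T\<close> lie in these sets themselves.\<close>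

lemma permutation_matched:
  assumes s: "s permutes {1..d}" and "d \<le> n"
    and S: "S \<subseteq> pos_roots n" "inj_on fst S" "inj_on snd S"
      "fst ` S \<subseteq> fst ` set (deficient s (Suc d))" "snd ` S \<subseteq> snd ` set (deficient s (Suc d))"
      "\<And>k. (\<Sum>\<alpha>\<in>S. root \<alpha> k) = (\<Sum>\<alpha>\<in>set (deficient s (Suc d)). root \<alpha> k)"
    and T: "T \<subseteq> pos_roots n" "inj_on fst T" "inj_on snd T"
      "fst ` T \<subseteq> fst ` set (exceed s 1 d)" "snd ` T \<subseteq> snd ` set (exceed s 1 d)"
      "\<And>k. (\<Sum>\<alpha>\<in>T. root \<alpha> k) = (\<Sum>\<alpha>\<in>set (exceed s 1 d). root \<alpha> k)"
  shows "matched d S T"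
proof -
  have D: "set (deficient s (Suc d)) = (\<lambda>k. (s k, k)) ` {k \<in> {1..d}. s k < k}"
    and X: "set (exceed s 1 d) = (\<lambda>k. (k, s k)) ` {k \<in> {1..d}. k < s k}"
    by (auto simp: deficient_def exceed_def)
  have sd: "s k \<in> {1..d}" if "k \<in> {1..d}" for k using permutes_in_image[OF s] that by blast
  have inj: "s k = s k' \<Longrightarrow> k = k'" for k k' using permutes_inj[OF s] by (auto dest: injD)
  have S': "fst ` S \<subseteq> s ` {k \<in> {1..d}. s k < k}" "snd ` S \<subseteq> {k \<in> {1..d}. s k < k}"
    using S(4,5) unfolding D image_image by auto
  have T': "snd ` T \<subseteq> s ` {k \<in> {1..d}. k < s k}" "fst ` T \<subseteq> {k \<in> {1..d}. k < s k}"
    using T(4,5) unfolding X image_image by auto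
  have "s ` {k \<in> {1..d}. s k < k} \<inter> s ` {k \<in> {1..d}. k < s k} = {}"
    by (auto dest!: inj)
  then have "fst ` S \<inter> snd ` T = {}"
    using S'(1) T'(1) by blast
  moreover have "snd ` S \<inter> fst ` T = {}" using S'(2) T'(2) by fastforce
  moreover have "S \<subseteq> pos_roots d"
    using S(1) S' by (force simp: pos_roots_def)
  moreover have "T \<subseteq> pos_roots d"
    using T(1) T' sd by (force simp: pos_roots_def)
  moreover have "(\<Sum>\<alpha>\<in>S. root \<alpha> k) = (\<Sum>\<alpha>\<in>T. root \<alpha> k)" for k
  proof -
    have "(\<Sum>\<alpha>\<in>S. root \<alpha> k) = (\<Sum>j | j \<in> {1..d} \<and> s j < j. of_bool (s j = k) - of_bool (j = k))"
      unfolding S(6) D by (subst sum.reindex) (auto simp: inj_on_def root_eq)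
    moreover have "(\<Sum>\<alpha>\<in>T. root \<alpha> k) = (\<Sum>j | j \<in> {1..d} \<and> j < s j. of_bool (j = k) - of_bool (s j = k))"
      unfolding T(6) X by (subst sum.reindex) (auto simp: inj_on_def root_eq)
    moreover have "(\<Sum>j\<in>{1..d}. of_bool (s j = k) - of_bool (j = k) :: int)
       = (\<Sum>j | j \<in> {1..d} \<and> s j < j. of_bool (s j = k) - of_bool (j = k))
       + (\<Sum>j | j \<in> {1..d} \<and> j < s j. of_bool (s j = k) - of_bool (j = k))"
      by (subst sum.union_disjoint[symmetric]) (auto intro!: sum.mono_neutral_right simp: not_less le_less)
    \<comment> \<open>The sum of all differences between s j and j vanishes since \<open>s\<close>
      permutes 1..d; fixed points contribute nothing, so the deficient and the exceeding part
      balance.\<close>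
    moreover have "(\<Sum>j\<in>{1..d}. of_bool (s j = k)) = (\<Sum>j\<in>{1..d}. of_bool (j = k) :: int)"
      by (rule sum.permute[OF s, of "\<lambda>j. of_bool (j = k)", unfolded o_def, symmetric])
    moreover have "(\<Sum>j | j \<in> {1..d} \<and> j < s j. of_bool (j = k) - of_bool (s j = k) :: int)
        = - (\<Sum>j | j \<in> {1..d} \<and> j < s j. of_bool (s j = k) - of_bool (j = k))"
      by (simp add: sum_negf[symmetric])
    ultimately show ?thesis by (simp add: sum_subtractf)
  qed
  ultimately show ?thesis using S(2,3) T(2,3) by (simp add: matched_def)
qed

section \<open>Permutation words\<close>

definition omega_words :: "nat \<Rightarrow> nat \<Rightarrow> nat list set" where
  "omega_words n d = wwords n d (\<lambda>k. int (omega d k))"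

lemma distinct_count_list: "distinct xs \<Longrightarrow> count_list xs k = of_bool (k \<in> set xs)"
  by (induction xs) auto

lemma omega_words_iff:
  assumes "d \<le> n"
  shows "xs \<in> omega_words n d \<longleftrightarrow> distinct xs \<and> set xs = {1..d}"
proof
  assume "xs \<in> omega_words n d"
  then have *: "count_list xs k = omega d k" "length xs = d" for k
    by (auto simp: omega_words_def wwords_def words_def wt_def fun_eq_iff)
  then have "k \<in> set xs \<longleftrightarrow> k \<in> {1..d}" for k
    using count_list_0_iff[of xs k] by (auto simp: omega_def)
  then have "set xs = {1..d}" by blast
  with * show "distinct xs \<and> set xs = {1..d}" by (simp add: card_distinct)
next
  assume *: "distinct xs \<and> set xs = {1..d}"
  then have "length xs = d" using distinct_card[of xs] by simp
  with * assms show "xs \<in> omega_words n d"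
    by (auto simp: omega_words_def wwords_def words_def wt_def fun_eq_iff distinct_count_list omega_def)
qed

lemma permutation_word:
  assumes "s permutes {1..d}" "d \<le> n"
  shows "map s [1..<Suc d] \<in> omega_words n d"
  using permutes_image[OF assms(1)] permutes_inj_on[OF assms(1)]
  by (simp add: omega_words_iff[OF assms(2)] distinct_map atLeastLessThanSuc_atLeastAtMost del: upt_Suc)

lemma word_permutation:
  assumes "xs \<in> omega_words n d" "d \<le> n"
  shows "\<exists>s. s permutes {1..d} \<and> map s [1..<Suc d] = xs"
proof -
  have xs: "distinct xs" "set xs = {1..d}" using assms by (simp_all add: omega_words_iff)
  then have len: "length xs = d" using distinct_card[of xs] by simp
  define s where "s k = (if k \<in> {1..d} then xs ! (k - 1) else k)" for k
  have "s permutes {1..d}"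
  proof (rule bij_imp_permutes)
    have "inj_on s {1..d}"
    proof (rule inj_onI)
      fix x y assume "x \<in> {1..d}" "y \<in> {1..d}" "s x = s y"
      then have "x - 1 = y - 1"
        using nth_eq_iff_index_eq[OF xs(1), of "x - 1" "y - 1"] len by (auto simp: s_def)
      with \<open>x \<in> {1..d}\<close> \<open>y \<in> {1..d}\<close> show "x = y" by auto
    qed
    moreover have "s ` {1..d} \<subseteq> {1..d}"
    proof (rule image_subsetI)
      fix k assume k: "k \<in> {1..d}"
      then have "xs ! (k - 1) \<in> set xs" using len by (intro nth_mem) auto
      with k xs(2) show "s k \<in> {1..d}" by (simp add: s_def)
    qed
    ultimately show "bij_betw s {1..d} {1..d}" by (simp add: bij_betw_def endo_inj_surj)
  qed (auto simp: s_def)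
  moreover have "map s [1..<Suc d] = xs"
    by (rule nth_equalityI) (simp_all add: len s_def del: upt_Suc)
  ultimately show ?thesis by blast
qed

lemma stat_swap: "a < b \<Longrightarrow> stat (ps @ a # b # qs) < stat (ps @ b # a # qs)"
  by (induction ps) auto

lemma finite_omega_words: "finite (omega_words n d)"
  by (rule finite_subset[OF _ finite_lists_length_eq[of "{1..n}" d]])
    (auto simp: omega_words_def wwords_def words_def)

text \<open>The word of the permutation determines \<open>S\<close> and \<open>T\<close>, hence the
  index. The upper bound is enough, as the reverse inequality will come from spanning.\<close>

lemma card_hecke_index:
  assumes "d \<le> n"
  shows "finite (hecke_index n d) \<and> card (hecke_index n d) \<le> card (omega_words n d)"
proof -
  define f where "f xs = index_of d {(xs ! (k - 1), k) | k. k \<in> {1..d} \<and> xs ! (k - 1) < k}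
    {(k, xs ! (k - 1)) | k. k \<in> {1..d} \<and> k < xs ! (k - 1)}" for xs
  have "hecke_index n d \<subseteq> f ` omega_words n d"
  proof (rule subsetI)
    fix i assume "i \<in> hecke_index n d"
    moreover obtain A l C where "i = (A, l, C)" by (cases i)
    ultimately obtain S T where ST: "matched d S T" "i = index_of d S T"
      using hecke_index_matched by blast
    then obtain s where s: "s permutes {1..d}" "S = {(s k, k) | k. k \<in> {1..d} \<and> s k < k}"
      "T = {(k, s k) | k. k \<in> {1..d} \<and> k < s k}"
      using matched_permutation by blast
    have "map s [1..<Suc d] ! (k - 1) = s k" if "k \<in> {1..d}" for k
      using that by (subst nth_map) (auto simp del: upt_Suc)
    then have "f (map s [1..<Suc d]) = i"
      unfolding f_def ST(2) s(2,3) by (intro arg_cong2[of _ _ _ _ "index_of d"]) (force simp del: upt_Suc)+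
    then show "i \<in> f ` omega_words n d"
      using permutation_word[OF s(1) assms] by blast
  qed
  then show ?thesis
    using finite_omega_words by (meson card_image_le card_mono finite_imageI finite_subset le_trans)
qed

section \<open>Products of root vectors as operators\<close>

lemma lin_eq_asp:
  fixes f g :: "tens \<Rightarrow> tens"
  assumes "lin f" "lin g" "\<And>xs. xs \<in> S \<Longrightarrow> f (wd xs) = g (wd xs)" "t \<in> asp S"
  shows "f t = g t"
proof -
  have "f t - g t \<in> asp {}"
    by (rule lin_asp[OF lin_difff[OF assms(1,2)] Asub_asp _ assms(4)])
      (simp add: assms(3) Asub_0[OF Asub_asp])
  then show ?thesis by (auto dest: asp_empty)
qed

lemma foldr_XE_asp:
  "\<lbrakk>set L \<subseteq> pos_roots n; t \<in> asp (wwords n d m)\<rbrakk> \<Longrightarrow>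
    foldr (\<lambda>(i, l). XE n d i l) L t \<in> asp (wwords n d (\<lambda>k. m k + (\<Sum>\<alpha>\<leftarrow>L. root \<alpha> k)))"
proof (induction L)
  case (Cons \<alpha> L)
  obtain i l where \<alpha>: "\<alpha> = (i, l)" by (cases \<alpha>)
  have "XE n d i l (foldr (\<lambda>(i, l). XE n d i l) L t)
      \<in> asp (wwords n d (\<lambda>k. m k + (\<Sum>\<alpha>\<leftarrow>L. root \<alpha> k) + root (i, l) k))"
    using Cons \<alpha> by (intro XE_asp) (auto simp: pos_roots_def)
  then show ?case by (simp add: \<alpha> algebra_simps)
qed simp

lemma foldr_XF_asp:
  "\<lbrakk>set L \<subseteq> pos_roots n; t \<in> asp (wwords n d m)\<rbrakk> \<Longrightarrow>
    foldr (\<lambda>(i, l). XF n d i l) L t \<in> asp (wwords n d (\<lambda>k. m k - (\<Sum>\<alpha>\<leftarrow>L. root \<alpha> k)))"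
proof (induction L)
  case (Cons \<alpha> L)
  obtain i l where \<alpha>: "\<alpha> = (i, l)" by (cases \<alpha>)
  have "XF n d i l (foldr (\<lambda>(i, l). XF n d i l) L t)
      \<in> asp (wwords n d (\<lambda>k. m k - (\<Sum>\<alpha>\<leftarrow>L. root \<alpha> k) - root (i, l) k))"
    using Cons \<alpha> by (intro XF_asp) (auto simp: pos_roots_def)
  then show ?case by (simp add: \<alpha> algebra_simps)
qed simp

lemma div_pow_0: "div_pow x 0 = 1" and div_pow_1: "div_pow x (Suc 0) = x"
  using vv_diff by (simp_all add: div_pow_def qfact_def qint_def cst_1)

text \<open>With exponents 0 and 1 each divided power is 1 or the root vector. The projection
  \<open>tens_id\<close> remains because the empty product acts through it.\<close>

lemma E_mon_action:
  "set L \<subseteq> pos_roots n \<Longrightarrow> E_mon L (\<lambda>\<alpha>. of_bool (\<alpha> \<in> S)) \<in> uq_free n \<and>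
    free_act n d (E_mon L (\<lambda>\<alpha>. of_bool (\<alpha> \<in> S))) t
      = foldr (\<lambda>(i, l). XE n d i l) (filter (\<lambda>\<alpha>. \<alpha> \<in> S) L) (tens_id n d t)"
proof (induction L)
  case Nil
  then show ?case by (simp add: E_mon_def uq_free_1 free_act_1)
next
  case (Cons \<alpha> L)
  obtain i l where \<alpha>: "\<alpha> = (i, l)" by (cases \<alpha>)
  have il: "1 \<le> i" "i < l" "l \<le> n" using Cons.prems \<alpha> by (auto simp: pos_roots_def)
  from Cons root_vec_pos_action[OF il] show ?case
    by (cases "\<alpha> \<in> S") (auto simp: E_mon_def div_pow_0 div_pow_1 \<alpha> uq_free_mult free_act_mult)
qed

lemma F_mon_action:
  "set L \<subseteq> pos_roots n \<Longrightarrow> F_mon L (\<lambda>\<alpha>. of_bool (\<alpha> \<in> S)) \<in> uq_free n \<and>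
    (\<exists>c\<in>lau_units. \<forall>t. free_act n d (F_mon L (\<lambda>\<alpha>. of_bool (\<alpha> \<in> S))) t
      = scl c (foldr (\<lambda>(i, l). XF n d i l) (filter (\<lambda>\<alpha>. \<alpha> \<in> S) L) (tens_id n d t)))"
proof (induction L)
  case Nil
  then show ?case by (auto simp: F_mon_def uq_free_1 free_act_1 scl_simps intro!: bexI[of _ 1] lau_units_1)
next
  case (Cons \<alpha> L)
  obtain i l where \<alpha>: "\<alpha> = (i, l)" by (cases \<alpha>)
  have il: "1 \<le> i" "i < l" "l \<le> n" using Cons.prems \<alpha> by (auto simp: pos_roots_def)
  show ?case
  proof (cases "\<alpha> \<in> S")
    case True
    obtain c where c: "c \<in> lau_units" "free_act n d (F_mon L (\<lambda>\<alpha>. of_bool (\<alpha> \<in> S))) t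
      = scl c (foldr (\<lambda>(i, l). XF n d i l) (filter (\<lambda>\<alpha>. \<alpha> \<in> S) L) (tens_id n d t))" for t
      using Cons by auto
    have F: "F_mon (\<alpha> # L) (\<lambda>\<alpha>. of_bool (\<alpha> \<in> S)) = root_vec_neg i l * F_mon L (\<lambda>\<alpha>. of_bool (\<alpha> \<in> S))"
      using True by (simp add: F_mon_def div_pow_1 \<alpha>)
    have "(- vv) ^ (l - Suc i) * c \<in> lau_units"
      by (intro lau_units_mult lau_units_power lau_units_uminus lau_units_vv c)
    then show ?thesis
      using Cons root_vec_neg_action[OF il] True unfolding F
      by (intro conjI bexI[of _ "(- vv) ^ (l - Suc i) * c"])
        (auto simp: \<alpha> uq_free_mult free_act_mult c(2) XF_lin scl_simps)
  next
    case False
    then show ?thesis using Cons by (simp add: F_mon_def div_pow_0)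
  qed
qed

lemma weight_idem_asp:
  assumes "l \<in> Lam n d" "t \<in> asp (wwords n d m)"
  shows "free_act n d (weight_idem n l) t = (if m = (\<lambda>k. int (l k)) then t else 0)"
proof (rule lin_eq_asp[OF lin_free_act_right _ _ assms(2)])
  show "lin (\<lambda>t. if m = (\<lambda>k. int (l k)) then t else 0)" by (simp add: lin_def)
  show "free_act n d (weight_idem n l) (wd xs) = (if m = (\<lambda>k. int (l k)) then wd xs else 0)"
    if "xs \<in> wwords n d m" for xs
    using that weight_idem_wd[OF assms(1)] by (simp add: wwords_def)
qed

lemma asp_wwords_words: "t \<in> asp (wwords n d m) \<Longrightarrow> t \<in> asp (words n d)"
  using asp_mono[of "wwords n d m" "words n d"] by (auto simp: wwords_def)

lemma tens_lattice_words: "tens_lattice n d = asp (words n d)"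
  by (simp add: tens_lattice_asp words_def)

lemma asp_Int: "t \<in> asp S \<Longrightarrow> t \<in> asp T \<Longrightarrow> t \<in> asp (S \<inter> T)"
  by (auto simp: asp_def)

lemma omega_Lam: "d \<le> n \<Longrightarrow> omega d \<in> Lam n d"
proof -
  assume "d \<le> n"
  moreover from this have "(\<Sum>i=1..n. omega d i) = (\<Sum>i=1..d. 1)"
    by (intro sum.mono_neutral_cong_right) (auto simp: omega_def)
  ultimately show ?thesis by (auto simp: Lam_def omega_def)
qed

lemma vector_space_scl: "vector_space (scl :: qfield \<Rightarrow> tens \<Rightarrow> tens)"
  unfolding vector_space_def by (simp add: scl_simps) (simp add: scl_def cst_add distrib_right)

lemma matching_exceed:
  assumes "s permutes {1..d}" "d \<le> n"
  shows "matching n (exceed s 1 d)" "matching n (deficient s (Suc d))"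
proof -
  have sd: "s k \<in> {1..d}" if "k \<in> {1..d}" for k using permutes_in_image[OF assms(1)] that by blast
  have inj: "inj_on s A" for A using permutes_inj_on[OF assms(1)] .
  show "matching n (exceed s 1 d)"
    using sd assms(2) inj
    by (fastforce simp: matching_def exceed_def o_def pos_roots_def distinct_map simp del: upt_Suc)
  show "matching n (deficient s (Suc d))"
    using sd assms(2) inj
    by (fastforce simp: matching_def deficient_def o_def pos_roots_def distinct_map simp del: upt_Suc)
qed

section \<open>The integral Hecke algebra\<close>

locale hecke_basis =
  fixes n d :: nat and rs rs' :: "(nat \<times> nat) list"
  assumes d_le: "d \<le> n"
    and rs: "distinct rs" "set rs = pos_roots n"
    and rs': "distinct rs'" "set rs' = pos_roots n"
begin

definition basis :: "(nat \<times> nat \<Rightarrow> nat) \<times> (nat \<Rightarrow> nat) \<times> (nat \<times> nat \<Rightarrow> nat) \<Rightarrow> tens \<Rightarrow> tens" where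
  "basis = (\<lambda>(A, l, C). schur_elt n d (E_mon rs A * weight_idem n l * F_mon rs' C))"

abbreviation e\<omega> :: "tens \<Rightarrow> tens" where
  "e\<omega> \<equiv> free_act n d (weight_idem n (omega d))"

abbreviation \<Omega> :: "nat list set" where
  "\<Omega> \<equiv> omega_words n d"

definition w\<^sub>0 :: tens where
  "w\<^sub>0 = wd [1..<Suc d]"

text \<open>The product without its idempotent and without the powers of -v from the negative root
  vectors; by \<open>basis_wd\<close> this is the basis element on words of weight \<omega>, up to a
  unit.\<close>

definition mon :: "(nat \<times> nat) set \<Rightarrow> (nat \<times> nat) set \<Rightarrow> tens \<Rightarrow> tens" where
  "mon S T t = foldr (\<lambda>(i, l). XE n d i l) (filter (\<lambda>\<alpha>. \<alpha> \<in> S) rs)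
    (foldr (\<lambda>(i, l). XF n d i l) (filter (\<lambda>\<alpha>. \<alpha> \<in> T) rs') t)"

lemma id_omega_word: "[1..<Suc d] \<in> \<Omega>"
  using permutation_word[OF permutes_id d_le] by (simp add: id_def del: upt_Suc)

lemma omega_words_words: "xs \<in> \<Omega> \<Longrightarrow> xs \<in> words n d"
  by (simp add: omega_words_def wwords_def)

lemma weight_idem_free: "l \<in> Lam n d \<Longrightarrow> weight_idem n l \<in> uq_free n"
  using weight_idem_wd[of l n d "[1..<Suc d]"] omega_words_words[OF id_omega_word] by blast

lemma schur_elt_omega: "schur_elt n d (weight_idem n (omega d)) = e\<omega>"
  by (rule schur_elt_eq, rule weight_idem_free, rule omega_Lam, rule d_le)

lemma free_act_outside:
  assumes "xs \<notin> words n d"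
  shows "free_act n d u (wd xs) = 0"
proof -
  have "tens_id n d (wd xs) = 0"
    using assms by (auto simp: wd_def tens_id_single tens_words_def words_def)
  then show ?thesis
    using free_act_tens_id[of n d u "wd xs"] lin_simps(3)[OF lin_free_act_right] by metis
qed

lemma e_omega_wd: "e\<omega> (wd xs) = (if xs \<in> \<Omega> then wd xs else 0)"
  using weight_idem_wd[OF omega_Lam[OF d_le], of xs] free_act_outside[of xs]
  by (cases "xs \<in> words n d") (auto simp: omega_words_def wwords_def)

lemma e_omega_fixed: "t \<in> asp \<Omega> \<Longrightarrow> e\<omega> t = t"
  unfolding omega_words_def using weight_idem_asp[OF omega_Lam[OF d_le]] by simp

lemma e_omega_range: "t \<in> asp (words n d) \<Longrightarrow> e\<omega> t \<in> asp \<Omega>"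
  by (rule lin_asp[OF lin_free_act_right Asub_asp]) (simp_all add: e_omega_wd asp_wd Asub_0[OF Asub_asp])

lemma sum_filter:
  assumes "distinct L" "set L = pos_roots n" "S \<subseteq> pos_roots n"
  shows "(\<Sum>\<alpha>\<leftarrow>filter (\<lambda>\<alpha>. \<alpha> \<in> S) L. root \<alpha> k) = (\<Sum>\<alpha>\<in>S. root \<alpha> k)"
proof -
  have "set (filter (\<lambda>\<alpha>. \<alpha> \<in> S) L) = S" using assms by auto
  with assms(1) show ?thesis by (simp add: sum_list_distinct_conv_sum_set)
qed

lemma matched_sub:
  assumes "matched d S T"
  shows "S \<subseteq> pos_roots n" "T \<subseteq> pos_roots n" "(\<Sum>\<alpha>\<in>S. root \<alpha> k) = (\<Sum>\<alpha>\<in>T. root \<alpha> k)"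
  using assms pos_roots_mono[OF d_le] by (auto simp: matched_def)

lemma mon_asp:
  assumes "matched d S T" "xs \<in> \<Omega>"
  shows "mon S T (wd xs) \<in> asp \<Omega>"
proof -
  note ST = matched_sub[OF assms(1)]
  have "mon S T (wd xs) \<in> asp (wwords n d (\<lambda>k. int (omega d k) - (\<Sum>\<alpha>\<leftarrow>filter (\<lambda>\<alpha>. \<alpha> \<in> T) rs'. root \<alpha> k)
      + (\<Sum>\<alpha>\<leftarrow>filter (\<lambda>\<alpha>. \<alpha> \<in> S) rs. root \<alpha> k)))"
    unfolding mon_def using assms(2) rs rs'
    by (intro foldr_XE_asp foldr_XF_asp asp_wd) (auto simp: omega_words_def)
  then show ?thesis
    by (simp add: sum_filter[OF rs ST(1)] sum_filter[OF rs' ST(2)] ST(3) omega_words_def)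
qed

text \<open>The F part lowers the weight by the sum of \<open>T\<close>, and \<lambda> plus that sum
  is \<omega>. Hence the idempotent lets through exactly what started in weight \<omega>.\<close>

lemma basis_wd:
  assumes "matched d S T"
  shows "\<exists>u\<in>uq_free n. basis (index_of d S T) = free_act n d u"
    and "\<exists>c\<in>lau_units. \<forall>xs. basis (index_of d S T) (wd xs) = (if xs \<in> \<Omega> then scl c (mon S T (wd xs)) else 0)"
proof -
  note ST = matched_sub[OF assms]
  obtain A l C where i: "index_of d S T = (A, l, C)" by (cases "index_of d S T")
  then have A: "A = (\<lambda>\<alpha>. of_bool (\<alpha> \<in> S))" and C: "C = (\<lambda>\<alpha>. of_bool (\<alpha> \<in> T))" by (auto simp: index_of_def)
  have "(A, l, C) \<in> hecke_index n d"
    using matched_hecke_index[OF assms d_le] i by simp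
  then have l: "l \<in> Lam n d" and "add_roots n l A k = int (omega d k)" for k
    by (auto simp: hecke_index_def Y_plus_index_def fun_eq_iff)
  then have lk: "int (l k) = int (omega d k) - (\<Sum>\<alpha>\<in>T. root \<alpha> k)" for k
    unfolding add_roots_def A sum_root_indicator[OF ST(1)] ST(3)[symmetric] by (metis add_diff_cancel_right')
  note E = E_mon_action[of rs n S d, folded A]
  note F = F_mon_action[of rs' n T d, folded C]
  have Ef: "E_mon rs A \<in> uq_free n" and Wf: "weight_idem n l \<in> uq_free n" and Ff: "F_mon rs' C \<in> uq_free n"
    using E F weight_idem_free[OF l] rs rs' by auto
  have free: "E_mon rs A * weight_idem n l * F_mon rs' C \<in> uq_free n"
    by (intro uq_free_mult Ef Wf Ff)
  have b: "basis (index_of d S T) = free_act n d (E_mon rs A * weight_idem n l * F_mon rs' C)"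
    by (simp add: i basis_def schur_elt_eq[OF free])
  with free show "\<exists>u\<in>uq_free n. basis (index_of d S T) = free_act n d u" by blast
  obtain c where c: "c \<in> lau_units" "\<And>t. free_act n d (F_mon rs' C) t
      = scl c (foldr (\<lambda>(i, l). XF n d i l) (filter (\<lambda>\<alpha>. \<alpha> \<in> T) rs') (tens_id n d t))"
    using F rs' by blast
  have "basis (index_of d S T) (wd xs) = (if xs \<in> \<Omega> then scl c (mon S T (wd xs)) else 0)" for xs
  proof (cases "xs \<in> words n d")
    case True
    let ?f = "foldr (\<lambda>(i, l). XF n d i l) (filter (\<lambda>\<alpha>. \<alpha> \<in> T) rs') (wd xs)"
    let ?m = "\<lambda>k. wt xs k - (\<Sum>\<alpha>\<leftarrow>filter (\<lambda>\<alpha>. \<alpha> \<in> T) rs'. root \<alpha> k)"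
    have f: "?f \<in> asp (wwords n d ?m)"
      using True rs' by (intro foldr_XF_asp asp_wd) (auto simp: wwords_def)
    have m: "?m = (\<lambda>k. int (l k)) \<longleftrightarrow> wt xs = (\<lambda>k. int (omega d k))"
      by (simp add: fun_eq_iff lk sum_filter[OF rs' ST(2)])
    have "basis (index_of d S T) (wd xs) = free_act n d (E_mon rs A) (free_act n d (weight_idem n l) (scl c ?f))"
      by (simp add: b free_act_mult Wf Ff c(2) tens_id_wd True)
    also have "\<dots> = scl c (free_act n d (E_mon rs A) (if wt xs = (\<lambda>k. int (omega d k)) then ?f else 0))"
      by (simp add: lin_scl[OF lin_free_act_right] weight_idem_asp[OF l f] m)
    also have "\<dots> = (if xs \<in> \<Omega> then scl c (mon S T (wd xs)) else 0)"
    proof (cases "wt xs = (\<lambda>k. int (omega d k))")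
      case wt: True
      then show ?thesis using E rs tens_id_asp[OF asp_wwords_words[OF f]] True
        by (simp add: omega_words_def wwords_def mon_def)
    next
      case False
      then show ?thesis
        by (simp add: omega_words_def wwords_def lin_simps[OF lin_free_act_right] scl_simps)
    qed
    finally show ?thesis .
  next
    case False
    then show ?thesis using free_act_outside omega_words_words by (auto simp: b)
  qed
  with c(1) show "\<exists>c\<in>lau_units. \<forall>xs. basis (index_of d S T) (wd xs) = (if xs \<in> \<Omega> then scl c (mon S T (wd xs)) else 0)"
    by blast
qed

section \<open>Elements of the integral Hecke algebra\<close>

lemma hecke_A_iff: "f \<in> hecke_A n d \<longleftrightarrow>
    (\<exists>u\<in>uq_free n. (\<forall>t\<in>asp (words n d). free_act n d u t \<in> asp (words n d)) \<and> f = e\<omega> \<circ> free_act n d u \<circ> e\<omega>)"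
  unfolding hecke_A_def schur_A_def schur_eq schur_elt_omega tens_lattice_words by blast

text \<open>The element maps words to integral vectors of weight \<omega> and kills all words of
  other weights, so it is unchanged by the idempotent on both sides.\<close>

lemma basis_hecke: "matched d S T \<Longrightarrow> basis (index_of d S T) \<in> hecke_A n d"
proof -
  assume m: "matched d S T"
  obtain u where u: "u \<in> uq_free n" "basis (index_of d S T) = free_act n d u"
    using basis_wd(1)[OF m] by blast
  obtain c where c: "c \<in> lau_units"
    "\<And>xs. basis (index_of d S T) (wd xs) = (if xs \<in> \<Omega> then scl c (mon S T (wd xs)) else 0)"
    using basis_wd(2)[OF m] by blast
  have \<Omega>: "basis (index_of d S T) (wd xs) \<in> asp \<Omega>" for xs
    unfolding c(2) using c(1) m mon_asp by (auto intro: Asub_scl[OF Asub_asp] Asub_0[OF Asub_asp] lau_units_lau)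
  have "free_act n d u t \<in> asp (words n d)" if "t \<in> asp (words n d)" for t
    by (rule lin_asp[OF lin_free_act_right Asub_asp _ that])
      (use asp_wwords_words[OF \<Omega>[unfolded omega_words_def]] u(2) in simp)
  moreover have "basis (index_of d S T) = e\<omega> \<circ> free_act n d u \<circ> e\<omega>"
  proof
    fix t
    show "basis (index_of d S T) t = (e\<omega> \<circ> free_act n d u \<circ> e\<omega>) t"
    proof (rule wd_eqI[where t = t])
      show "lin (basis (index_of d S T))" by (simp add: u(2) lin_free_act_right)
      show "lin (e\<omega> \<circ> free_act n d u \<circ> e\<omega>)" by (intro lin_comp lin_free_act_right)
      show "basis (index_of d S T) (wd xs) = (e\<omega> \<circ> free_act n d u \<circ> e\<omega>) (wd xs)" for xs
        using e_omega_fixed[OF \<Omega>[of xs]] c(2)[of xs] unfolding u(2)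
        by (cases "xs \<in> \<Omega>") (simp_all only: o_def e_omega_wd if_True if_False lin_simps(3)[OF lin_free_act_right])
    qed
  qed
  ultimately show ?thesis using u(1) unfolding hecke_A_iff by blast
qed

lemma hecke_A_subspace: "laurent_mod.subspace (hecke_A n d)"
proof -
  have "0 \<in> hecke_A n d"
    unfolding hecke_A_iff
    by (intro bexI[of _ 0])
      (auto simp: fun_eq_iff free_act_simps Asub_0[OF Asub_asp] uq_free_0 lin_simps[OF lin_free_act_right])
  moreover have "f + g \<in> hecke_A n d" if fg: "f \<in> hecke_A n d" "g \<in> hecke_A n d" for f g
  proof -
    obtain u where u: "u \<in> uq_free n" "\<forall>t\<in>asp (words n d). free_act n d u t \<in> asp (words n d)"
      "f = e\<omega> \<circ> free_act n d u \<circ> e\<omega>" using fg unfolding hecke_A_iff by blast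
    obtain u' where u': "u' \<in> uq_free n" "\<forall>t\<in>asp (words n d). free_act n d u' t \<in> asp (words n d)"
      "g = e\<omega> \<circ> free_act n d u' \<circ> e\<omega>" using fg unfolding hecke_A_iff by blast
    show ?thesis unfolding hecke_A_iff
      by (intro bexI[of _ "u + u'"])
        (use u u' in \<open>auto simp: fun_eq_iff free_act_simps uq_free_add lin_simps[OF lin_free_act_right] intro: Asub_add[OF Asub_asp]\<close>)
  qed
  moreover have "laurent_scale a f \<in> hecke_A n d" if f: "f \<in> hecke_A n d" for a f
  proof -
    obtain u where u: "u \<in> uq_free n" "\<forall>t\<in>asp (words n d). free_act n d u t \<in> asp (words n d)"
      "f = e\<omega> \<circ> free_act n d u \<circ> e\<omega>" using f unfolding hecke_A_iff by blast
    have "of_laurent a \<in> lau" by (simp add: lau_def)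
    with u(2) have "cst (of_laurent a) * free_act n d u t \<in> asp (words n d)" if "t \<in> asp (words n d)" for t
      using that Asub_scl[OF Asub_asp, of "of_laurent a" "free_act n d u t"] by (simp add: scl_def)
    with u(1,3) show ?thesis unfolding hecke_A_iff
      by (intro bexI[of _ "cst (of_laurent a) * u"])
        (auto simp: fun_eq_iff laurent_scale_def free_act_simps uq_free_mult uq_free_cst lin_simps[OF lin_free_act_right])
  qed
  ultimately show ?thesis by (simp add: laurent_mod.subspace_def)
qed

lemma hecke_A_wd:
  assumes "f \<in> hecke_A n d"
  shows "lin f" "f (wd xs) = (if xs \<in> \<Omega> then f (wd xs) else 0)" "xs \<in> \<Omega> \<Longrightarrow> f (wd xs) \<in> asp \<Omega>"
    "Suc k < d \<Longrightarrow> f (hecke_op k t) = hecke_op k (f t)"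
proof -
  obtain u where u: "\<forall>t\<in>asp (words n d). free_act n d u t \<in> asp (words n d)"
    "f = e\<omega> \<circ> free_act n d u \<circ> e\<omega>" using assms unfolding hecke_A_iff by blast
  show "lin f" unfolding u(2) by (intro lin_comp lin_free_act_right)
  show "f (wd xs) = (if xs \<in> \<Omega> then f (wd xs) else 0)"
    by (simp add: u(2) e_omega_wd lin_simps[OF lin_free_act_right])
  show "f (wd xs) \<in> asp \<Omega>" if "xs \<in> \<Omega>"
    using e_omega_range[OF u(1)[rule_format, OF asp_wd[OF omega_words_words[OF that]]]] that
    by (simp add: u(2) e_omega_wd)
  show "f (hecke_op k t) = hecke_op k (f t)" if "Suc k < d"
    by (simp add: u(2) free_act_hecke[OF that])
qed

text \<open>A word with a descent is the image, under one Hecke operator, of the word with that pair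
  sorted: on an ascending pair the operator is a plain swap without error term. The sorted word has
  smaller \<open>stat\<close>, and the operator commutes with \<open>f\<close>.\<close>

lemma hecke_A_determined:
  assumes f: "f \<in> hecke_A n d" and 0: "f w\<^sub>0 = 0"
  shows "f = 0"
proof -
  have "f (wd xs) = 0" if "xs \<in> \<Omega>" for xs
    using that
  proof (induction "stat xs" arbitrary: xs rule: less_induct)
    case less
    have xs: "distinct xs" "set xs = {1..d}" using less.prems d_le by (simp_all add: omega_words_iff)
    then have len: "length xs = d" using distinct_card[of xs] by simp
    show ?case
    proof (cases "sorted xs")
      case True
      have "xs = [1..<Suc d]"
        by (rule sorted_distinct_set_unique[OF True xs(1)])
          (simp_all only: sorted_upt distinct_upt xs(2) set_upt atLeastLessThanSuc_atLeastAtMost)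
      with 0 show ?thesis by (simp add: w\<^sub>0_def del: upt_Suc)
    next
      case False
      then obtain i where i: "Suc i < length xs" "xs ! Suc i < xs ! i"
        unfolding sorted_iff_nth_Suc by (auto simp: not_le)
      let ?ps = "take i xs" and ?qs = "drop (Suc (Suc i)) xs"
      have split: "xs = ?ps @ xs ! i # xs ! Suc i # ?qs"
        using i id_take_nth_drop[of i xs] Cons_nth_drop_Suc[of "Suc i" xs] by simp
      let ?ys = "?ps @ xs ! Suc i # xs ! i # ?qs"
      have "set ?ys = set (?ps @ xs ! i # xs ! Suc i # ?qs)" "distinct ?ys = distinct (?ps @ xs ! i # xs ! Suc i # ?qs)"
        by auto
      then have ys: "?ys \<in> \<Omega>"
        using xs unfolding omega_words_iff[OF d_le] split[symmetric] by simp
      have "stat ?ys < stat xs" using stat_swap[OF i(2), of ?ps ?qs] split by simp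
      then have "f (wd ?ys) = 0" using ys less.hyps by blast
      moreover have "wd xs = hecke_op i (wd ?ys)"
        using hecke_op_swap[OF i(2), of ?ps ?qs] split i(1) by simp
      ultimately show ?thesis
        using hecke_A_wd(4)[OF f, of i "wd ?ys"] i(1) len by (simp add: hecke_lin)
    qed
  qed
  then have "f (wd xs) = 0" for xs using hecke_A_wd(2)[OF f, of xs] by (cases "xs \<in> \<Omega>") auto
  then have "f t = 0" for t
    using wd_eqI[OF hecke_A_wd(1)[OF f] lin_0f] by simp
  then show ?thesis by (simp add: fun_eq_iff)
qed

text \<open>Working with values at \<open>w\<^sub>0\<close> turns the spanning statement for
  operators into one about an \<A>-submodule of tensor space, where straightening and leading terms
  apply.\<close>

definition orbit :: "tens set" where
  "orbit = (\<lambda>g. g w\<^sub>0) ` laurent_mod.span (basis ` hecke_index n d)"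

lemma Asub_orbit: "Asub orbit"
  unfolding Asub_def
proof (intro conjI ballI)
  show "0 \<in> orbit"
    unfolding orbit_def by (rule image_eqI[of _ _ 0]) (simp_all add: laurent_mod.span_zero)
next
  fix x y assume "x \<in> orbit" "y \<in> orbit"
  then obtain f g where "f \<in> laurent_mod.span (basis ` hecke_index n d)" "x = f w\<^sub>0"
    "g \<in> laurent_mod.span (basis ` hecke_index n d)" "y = g w\<^sub>0"
    by (auto simp: orbit_def)
  then show "x + y \<in> orbit"
    unfolding orbit_def by (intro image_eqI[of _ _ "f + g"] laurent_mod.span_add) simp_all
next
  fix c x assume "c \<in> lau" "x \<in> orbit"
  then obtain a g where "c = of_laurent a" "g \<in> laurent_mod.span (basis ` hecke_index n d)" "x = g w\<^sub>0"
    by (auto simp: lau_def orbit_def)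
  then show "scl c x \<in> orbit"
    unfolding orbit_def by (intro image_eqI[of _ _ "laurent_scale a g"] laurent_mod.span_scale) (simp_all add: laurent_scale_def scl_def)
qed

lemma mon_orbit:
  assumes "matched d S T"
  shows "mon S T w\<^sub>0 \<in> orbit"
proof -
  have "basis (index_of d S T) \<in> laurent_mod.span (basis ` hecke_index n d)"
    by (intro laurent_mod.span_base imageI matched_hecke_index assms d_le)
  then have "basis (index_of d S T) w\<^sub>0 \<in> orbit" by (simp add: orbit_def)
  moreover obtain c where "c \<in> lau_units" "basis (index_of d S T) w\<^sub>0 = scl c (mon S T w\<^sub>0)"
    using basis_wd(2)[OF assms] id_omega_word by (auto simp: w\<^sub>0_def)
  ultimately show ?thesis using Asub_unit[OF Asub_orbit] by simp
qed

text \<open>The F factors are straightened first, inside the preimage of \<open>orbit\<close> under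
  the E product; then the E factors are straightened for each resulting \<open>T\<close>. Every pair
  that occurs is matched.\<close>

lemma stage_orbit:
  assumes s: "s permutes {1..d}"
  shows "foldr (\<lambda>(i, l). XE n d i l) (deficient s (Suc d)) (foldr (\<lambda>(i, l). XF n d i l) (exceed s 1 d) w\<^sub>0) \<in> orbit"
proof -
  interpret E: straight n "\<lambda>(i, l). XE n d i l" by (rule straight_E)
  interpret F: straight n "\<lambda>(i, l). XF n d i l" by (rule straight_F)
  note match = matching_exceed[OF s d_le]
  have "foldr (\<lambda>(i, l). XF n d i l) (exceed s 1 d) w\<^sub>0
      \<in> {t. foldr (\<lambda>(i, l). XE n d i l) (deficient s (Suc d)) t \<in> orbit}"
  proof (rule F.straighten[OF Asub_vimage[OF Asub_orbit E.lin_foldr_Y] match(1) rs'], unfold mem_Collect_eq)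
    fix T assume T: "T \<subseteq> pos_roots n" "inj_on fst T" "inj_on snd T"
      "fst ` T \<subseteq> fst ` set (exceed s 1 d)" "snd ` T \<subseteq> snd ` set (exceed s 1 d)"
      "\<And>k. (\<Sum>\<alpha>\<in>T. root \<alpha> k) = (\<Sum>\<alpha>\<in>set (exceed s 1 d). root \<alpha> k)"
    show "foldr (\<lambda>(i, l). XE n d i l) (deficient s (Suc d))
        (foldr (\<lambda>(i, l). XF n d i l) (filter (\<lambda>\<alpha>. \<alpha> \<in> T) rs') w\<^sub>0) \<in> orbit"
    proof (rule E.straighten[OF Asub_orbit match(2) rs])
      fix S assume S: "S \<subseteq> pos_roots n" "inj_on fst S" "inj_on snd S"
        "fst ` S \<subseteq> fst ` set (deficient s (Suc d))" "snd ` S \<subseteq> snd ` set (deficient s (Suc d))"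
        "\<And>k. (\<Sum>\<alpha>\<in>S. root \<alpha> k) = (\<Sum>\<alpha>\<in>set (deficient s (Suc d)). root \<alpha> k)"
      have "matched d S T" by (rule permutation_matched[OF s d_le S T])
      then show "foldr (\<lambda>(i, l). XE n d i l) (filter (\<lambda>\<alpha>. \<alpha> \<in> S) rs)
          (foldr (\<lambda>(i, l). XF n d i l) (filter (\<lambda>\<alpha>. \<alpha> \<in> T) rs') w\<^sub>0) \<in> orbit"
        using mon_orbit by (simp add: mon_def)
    qed
  qed
  then show ?thesis by simp
qed

text \<open>Confines the error words of \<open>E_stage\<close> to permutation words, so that the
  induction over \<open>stat\<close> can reach them.\<close>

lemma stage_asp:
  assumes s: "s permutes {1..d}"
  shows "foldr (\<lambda>(i, l). XE n d i l) (deficient s (Suc d)) (foldr (\<lambda>(i, l). XF n d i l) (exceed s 1 d) w\<^sub>0) \<in> asp \<Omega>"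
proof -
  note match = matching_exceed[OF s d_le]
  have dist: "distinct (deficient s (Suc d))" "distinct (exceed s 1 d)"
    using match by (auto simp: matching_def distinct_map)
  have "matched d (set (deficient s (Suc d))) (set (exceed s 1 d))"
    by (rule permutation_matched[OF s d_le]) (use match in \<open>auto simp: matching_def distinct_map\<close>)
  then have "(\<Sum>\<alpha>\<leftarrow>exceed s 1 d. root \<alpha> k) = (\<Sum>\<alpha>\<leftarrow>deficient s (Suc d). root \<alpha> k)" for k
    using dist by (simp add: sum_list_distinct_conv_sum_set matched_def)
  moreover have "foldr (\<lambda>(i, l). XE n d i l) (deficient s (Suc d)) (foldr (\<lambda>(i, l). XF n d i l) (exceed s 1 d) w\<^sub>0)
    \<in> asp (wwords n d (\<lambda>k. int (omega d k) - (\<Sum>\<alpha>\<leftarrow>exceed s 1 d. root \<alpha> k) + (\<Sum>\<alpha>\<leftarrow>deficient s (Suc d). root \<alpha> k)))"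
    using match id_omega_word unfolding w\<^sub>0_def
    by (intro foldr_XE_asp foldr_XF_asp asp_wd) (auto simp: matching_def omega_words_def simp del: upt_Suc)
  ultimately show ?thesis by (simp add: omega_words_def)
qed

lemma word_orbit:
  assumes "xs \<in> \<Omega>"
  shows "wd xs \<in> orbit"
  using assms
proof (induction "stat xs" arbitrary: xs rule: less_induct)
  case less
  obtain s where s: "s permutes {1..d}" "map s [1..<Suc d] = xs"
    using word_permutation[OF less.prems d_le] by blast
  let ?E = "foldr (\<lambda>(i, l). XE n d i l) (deficient s (Suc d))"
  let ?y = "map (\<lambda>p. if p < 1 \<or> p \<le> s p then s p else p) [1..<Suc d]"
  have linE: "lin ?E"
  proof -
    interpret E: straight n "\<lambda>(i, l). XE n d i l" by (rule straight_E)
    show ?thesis by (rule E.lin_foldr_Y)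
  qed
  have y: "map (\<lambda>p. if 1 \<le> p \<and> p < s p then s p else p) [1..<Suc d] = ?y"
    by (rule map_cong) (auto simp del: upt_Suc)
  obtain c where c: "c \<in> lau_units" "foldr (\<lambda>(i, l). XF n d i l) (exceed s 1 d) w\<^sub>0 = scl c (wd ?y)"
    using F_stage[OF s(1) d_le, of 1] unfolding y w\<^sub>0_def by auto
  have "?E (wd ?y) \<in> orbit" "?E (wd ?y) \<in> asp \<Omega>"
    using stage_orbit[OF s(1)] stage_asp[OF s(1)] Asub_unit[OF Asub_orbit c(1)] Asub_unit[OF Asub_asp c(1)]
    unfolding c(2) lin_scl[OF linE] by blast+
  note Ey = this
  have xs: "map (\<lambda>p. if p < Suc d \<or> p \<le> s p then s p else p) [1..<Suc d] = xs"
    unfolding s(2)[symmetric] by (rule map_cong) (auto simp del: upt_Suc)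
  obtain c' where c': "c' \<in> lau_units" "?E (wd ?y) - scl c' (wd xs) \<in> asp {zs \<in> words n d. stat zs < stat xs \<and>
      (\<forall>k p. Suc d \<le> k \<longrightarrow> k \<le> p \<longrightarrow> p < d \<longrightarrow> zs ! p \<noteq> k)}"
    using E_stage[OF s(1) d_le, of "Suc d"] unfolding xs by auto
  have "?E (wd ?y) - scl c' (wd xs) \<in> asp \<Omega>"
    using Ey(2) less.prems c'(1) by (intro Asub_diff Asub_scl Asub_asp asp_wd lau_units_lau)
  \<comment> \<open>The error terms are permutation words with smaller \<open>stat\<close>, hence in
    \<open>orbit\<close> by induction.\<close>
  from asp_Int[OF c'(2) this] have "?E (wd ?y) - scl c' (wd xs) \<in> orbit"
    by (rule asp_subset[OF _ Asub_orbit]) (use less.hyps in auto)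
  from Asub_diff[OF Asub_orbit Ey(1) this] have "scl c' (wd xs) \<in> orbit" by simp
  then show ?case using Asub_unit[OF Asub_orbit c'(1)] by simp
qed

text \<open>The value of \<open>f\<close> at \<open>w\<^sub>0\<close> is an \<A>-combination of
  permutation words, so it agrees with the value of some \<open>g\<close> in the span;
  \<open>f - g\<close> then vanishes by \<open>hecke_A_determined\<close>.\<close>

lemma span_basis: "laurent_mod.span (basis ` hecke_index n d) = hecke_A n d"
proof (rule antisym)
  have "basis ` hecke_index n d \<subseteq> hecke_A n d"
  proof (rule image_subsetI)
    fix i assume "i \<in> hecke_index n d"
    then show "basis i \<in> hecke_A n d"
      using hecke_index_matched basis_hecke by (cases i) metis
  qed
  then show le: "laurent_mod.span (basis ` hecke_index n d) \<subseteq> hecke_A n d"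
    by (rule laurent_mod.span_minimal[OF _ hecke_A_subspace])
  show "hecke_A n d \<subseteq> laurent_mod.span (basis ` hecke_index n d)"
  proof
    fix f assume f: "f \<in> hecke_A n d"
    have "f w\<^sub>0 \<in> orbit"
      using asp_subset[OF hecke_A_wd(3)[OF f id_omega_word] Asub_orbit word_orbit] by (simp add: w\<^sub>0_def)
    then obtain g where g: "g \<in> laurent_mod.span (basis ` hecke_index n d)" "f w\<^sub>0 = g w\<^sub>0"
      by (auto simp: orbit_def)
    have "f - g \<in> hecke_A n d"
      by (rule laurent_mod.subspace_diff[OF hecke_A_subspace f]) (use g le in blast)
    then have "f - g = 0" by (rule hecke_A_determined) (simp add: g(2))
    with g(1) show "f \<in> laurent_mod.span (basis ` hecke_index n d)" by simp
  qed
qed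

theorem hecke_A_basis: "is_A_basis basis (hecke_index n d) (hecke_A n d)"
proof -
  interpret vs: vector_space "scl :: qfield \<Rightarrow> tens \<Rightarrow> tens" by (rule vector_space_scl)
  let ?I = "hecke_index n d" and ?ev = "\<lambda>g :: tens \<Rightarrow> tens. g w\<^sub>0"
  define B where "B = (\<lambda>i. basis i w\<^sub>0) ` ?I"
  have fin: "finite ?I" and cardI: "card ?I \<le> card \<Omega>"
    using card_hecke_index[OF d_le] by auto
  have "inj_on wd \<Omega>"
    by (rule inj_onI) (simp add: wd_def, metis fword.inject lookup_single_eq lookup_single_not_eq zero_neq_one)
  then have cardW: "card (wd ` \<Omega>) = card \<Omega>" by (rule card_image)
  have indW: "vs.independent (wd ` \<Omega>)"
    unfolding vs.dependent_explicit
  proof (rule notI, elim exE conjE bexE)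
    fix t u v assume t: "finite t" "t \<subseteq> wd ` \<Omega>" "(\<Sum>v\<in>t. scl (u v) v) = 0" "v \<in> t" "u v \<noteq> 0"
    then obtain xs where xs: "v = wd xs" by auto
    have "0 = (\<Sum>v\<in>t. u v * Poly_Mapping.lookup v (FWord xs))"
      using arg_cong[OF t(3), of "\<lambda>x. Poly_Mapping.lookup x (FWord xs)"] by (simp add: lookup_sum lookup_scl)
    also have "\<dots> = (\<Sum>v\<in>{wd xs}. u v * Poly_Mapping.lookup v (FWord xs))"
      by (rule sum.mono_neutral_right) (use t xs in \<open>auto simp: lookup_wd\<close>)
    finally show False using t(5) xs by (simp add: lookup_wd)
  qed
  have spanB: "wd ` \<Omega> \<subseteq> vs.span B"
  proof -
    have "g w\<^sub>0 \<in> vs.span B" if "g \<in> laurent_mod.span (basis ` ?I)" for g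
      using that
    proof (induction rule: laurent_mod.span_induct_alt)
      case base
      then show ?case by (simp add: vs.span_zero)
    next
      case (step a f g)
      then have "f w\<^sub>0 \<in> B" by (auto simp: B_def)
      then have "scl (of_laurent a) (f w\<^sub>0) + g w\<^sub>0 \<in> vs.span B"
        using step by (intro vs.span_add[OF vs.span_scale[OF vs.span_base]])
      moreover have "(laurent_scale a f + g) w\<^sub>0 = scl (of_laurent a) (f w\<^sub>0) + g w\<^sub>0"
        by (simp add: laurent_scale_def scl_def)
      ultimately show ?case by simp
    qed
    then show ?thesis using word_orbit by (fastforce simp: orbit_def)
  qed
  have finB: "finite B" using fin by (simp add: B_def)
  \<comment> \<open>The permutation words are independent over \<rat>(v) and lie in the span of
    \<open>B\<close>, so |\<Omega>| \<le> |B| \<le> |I| \<le> |\<Omega>|; the equalities make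
    evaluation at \<open>w\<^sub>0\<close> injective on the index set.\<close>
  have "card \<Omega> \<le> card B"
    using vs.independent_span_bound[OF finB indW spanB] cardW by simp
  moreover have "card B \<le> card ?I" unfolding B_def by (rule card_image_le[OF fin])
  ultimately have cardB: "card B = card ?I" "card B = card \<Omega>" using cardI by linarith+
  then have inj: "inj_on (\<lambda>i. basis i w\<^sub>0) ?I"
    unfolding B_def by (intro eq_card_imp_inj_on fin)
  \<comment> \<open>Otherwise one vector of \<open>B\<close> could be dropped, leaving too few
    vectors to span.\<close>
  have indB: "vs.independent B"
  proof
    assume "vs.dependent B"
    then obtain a where a: "a \<in> B" "a \<in> vs.span (B - {a})" by (auto simp: vs.dependent_def)
    then have "vs.span (B - {a}) = vs.span B" using vs.span_redundant[OF a(2)] by (simp add: insert_absorb)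
    then have "wd ` \<Omega> \<subseteq> vs.span (B - {a})" using spanB by simp
    then have "card \<Omega> \<le> card (B - {a})"
      using vs.independent_span_bound[OF _ indW] finB cardW by (metis finite_Diff)
    moreover have "card (B - {a}) < card B" using a(1) finB by (rule card_Diff1_less[rotated])
    ultimately show False using cardB by simp
  qed
  have inj_ev: "inj_on ?ev (basis ` ?I)"
    using inj by (auto simp: inj_on_def)
  have "\<not> laurent_mod.dependent (basis ` ?I)"
    unfolding laurent_mod.dependent_explicit
  proof (rule notI, elim exE conjE bexE)
    fix t u v assume t: "finite t" "t \<subseteq> basis ` ?I" "(\<Sum>v\<in>t. laurent_scale (u v) v) = 0" "v \<in> t" "u v \<noteq> 0"
    have inj_t: "inj_on ?ev t" using inj_ev t(2) by (rule inj_on_subset)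
    \<comment> \<open>An \<A>-relation between operators, evaluated at \<open>w\<^sub>0\<close>,
      becomes a \<rat>(v)-relation between vectors; injectivity of the evaluation lets its
      coefficients be indexed by the values.\<close>
    define w where "w x = of_laurent (u (the_inv_into t ?ev x))" for x
    have w: "w (?ev g) = of_laurent (u g)" if "g \<in> t" for g
      by (simp add: w_def the_inv_into_f_f[OF inj_t that])
    have ev_sum: "(\<Sum>g\<in>t'. laurent_scale (u g) g) w\<^sub>0 = (\<Sum>g\<in>t'. scl (of_laurent (u g)) (g w\<^sub>0))" for t'
      by (induction t' rule: infinite_finite_induct) (simp_all add: laurent_scale_def scl_def)
    have "(\<Sum>x\<in>?ev ` t. scl (w x) x) = (\<Sum>g\<in>t. scl (of_laurent (u g)) (g w\<^sub>0))"
      by (subst sum.reindex[OF inj_t]) (auto intro!: sum.cong simp: w)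
    also have "\<dots> = 0" using fun_cong[OF t(3), of w\<^sub>0] by (simp add: ev_sum)
    finally have sum: "(\<Sum>x\<in>?ev ` t. scl (w x) x) = 0" .
    have "?ev ` t \<subseteq> B" using t(2) by (auto simp: B_def)
    moreover have "of_laurent (u v) \<noteq> 0"
    proof
      assume "of_laurent (u v) = 0"
      moreover have "of_laurent 0 = 0" by (simp add: of_laurent_def Zero_fract_def)
      ultimately show False using inj_of_laurent t(5) by (metis injD)
    qed
    then have "\<exists>x\<in>?ev ` t. w x \<noteq> 0" using w t(4) by auto
    ultimately show False using indB sum t(1) unfolding vs.dependent_explicit by blast
  qed
  moreover have "inj_on basis ?I" using inj by (auto simp: inj_on_def)
  ultimately show ?thesis by (simp add: is_A_basis_def span_basis)
qed

end

theorem mainTheorem8: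
  fixes n d :: nat and rs rs' :: "(nat \<times> nat) list"
  assumes "n \<ge> 1" and "n \<ge> d"
    and "distinct rs" and "set rs = pos_roots n"
    and "distinct rs'" and "set rs' = pos_roots n"
  shows "is_A_basis
    (\<lambda>(A, l, C). schur_elt n d (E_mon rs A * weight_idem n l * F_mon rs' C))
    {(A, l, C) \<in> Y_plus_index n d.
       add_roots n l A = (\<lambda>k. int (omega d k)) \<and> (\<lambda>k. int (omega d k)) = add_roots n l C}
    (hecke_A n d)"
proof -
  interpret hecke_basis n d rs rs'
    by standard (use assms in auto)
  show ?thesis
    using hecke_A_basis by (simp only: basis_def hecke_index_def)
qed



end
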